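(* Let $N,n,C\ge 1$. For each $c\in[C]$ let $\{X_{c,1},\dots,X_{c,n}\}$ be a set of $N\times N$ quaternionic random matrices, the sets for different $c$ being independent of each other. Suppose that for each $c$ there is a function $f_c$, with complex values, defined on $\mathrm{PM}(I)$ for every $I\subseteq[n]$, such that for every $I\subseteq[n]$ and all $\iota:\pm I\to[N]$, $\eta:\pm I\to\{1,-1\}$, $$\mathbb{E}\Big(\prod_{k\in I}X^{(c,k)}_{\iota_k,\iota_{-k};\eta_k,\eta_{-k}}\Big)=\sum_{\substack{\alpha\in\mathrm{PM}(I)\\ \iota=\iota\circ\delta\alpha\\ \mathrm{sgn}\cdot\eta=(\mathrm{sgn}\circ\alpha)\cdot(\eta\circ\delta\alpha)}}\Big[\prod_{\substack{k\in I\\ -k\in\mathrm{FD}(\alpha)}}\eta_k\eta_{-k}\Big](2N)^{\#(\alpha)/2-|I|}f_c(\alpha).$$ Let $w:[n]\to[C]$, $X_k=X_{w(k),k}$, let $Y_1,\dots,Y_n$ be $N\times N$ quaternionic random matrices independent from the $X_k$, let $\varepsilon:[n]\to\{1,-1\}$, and let $\varphi_{\mathrm{Re}},\varphi_{\mathrm{tr}}\in S([n]_\infty)$, where $[n]_\infty=[n]\cup\{\infty\}$. Then, as an identity of $N\times N$ quaternionic matrices, $$\mathbb{E}\big(\mathrm{Re}_{\varphi_{\mathrm{Re}}}\mathrm{tr}_{\varphi_{\mathrm{tr}}}(X_1^{(\varepsilon_1)}Y_1,\dots,X_n^{(\varepsilon_n)}Y_n)\big)$$ $$=\sum_{\substack{\alpha=\alpha_1\cdots\alpha_C\\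 \alpha_c\in\mathrm{PM}(w^{-1}(c))}}(-2)^{\chi(\varphi_{\mathrm{Re}},\delta_\varepsilon\alpha\delta_\varepsilon)-2\#(\varphi_{\mathrm{Re}})}N^{\chi(\varphi_{\mathrm{tr}},\delta_\varepsilon\alpha\delta_\varepsilon)-2\#(\varphi_{\mathrm{tr}})}f_1(\alpha_1)\cdots f_C(\alpha_C)$$ $$\qquad\times\,\mathbb{E}\big(\mathrm{Re}_{\mathrm{FD}(K(\varphi_{\mathrm{Re}},\delta_\varepsilon\alpha\delta_\varepsilon)^{-1})}\mathrm{tr}_{\mathrm{FD}(K(\varphi_{\mathrm{tr}},\delta_\varepsilon\alpha\delta_\varepsilon)^{-1})}(Y_1,\dots,Y_n)\big),$$ where $\alpha$ is taken to act trivially on $\pm\infty$, and its cycles are counted as those of a permutation on $\pm[n]_\infty$.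
   Context: Quaternions. $a+bi+cj+dk$ is represented by the $2\times2$ complex matrix $\begin{pmatrix}a+bi&c+di\\-c+di&a-bi\end{pmatrix}$, rows and columns indexed by $1,-1$ in this order. For a quaternionic matrix $A$, $A_{\iota_1,\iota_2;\eta_1,\eta_2}$ is the $(\eta_1,\eta_2)$ entry of the $2\times 2$ matrix representing the quaternion in position $(\iota_1,\iota_2)$. $A^*$ is the conjugate transpose. For matrices $A_1,A_2,\dots$ write $A^{(k)}$ for $A_k$ and $A^{(-k)}$ for $A_k^*$ when indices are attached; $X^{(c,k)}$ means $X_{c,k}$. $X_k^{(\varepsilon_k)}$ is $X_k$ if $\varepsilon(k)=1$ and $X_k^*$ if $\varepsilon(k)=-1$. Permutations. $[n]=\{1,\dots,n\}$, $\pm I=I\cup(-I)$; $\infty$ and $-\infty$ are two distinct formal points, $\infty$ being positive. $S(I)$ is the group of permutations of $I$, acting right to left. $\#(\pi)$ is the number of orbits of $\pi$. $\delta:k\mapsto-k$. $\mathrm{sgn}(k)$ is the sign of $k$; $\cdot$ is pointwise multiplication of functions. $\delta_\varepsilon$ is $k\mapsto\varepsilon(|k|)k$ on $\pm[n]$ and fixes $\pm\infty$. Permutations are extended by the identity where needed. $\mathrm{PM}(I)$ is the set of $\pi\in S(\pm I)$ with $\delta\pi\delta=\pi^{-1}$ and with no $k$ and $-k$ in the same cycle. The cycles of $\pi\in\mathrm{PM}(I)$ come in pairs (order and signs reversed); $\mathrm{FD}(\pi)$ is the product of those cycles, one from each pair, in which $\infty$ (if $\pm\infty$ occurs in the pair),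 or otherwise the element of smallest absolute value, appears with positive sign, viewed as a permutation on the elements of these cycles; $\mathrm{FD}(\pi)$ also denotes that set of elements. So $\#(\mathrm{FD}(\pi))=\#(\pi)/2$. For $\varphi_+\in S(I)$ (with $I$ never containing both $k$ and $-k$) let $\varphi_-=\delta\varphi_+\delta$. For $\alpha\in\mathrm{PM}(I)$, $K(\varphi_+,\alpha)=\varphi_+^{-1}\alpha^{-1}\varphi_-$ and $\chi(\varphi_+,\alpha)=\#(\varphi_+\varphi_-^{-1})/2+\#(\alpha)/2+\#(K(\varphi_+,\alpha))/2-|I|$, the permutations being on $\pm I$ (here $I=[n]_\infty$). Traces along permutations with a point at infinity. For $\pi,\rho\in\mathrm{PM}([n]_\infty)$ and $N\times N$ quaternionic matrices $A_1,\dots,A_n$, $\mathrm{Re}_{\mathrm{FD}(\pi)}\mathrm{tr}_{\mathrm{FD}(\rho)}(A_1,\dots,A_n)$ is the $N\times N$ quaternionic matrix whose entry with indices $r,c;s,t$ is $$2^{-(\#(\mathrm{FD}(\pi))-1)}N^{-(\#(\mathrm{FD}(\rho))-1)}\sum_{i}\sum_{h}\ \prod_{k\in\mathrm{FD}(\pi)\setminus\{\infty\}}A^{(k)}_{i_k,i_{-k};h_k,h_{\pi(k)}},$$ where $i$ runs over functions $\pm[n]_\infty\to[N]$ with $i_{-k}=i_{\rho(k)}$ for all $k$, $i_{-\infty}=r$ and $i_\infty=c$, and $h$ runs over functions $\mathrm{FD}(\pi)\to\{1,-1\}$ with $h_{\pi(\infty)}=s$ and $h_\infty=t$ (an empty sum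 is $0$). For example if both permutations are $(\infty,1,2)$ the result is $A_1A_2$; if $\infty$ is fixed by both, it is a scalar times the identity. For $\varphi\in S([n]_\infty)$, a subscript $\varphi$ means this with $\pi$ (or $\rho$) equal to $\varphi\,\delta\varphi^{-1}\delta\in\mathrm{PM}([n]_\infty)$, whose $\mathrm{FD}$ is taken to be $\varphi$. All expectations written are assumed to exist. *)

theory Defs
  imports
    "HOL-Probability.Probability"
    "HOL-Combinatorics.Orbits"
    "HOL-Library.Extended"
begin

section \<open>Quaternions and quaternionic matrices\<close>

text \<open>
  The vector with components \<open>$1, $2, $3, $4\<close> stands for the quaternion
  \<open>a + b i + c j + d k\<close>; this gives quaternions and quaternionic matrices their usual Borel
  structure.  Pitfall: the library's \<open>*\<close> on \<^typ>\<open>real ^ 4\<close> is componentwise and its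
  \<open>**\<close> is built on that, so neither is used for quaternions; see \<open>qtimes\<close> and
  \<open>qmm\<close>.
\<close>

type_synonym quat = "real ^ 4"

definition qtimes :: "quat \<Rightarrow> quat \<Rightarrow> quat" where
  "qtimes p q = vector
     [p $ 1 * q $ 1 - p $ 2 * q $ 2 - p $ 3 * q $ 3 - p $ 4 * q $ 4,
      p $ 1 * q $ 2 + p $ 2 * q $ 1 + p $ 3 * q $ 4 - p $ 4 * q $ 3,
      p $ 1 * q $ 3 - p $ 2 * q $ 4 + p $ 3 * q $ 1 + p $ 4 * q $ 2,
      p $ 1 * q $ 4 + p $ 2 * q $ 3 - p $ 3 * q $ 2 + p $ 4 * q $ 1]"

definition qcnj :: "quat \<Rightarrow> quat" where
  "qcnj q = vector [q $ 1, - q $ 2, - q $ 3, - q $ 4]"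

text \<open>Only the arguments \<open>1\<close> and \<open>-1\<close> of \<open>s\<close> and \<open>t\<close> are meaningful.\<close>

definition qentry :: "quat \<Rightarrow> int \<Rightarrow> int \<Rightarrow> complex" where
  "qentry q s t =
     (if s = 1
      then (if t = 1 then Complex (q $ 1) (q $ 2) else Complex (q $ 3) (q $ 4))
      else (if t = 1 then Complex (- q $ 3) (q $ 4) else Complex (q $ 1) (- q $ 2)))"

lemma vector_4_nth [simp]:
  "(vector [a, b, c, d] :: quat) $ 1 = a" "(vector [a, b, c, d] :: quat) $ 2 = b"
  "(vector [a, b, c, d] :: quat) $ 3 = c" "(vector [a, b, c, d] :: quat) $ 4 = d"
  by (simp_all add: vector_def)

lemma qentry_qtimes:
  assumes "s \<in> {1, -1}" "t \<in> {1, -1}"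
  shows "qentry (qtimes p q) s t = (\<Sum>u\<in>{1, -1}. qentry p s u * qentry q u t)"
  using assms by (auto simp: qentry_def qtimes_def complex_eq_iff algebra_simps)

lemma qentry_qcnj:
  assumes "s \<in> {1, -1}" "t \<in> {1, -1}"
  shows "qentry (qcnj q) s t = cnj (qentry q t s)"
  using assms by (auto simp: qentry_def qcnj_def complex_eq_iff)

definition qmm :: "quat ^ 'N ^ 'N \<Rightarrow> quat ^ 'N ^ 'N \<Rightarrow> quat ^ 'N ^ 'N" where
  "qmm A B = (\<chi> i j. \<Sum>l\<in>UNIV. qtimes (A $ i $ l) (B $ l $ j))"

definition qadjoint :: "quat ^ 'N ^ 'N \<Rightarrow> quat ^ 'N ^ 'N" where
  "qadjoint A = (\<chi> i j. qcnj (A $ j $ i))"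

definition qpow :: "quat ^ 'N ^ 'N \<Rightarrow> int \<Rightarrow> quat ^ 'N ^ 'N" where
  "qpow A e = (if e = 1 then A else qadjoint A)"

section \<open>Signed points and their permutations\<close>

text \<open>
  The elements of \<open>\<plusminus>[n]\<close> are \<^term>\<open>Fin k\<close> with \<open>1 \<le> \<bar>k\<bar> \<le> n\<close>, and \<open>\<infinity>\<close>, \<open>-\<infinity>\<close> are
  \<^term>\<open>Pinf\<close>, \<^term>\<open>Minf\<close>; \<open>\<delta>\<close> is \<^term>\<open>uminus\<close>.
  A permutation of a set of points is a function on all points that is the identity off the set,
  so permutations of different sets compose without further ado.
\<close>

type_synonym point = "int extended"

definition fin_points :: "nat \<Rightarrow> point set" where
  "fin_points n = Fin ` {1..int n}"

definition inf_points :: "nat \<Rightarrow> point set" where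
  "inf_points n = insert Pinf (fin_points n)"

definition pm :: "point set \<Rightarrow> point set" where
  "pm I = I \<union> uminus ` I"

definition point_sgn :: "point \<Rightarrow> int" where
  "point_sgn k = (if 0 < k then 1 else -1)"

definition point_abs :: "point \<Rightarrow> point" where
  "point_abs k = max k (- k)"

text \<open>The set \<open>S\<close> matters because fixed points count as orbits.\<close>

definition num_orbits :: "point set \<Rightarrow> (point \<Rightarrow> point) \<Rightarrow> nat" where
  "num_orbits S p = card (orbit p ` S)"

definition PM :: "point set \<Rightarrow> (point \<Rightarrow> point) set" where
  "PM I = {p. p permutes pm I \<and> uminus \<circ> p \<circ> uminus = inv p \<and> (\<forall>k\<in>pm I. - k \<notin> orbit p k)}"

text \<open>
  This is \<open>FD\<close> as a set of points; as a permutation it is the restriction of \<open>p\<close> to that set.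
\<close>

definition FD :: "point set \<Rightarrow> (point \<Rightarrow> point) \<Rightarrow> point set" where
  "FD I p = {k \<in> pm I.
     if Pinf \<in> orbit p k \<or> Minf \<in> orbit p k then Pinf \<in> orbit p k
     else \<exists>m\<in>orbit p k. 0 < m \<and> (\<forall>l\<in>orbit p k. point_abs m \<le> point_abs l)}"

definition delta_eps :: "nat \<Rightarrow> (point \<Rightarrow> int) \<Rightarrow> point \<Rightarrow> point" where
  "delta_eps n e k = (if k \<in> pm (fin_points n) \<and> e (point_abs k) = -1 then - k else k)"

text \<open>\<open>p\<^sub>-\<close>, and the permutation \<open>p p\<^sub>-\<^sup>-\<^sup>1 = p \<delta> p\<^sup>-\<^sup>1 \<delta>\<close>.\<close>

definition minus_perm :: "(point \<Rightarrow> point) \<Rightarrow> point \<Rightarrow> point" where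
  "minus_perm p = uminus \<circ> p \<circ> uminus"

definition double_perm :: "(point \<Rightarrow> point) \<Rightarrow> point \<Rightarrow> point" where
  "double_perm p = p \<circ> inv (minus_perm p)"

definition K :: "(point \<Rightarrow> point) \<Rightarrow> (point \<Rightarrow> point) \<Rightarrow> point \<Rightarrow> point" where
  "K p a = inv p \<circ> inv a \<circ> minus_perm p"

text \<open>
  The divisions by \<open>2\<close> are exact for \<open>a \<in> PM I\<close> and \<open>p\<close> a permutation of \<open>I\<close>: the cycles of the
  three permutations come in pairs.
\<close>

definition chi :: "point set \<Rightarrow> (point \<Rightarrow> point) \<Rightarrow> (point \<Rightarrow> point) \<Rightarrow> int" where
  "chi I p a =
     int (num_orbits (pm I) (double_perm p) div 2) + int (num_orbits (pm I) a div 2)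
       + int (num_orbits (pm I) (K p a) div 2) - int (card I)"

section \<open>Traces along permutations\<close>

definition signed_mat :: "(point \<Rightarrow> quat ^ 'N ^ 'N) \<Rightarrow> point \<Rightarrow> quat ^ 'N ^ 'N" where
  "signed_mat A k = (if 0 < k then A k else qadjoint (A (- k)))"

text \<open>
  The entry of the quaternionic matrix with matrix position \<open>(r, c)\<close> and quaternion
  position \<open>(s, t)\<close>.  For \<open>p, q \<in> PM (inf_points n)\<close> both \<open>FD\<close> contain the cycle of
  \<^term>\<open>Pinf\<close>, so the exponents do not truncate.
\<close>

definition re_tr ::
  "nat \<Rightarrow> (point \<Rightarrow> point) \<Rightarrow> (point \<Rightarrow> point) \<Rightarrow> (point \<Rightarrow> quat ^ 'N::finite ^ 'N)
    \<Rightarrow> 'N \<Rightarrow> 'N \<Rightarrow> int \<Rightarrow> int \<Rightarrow> complex" where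
  "re_tr n p q A r c s t =
     (let J = inf_points n; D = FD J p in
      (\<Sum>i | i \<in> (pm J \<rightarrow>\<^sub>E UNIV) \<and> (\<forall>k\<in>pm J. i (- k) = i (q k)) \<and> i Minf = r \<and> i Pinf = c.
       \<Sum>h | h \<in> (D \<rightarrow>\<^sub>E {1, -1}) \<and> h (p Pinf) = s \<and> h Pinf = t.
         \<Prod>k\<in>D - {Pinf}. qentry (signed_mat A k $ i k $ i (- k)) (h k) (h (p k)))
      / (2 ^ (num_orbits D p - 1) * of_nat CARD('N) ^ (num_orbits (FD J q) q - 1)))"

text \<open>
  The version for permutations of \<open>[n]\<^sub>\<infinity>\<close>.  The convention that \<open>FD\<close> of \<^term>\<open>double_perm p\<close>
  is \<open>p\<close> itself holds automatically, see \<open>FD_double_perm\<close> and \<open>double_perm_eq\<close>.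
\<close>

definition re_tr_perm ::
  "nat \<Rightarrow> (point \<Rightarrow> point) \<Rightarrow> (point \<Rightarrow> point) \<Rightarrow> (point \<Rightarrow> quat ^ 'N::finite ^ 'N)
    \<Rightarrow> 'N \<Rightarrow> 'N \<Rightarrow> int \<Rightarrow> int \<Rightarrow> complex" where
  "re_tr_perm n p q = re_tr n (double_perm p) (double_perm q)"

lemma uminus_point_uminus [simp]: "- (- k) = (k :: point)"
  by (cases k) auto

lemma inf_points_pos: "k \<in> inf_points n \<Longrightarrow> 0 < k"
  by (auto simp: inf_points_def fin_points_def zero_extended_def)

lemma uminus_notin_inf_points: "k \<in> inf_points n \<Longrightarrow> - k \<notin> inf_points n"
  by (auto simp: inf_points_def fin_points_def)

lemma bij_uminus_point: "bij (uminus :: point \<Rightarrow> point)"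
  by (rule o_bij[where g = uminus]) (auto simp: fun_eq_iff)

lemma inv_minus_perm:
  assumes "p permutes S"
  shows "inv (minus_perm p) = minus_perm (inv p)"
  by (rule inv_unique_comp)
    (use permutes_inverses[OF assms] in \<open>auto simp: minus_perm_def fun_eq_iff\<close>)

lemma double_perm_eq:
  assumes "p permutes inf_points n" and "k \<in> inf_points n"
  shows "double_perm p k = p k"
  unfolding double_perm_def inv_minus_perm[OF assms(1)]
  using permutes_not_in[OF permutes_inv[OF assms(1)] uminus_notin_inf_points[OF assms(2)]]
  by (simp add: minus_perm_def)

lemma FD_double_perm:
  assumes p: "p permutes inf_points n"
  shows "FD (inf_points n) (double_perm p) = inf_points n"
proof -
  have ip: "inv p permutes inf_points n"
    using p by (rule permutes_inv)
  have pos: "orbit (double_perm p) k \<subseteq> inf_points n" if k: "k \<in> inf_points n" for k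
  proof
    fix l assume "l \<in> orbit (double_perm p) k"
    then show "l \<in> inf_points n"
      by induction (use k p in \<open>simp_all add: double_perm_eq permutes_in_image\<close>)
  qed
  have step: "double_perm p l \<in> uminus ` inf_points n" if l: "l \<in> uminus ` inf_points n" for l
  proof -
    obtain m where m: "l = - m" "m \<in> inf_points n"
      using l by auto
    have "inv p m \<in> inf_points n"
      using m ip by (simp add: permutes_in_image)
    then have "p (- inv p m) = - inv p m"
      by (rule permutes_not_in[OF p uminus_notin_inf_points])
    then show ?thesis
      using \<open>inv p m \<in> inf_points n\<close> m
      unfolding double_perm_def inv_minus_perm[OF p] by (simp add: minus_perm_def)
  qed
  have neg: "orbit (double_perm p) k \<subseteq> uminus ` inf_points n" if k: "k \<in> uminus ` inf_points n" for k
  proof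
    fix l assume "l \<in> orbit (double_perm p) k"
    then show "l \<in> uminus ` inf_points n"
      by induction (use k step in auto)
  qed
  have fin: "finite (inf_points n)"
    by (simp add: inf_points_def fin_points_def)
  have "k \<in> FD (inf_points n) (double_perm p)" if k: "k \<in> inf_points n" for k
  proof -
    let ?O = "orbit (double_perm p) k"
    have f: "finite (point_abs ` ?O)" "point_abs ` ?O \<noteq> {}"
      using pos[OF k] fin by (auto intro: finite_subset simp: orbit_nonempty)
    obtain m where m: "m \<in> ?O" "\<forall>l\<in>?O. point_abs m \<le> point_abs l"
      using Min_in[OF f] Min_le[OF f(1)] by (metis imageE imageI)
    have "Minf \<notin> ?O"
      using pos[OF k] inf_points_pos by (fastforce simp: zero_extended_def)
    moreover have "0 < m"
      using m pos[OF k] inf_points_pos by blast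
    ultimately show ?thesis
      using m k by (auto simp: FD_def pm_def)
  qed
  moreover have "k \<notin> FD (inf_points n) (double_perm p)" if k: "k \<in> uminus ` inf_points n" for k
  proof -
    have "\<not> 0 < l" if "l \<in> orbit (double_perm p) k" for l
      using that neg[OF k]
      by (auto simp: inf_points_def fin_points_def zero_extended_def)
    then have "Pinf \<notin> orbit (double_perm p) k"
      "\<not> (\<exists>m\<in>orbit (double_perm p) k. 0 < m)"
      by (force simp: zero_extended_def)+
    then show ?thesis
      by (auto simp: FD_def)
  qed
  moreover have "FD (inf_points n) (double_perm p) \<subseteq> inf_points n \<union> uminus ` inf_points n"
    by (auto simp: FD_def pm_def)
  ultimately show ?thesis
    by blast
qed

section \<open>The moment hypothesis\<close>

definition moment_index_set ::
  "point set \<Rightarrow> (point \<Rightarrow> 'N) \<Rightarrow> (point \<Rightarrow> int) \<Rightarrow> (point \<Rightarrow> point) set" where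
  "moment_index_set I \<iota> \<eta> =
     {\<alpha> \<in> PM I.
        (\<forall>k\<in>pm I. \<iota> k = \<iota> (- \<alpha> k)) \<and>
        (\<forall>k\<in>pm I. point_sgn k * \<eta> k = point_sgn (\<alpha> k) * \<eta> (- \<alpha> k))}"

text \<open>The order of composition is \<open>\<alpha>\<^sub>1 \<circ> \<dots> \<circ> \<alpha>\<^sub>C\<close>.\<close>

definition compose_perms :: "nat \<Rightarrow> (nat \<Rightarrow> point \<Rightarrow> point) \<Rightarrow> point \<Rightarrow> point" where
  "compose_perms C a = foldr (\<lambda>c p. a c \<circ> p) [1..<Suc C] id"

end

theory Submission
  imports Defs
begin

text \<open>
  Let \<open>J = [n]\<^sub>\<infinity>\<close>, and let \<open>\<delta>\<close> be the change of sign of a point.  The entry of an adjoint is, up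
  to a sign, an entry of the original matrix with both positions exchanged and both quaternion
  indices exchanged and negated.  A trace along \<open>p\<close> and \<open>q\<close> is therefore a sum over two functions
  on all of \<open>\<plusminus>J\<close>, a position index \<open>i\<close> with \<open>i \<circ> \<delta> = i \<circ> q\<close> and a quaternion index \<open>h\<close> with
  \<open>sgn \<cdot> (h \<circ> \<delta>) = (sgn \<cdot> h) \<circ> p\<close>, in which only the matrices themselves occur; the adjoints leave
  behind the sign \<open>\<Prod> h k * h (- k)\<close> over the \<open>k\<close> with \<open>- k\<close> in \<open>FD p\<close> (\<open>re_tr_symmetric\<close>).

  Expanding the products of the matrices introduces one new index per factor, and the constraint
  of the trace makes one index per factor redundant; what remains is a sum over functions on
  \<open>\<plusminus>J\<close> with prescribed values at three points (\<open>re_tr_perm_qmm\<close>).  Taking the expectation of the \<open>X\<close> part brings constraints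
  back, now \<open>i = i \<circ> \<delta>\<beta>\<close> and \<open>sgn \<cdot> h = (sgn \<circ> \<beta>) \<cdot> (h \<circ> \<delta>\<beta>)\<close> with
  \<open>\<beta> = \<delta>\<^sub>\<epsilon>\<alpha>\<delta>\<^sub>\<epsilon>\<close> (\<open>moment_expansion\<close>).  Substituting \<open>\<phi>\<delta>\<close> into the index functions turns
  these constraints into those of the trace along \<open>\<phi>\<^sub>-\<^sup>-\<^sup>1\<beta>\<phi>\<close>, which is the inverse of
  \<open>K \<phi> \<beta>\<close> (\<open>sum_split_set_conj\<close>).  The powers of \<open>2\<close> and \<open>N\<close> only count cycles.

  The sign is the delicate point.  The function \<open>G = sgn \<cdot> h\<close> takes opposite values at the two ends
  of each edge of the matching \<open>\<delta>\<beta>\<close>, so it orients that matching.  The sign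
  left by the moment formula, times \<open>(-1)\<close> to the number of cycle pairs of \<open>\<beta>\<close>, is up to
  factors that do not see \<open>\<beta>\<close> the sign of any permutation of \<open>\<plusminus>J\<close> that takes the matching \<open>\<delta>\<close>, each
  edge oriented from \<open>k\<close> to \<open>- k\<close>, to the oriented matching \<open>\<delta>\<beta>\<close> (\<open>alignment_exists\<close>).  All such
  permutations have the same sign, because two of them differ by one that commutes with \<open>\<delta>\<close> and
  preserves \<open>J\<close>, and hence acts twice in the same way (\<open>sign_commuting_with_uminus\<close>).  Passing from
  \<open>\<beta>\<close> to \<open>\<phi>\<^sub>-\<^sup>-\<^sup>1\<beta>\<phi>\<close> composes the permutation with \<open>\<phi>\<^sup>-\<^sup>1\<close>, which contributes exactly
  the sign of \<open>\<phi>\<close> (\<open>sign_conj_perm\<close>).  Since the sign of a permutation is \<open>(-1)\<close> to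
  the number of points plus the number of orbits, the outcome is \<open>(-1)\<close> to the power \<open>\<chi>\<close>.

  Integrability is assumed of whole traces in \<open>Y\<close>, not of their monomials, so the
  expectation cannot be split term by term.  Instead Fubini integrates the \<open>X\<close> part with \<open>Y\<close> held
  fixed, and the resulting combination of traces in \<open>Y\<close> is integrated afterwards
  (\<open>integral_sum_products_indep\<close>).
\<close>

section \<open>Orbit counts and signs\<close>

text \<open>
  Composing with the transposition of \<open>a\<close> and \<open>p a\<close> makes
  \<open>a\<close> a fixed point and closes the cycle of \<open>a\<close> over the gap; all
  other arrows stay.
\<close>

lemma orbit_remove_point:
  assumes q: "q = Transposition.transpose a (p a) \<circ> p" and inj: "inj p" and a: "p a \<noteq> a"
    and x: "x \<noteq> a"
  shows "orbit q x = orbit p x - {a}"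
proof -
  have q_eq: "q y = (if p y = a then p a else p y)" if "y \<noteq> a" for y
    using that injD[OF inj, of y a] by (auto simp: q Transposition.transpose_def)
  have q_ne: "q y \<noteq> a" if "y \<noteq> a" for y
    using q_eq[OF that] a by auto
  have "y \<in> orbit p x \<and> y \<noteq> a" if "y \<in> orbit q x" for y
    using that
  proof induction
    case base
    then show ?case
      using q_eq[OF x] q_ne[OF x] orbit.base[of p x] orbit.step[of "p x" p x] by auto
  next
    case (step y)
    then show ?case
      using q_eq[of y] q_ne[of y] orbit.step[of y p x] orbit.step[of "p y" p x] by auto
  qed
  moreover have "(y \<noteq> a \<longrightarrow> y \<in> orbit q x) \<and> (y = a \<longrightarrow> p a \<in> orbit q x)" if "y \<in> orbit p x" for y
    using that
  proof induction
    case base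
    then show ?case
      using q_eq[OF x] orbit.base[of q x] by auto
  next
    case (step y)
    then show ?case
      using q_eq[of y] a orbit.step[of y q x] by (cases "y = a") auto
  qed
  ultimately show ?thesis by blast
qed

lemma permutes_self_in_orbit:
  assumes "p permutes S" "finite S"
  shows "x \<in> orbit p x"
  using assms by (intro permutation_self_in_orbit) (auto simp: permutation_permutes)

lemma permutes_orbit_eq:
  assumes "p permutes S" "finite S" "z \<in> orbit p x" "z \<in> orbit p y"
  shows "orbit p x = orbit p y"
  using assms cyclic_on_orbit[of p S] orbit_cyclic_eq3 by metis

text \<open>
  Splitting a point off its cycle by a transposition changes the sign and leaves one point less
  to permute, while the remaining points form as many orbits as there were before.
\<close>

theorem sign_eq_card_orbits:
  assumes "finite S" "p permutes S"
  shows "sign p = (- 1) ^ (card S + card (orbit p ` S))"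
  using assms
proof (induction S arbitrary: p rule: finite_induct)
  case empty
  then show ?case by (simp add: permutes_empty)
next
  case (insert a S)
  show ?case
  proof (cases "p a = a")
    case True
    have pS: "p permutes S"
      using insert.prems by (rule permutes_superset) (use True in auto)
    have "orbit p a = {a}"
      using True by (simp add: orbit_eq_singleton_iff)
    moreover have "{a} \<notin> orbit p ` S"
      using permutes_orbit_subset[OF pS] insert.hyps by auto
    ultimately have "card (orbit p ` insert a S) = Suc (card (orbit p ` S))"
      using insert.hyps by simp
    then show ?thesis
      using insert.IH[OF pS] insert.hyps by simp
  next
    case False
    define q where "q = Transposition.transpose a (p a) \<circ> p"
    have inS: "p a \<in> S"
      using insert.prems False permutes_in_image[of p "insert a S" a] by auto
    have "q permutes insert a S"
      unfolding q_def using insert.prems inS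
      by (intro permutes_compose permutes_swap_id) auto
    then have qS: "q permutes S"
      by (rule permutes_superset) (auto simp: q_def)
    have perm: "permutation p" "permutation q"
      using insert.prems insert.hyps qS by (auto simp: permutation_permutes)
    have "sign q = - sign p"
      unfolding q_def using perm False
      by (simp add: sign_compose permutation_swap_id sign_swap_id)
    moreover have orb: "orbit q x = orbit p x - {a}" if "x \<in> S" for x
    proof (rule orbit_remove_point[OF q_def permutes_inj[OF insert.prems] False])
      show "x \<noteq> a" using that insert.hyps by blast
    qed
    have "card (orbit q ` S) = card (orbit p ` S)"
    proof -
      have "orbit q ` S = (\<lambda>X. X - {a}) ` (orbit p ` S)"
        using orb by (auto simp: image_image)
      moreover have "inj_on (\<lambda>X. X - {a}) (orbit p ` S)"
      proof (intro inj_onI, clarify)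
        fix x y assume xy: "x \<in> S" "y \<in> S" "orbit p x - {a} = orbit p y - {a}"
        have "x \<in> orbit p x"
          using perm by (intro permutation_self_in_orbit)
        then have "x \<in> orbit p y"
          using xy insert.hyps by blast
        then show "orbit p x = orbit p y"
          using \<open>x \<in> orbit p x\<close> insert.prems insert.hyps
          by (intro permutes_orbit_eq[of p "insert a S"]) auto
      qed
      ultimately show ?thesis by (simp add: card_image)
    qed
    moreover have "orbit p ` insert a S = orbit p ` S"
      using permutation_orbit_step[OF perm(1), of a] inS by (metis image_insert insert_absorb imageI)
    ultimately show ?thesis
      using insert.IH[OF qS] insert.hyps by simp
  qed
qed

lemma num_orbits_cong:
  assumes "\<And>x. x \<in> S \<Longrightarrow> p x \<in> S" "\<And>x. x \<in> S \<Longrightarrow> p x = q x"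
  shows "num_orbits S p = num_orbits S q"
  unfolding num_orbits_def using assms
  by (intro arg_cong[of _ _ card] image_cong orbit_cong0[of _ S]) auto

lemma invariant_orbit_subset:
  assumes "\<And>x. x \<in> S \<Longrightarrow> p x \<in> S" "x \<in> S"
  shows "orbit p x \<subseteq> S"
proof
  fix y assume "y \<in> orbit p x"
  then show "y \<in> S" by induction (use assms in auto)
qed

lemma num_orbits_UN:
  assumes "finite I" "\<And>i. i \<in> I \<Longrightarrow> finite (A i)" "disjoint_family_on A I"
    and inv: "\<And>i x. i \<in> I \<Longrightarrow> x \<in> A i \<Longrightarrow> p x \<in> A i"
  shows "num_orbits (\<Union>i\<in>I. A i) p = (\<Sum>i\<in>I. num_orbits (A i) p)"
proof -
  have "orbit p ` A i \<inter> orbit p ` A j = {}" if ij: "i \<in> I" "j \<in> I" "i \<noteq> j" for i j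
  proof -
    have "False" if "x \<in> A i" "y \<in> A j" "orbit p x = orbit p y" for x y
      using invariant_orbit_subset[of "A i" p x] invariant_orbit_subset[of "A j" p y]
        inv ij that orbit_nonempty[of p x] disjoint_family_onD[OF assms(3) ij]
      by blast
    then show ?thesis by blast
  qed
  then have "card (\<Union>i\<in>I. orbit p ` A i) = (\<Sum>i\<in>I. card (orbit p ` A i))"
    using assms by (intro card_UN_disjoint) auto
  then show ?thesis
    by (simp add: num_orbits_def image_UN)
qed

lemma num_orbits_Un:
  assumes "finite A" "finite B" "A \<inter> B = {}"
    and "\<And>x. x \<in> A \<Longrightarrow> p x \<in> A" "\<And>x. x \<in> B \<Longrightarrow> p x \<in> B"
  shows "num_orbits (A \<union> B) p = num_orbits A p + num_orbits B p"
proof -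
  have "num_orbits (\<Union>b\<in>{True, False}. if b then A else B) p =
      (\<Sum>b\<in>{True, False}. num_orbits (if b then A else B) p)"
    by (rule num_orbits_UN) (use assms in \<open>auto simp: disjoint_family_on_def split: if_splits\<close>)
  then show ?thesis by (simp add: Un_commute)
qed

lemma num_orbits_image:
  assumes "inj f" "\<And>x. x \<in> S \<Longrightarrow> x \<in> orbit p x" "\<And>x. q (f x) = f (p x)"
  shows "num_orbits (f ` S) q = num_orbits S p"
proof -
  have "orbit q ` f ` S = image f ` (orbit p ` S)"
    using orbit_inverse[of _ p q f] assms by (auto simp: image_image)
  moreover have "inj_on (image f) (orbit p ` S)"
    using assms(1) by (intro inj_on_image) (rule inj_on_subset, auto)
  ultimately show ?thesis
    by (simp add: num_orbits_def card_image)
qed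

lemma num_orbits_inv:
  assumes "p permutes V" "finite V"
  shows "num_orbits S (inv p) = num_orbits S p"
  using assms by (simp add: num_orbits_def orbit_inv_eq permutation_permutes)
    (metis orbit_inv_eq permutation_permutes)

section \<open>Half systems of signed permutations\<close>

lemma uminus_point_eq_iff [simp]: "- x = - y \<longleftrightarrow> x = (y :: point)"
  by (metis uminus_point_uminus)

lemma inj_uminus_point: "inj_on (uminus :: point \<Rightarrow> point) A"
  by (auto intro: inj_onI)

lemma uminus_mem_pm_iff [simp]: "- x \<in> pm J \<longleftrightarrow> x \<in> pm J"
  unfolding pm_def by (metis Un_iff imageE imageI uminus_point_uminus)

lemma subset_pm: "J \<subseteq> pm J"
  by (auto simp: pm_def)

lemma finite_pm [simp]: "finite J \<Longrightarrow> finite (pm J)"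
  by (simp add: pm_def)

text \<open>
  Positivity of the points makes \<open>J\<close> and its negative disjoint, so that
  \<open>J\<close> is recovered from \<open>pm J\<close> as the set of positive points.
\<close>

locale signed_set =
  fixes J :: "point set"
  assumes finite_J: "finite J" and pos_J: "\<And>k. k \<in> J \<Longrightarrow> 0 < k"
begin

lemma uminus_notin_J: "k \<in> J \<Longrightarrow> - k \<notin> J"
  using pos_J[of k] pos_J[of "- k"] by (cases k) (auto simp: zero_extended_def)

lemma uminus_in_J_iff: "x \<in> pm J \<Longrightarrow> - x \<in> J \<longleftrightarrow> x \<notin> J"
  using uminus_notin_J by (auto simp: pm_def)

lemma pos_iff: "x \<in> pm J \<Longrightarrow> 0 < x \<longleftrightarrow> x \<in> J"
proof -
  assume "x \<in> pm J"
  then consider "x \<in> J" | "- x \<in> J" by (auto simp: pm_def)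
  then show ?thesis
  proof cases
    case 2
    then have "0 < - x" "x \<notin> J" using pos_J uminus_notin_J[of x] by auto
    then show ?thesis by (cases x) (auto simp: zero_extended_def)
  qed (use pos_J in auto)
qed

lemma uminus_neq: "x \<in> pm J \<Longrightarrow> - x \<noteq> x"
  using uminus_in_J_iff[of x] by auto

lemma point_sgn_eq: "x \<in> pm J \<Longrightarrow> point_sgn x = (if x \<in> J then 1 else -1)"
  by (simp add: point_sgn_def pos_iff)

lemma point_sgn_uminus: "x \<in> pm J \<Longrightarrow> point_sgn (- x) = - point_sgn x"
  by (simp add: point_sgn_eq uminus_in_J_iff)

end

text \<open>
  A choice of one cycle out of each pair of mirror cycles.  The set \<open>FD\<close> is one
  such choice; the parity arguments hold for every choice, which allows choices to be
  transported along conjugations instead of being compared with \<open>FD\<close>.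
\<close>

definition half_system :: "point set \<Rightarrow> (point \<Rightarrow> point) \<Rightarrow> point set \<Rightarrow> bool" where
  "half_system J p R \<longleftrightarrow> R \<subseteq> pm J \<and> p ` R \<subseteq> R \<and> (\<forall>k\<in>pm J. k \<in> R \<longleftrightarrow> - k \<notin> R)"

definition reversible :: "point set \<Rightarrow> (point \<Rightarrow> point) \<Rightarrow> bool" where
  "reversible J p \<longleftrightarrow> p permutes pm J \<and> uminus \<circ> p \<circ> uminus = inv p"

lemma reversibleD:
  assumes "reversible J p"
  shows "p permutes pm J" "inv p x = - p (- x)" "p (- p (- x)) = x" "p (- p x) = - x"
    "inj p" "p x \<in> pm J \<longleftrightarrow> x \<in> pm J"
proof -
  show p: "p permutes pm J"
    using assms by (simp add: reversible_def)
  show *: "inv p x = - p (- x)" for x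
    using assms by (simp add: reversible_def fun_eq_iff)
  show **: "p (- p (- x)) = x" for x
    using permutes_inverses(1)[OF p, of x] by (simp add: *)
  show "p (- p x) = - x"
    using **[of "- x"] by simp
  show "inj p" using p by (rule permutes_inj)
  show "p x \<in> pm J \<longleftrightarrow> x \<in> pm J"
    using p by (rule permutes_in_image)
qed

lemma half_systemD:
  assumes "half_system J p R"
  shows "R \<subseteq> pm J" "x \<in> R \<Longrightarrow> p x \<in> R" "x \<in> pm J \<Longrightarrow> - x \<in> R \<longleftrightarrow> x \<notin> R"
  using assms unfolding half_system_def by blast+

context signed_set
begin

text \<open>
  Invariance under \<open>p\<close> passes to the inverse because the sets are finite.
\<close>

lemma half_system_inv:
  assumes "half_system J p R" "reversible J p" "x \<in> R"
  shows "inv p x \<in> R"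
proof -
  note R = half_systemD[OF assms(1)] and p = reversibleD[OF assms(2)]
  have "p ` R = R"
    using R finite_J p(5) by (intro endo_inj_surj) (auto intro: finite_subset inj_on_subset)
  then show ?thesis
    using assms(3) p(5) by (metis imageE inv_f_f)
qed

lemma half_system_image_iff:
  assumes "half_system J p R" "reversible J p"
  shows "p x \<in> R \<longleftrightarrow> x \<in> R"
  using half_system_inv[OF assms, of "p x"] half_systemD(2)[OF assms(1)]
    inv_f_f[OF reversibleD(5)[OF assms(2)], of x]
  by auto


lemma half_system_compl:
  assumes "half_system J p R" "reversible J p"
  shows "half_system J p (pm J - R)" "pm J - R = uminus ` R"
proof -
  note R = half_systemD[OF assms(1)] and p = reversibleD[OF assms(2)]
  show "half_system J p (pm J - R)"
    using R half_system_image_iff[OF assms] p(6) by (auto simp: half_system_def)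
  show "pm J - R = uminus ` R"
  proof (intro set_eqI iffI)
    fix x assume "x \<in> pm J - R"
    then have "- x \<in> R" using R by blast
    then show "x \<in> uminus ` R" by (metis imageI uminus_point_uminus)
  qed (use R in auto)
qed

text \<open>
  Negation carries the orbits of \<open>p\<close> in a half system to orbits of the inverse of
  \<open>p\<close> in the complement, and inverse permutations have the same orbits.
\<close>

lemma num_orbits_half_system:
  assumes "half_system J p R" "reversible J p"
  shows "num_orbits (pm J - R) p = num_orbits R p" "num_orbits (pm J) p = 2 * num_orbits R p"
proof -
  note R = half_systemD[OF assms(1)] and p = reversibleD[OF assms(2)]
  have "num_orbits (uminus ` R) (inv p) = num_orbits R p"
    using finite_J
    by (intro num_orbits_image inj_uminus_point permutes_self_in_orbit[OF p(1)]) (auto simp: p)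
  then show *: "num_orbits (pm J - R) p = num_orbits R p"
    using num_orbits_inv[OF p(1)] finite_J by (simp add: half_system_compl[OF assms])
  have "num_orbits (R \<union> (pm J - R)) p = num_orbits R p + num_orbits (pm J - R) p"
    using R finite_J half_system_image_iff[OF assms] p(6)
    by (intro num_orbits_Un) (auto intro: finite_subset)
  moreover have "R \<union> (pm J - R) = pm J" using R by auto
  ultimately show "num_orbits (pm J) p = 2 * num_orbits R p"
    using * by simp
qed

lemma half_system_J:
  assumes "\<And>k. k \<in> J \<Longrightarrow> p k \<in> J"
  shows "half_system J p J"
  using assms subset_pm uminus_in_J_iff by (auto simp: half_system_def)

lemma card_half_system:
  assumes "half_system J p R"
  shows "card R = card J"
proof -
  note R = half_systemD[OF assms]
  have "bij_betw (\<lambda>x. if x \<in> J then x else - x) R J"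
    by (rule bij_betw_byWitness[where f' = "\<lambda>k. if k \<in> R then k else - k"])
      (use R uminus_in_J_iff subset_pm in \<open>auto simp: subset_iff\<close>)
  then show ?thesis by (rule bij_betw_same_card)
qed

section \<open>A sign attached to a matching and its invariance\<close>

definition flip :: "point set \<Rightarrow> point \<Rightarrow> point" where
  "flip B x = (if x \<in> pm B then - x else x)"

lemma flip_permutes: "flip B permutes pm B"
  by (rule bij_imp_permutes, rule bij_betw_byWitness[where f' = "flip B"]) (auto simp: flip_def)

lemma sign_flip:
  assumes "B \<subseteq> J"
  shows "sign (flip B) = (- 1) ^ card B"
proof -
  have "finite B" using assms finite_J by (rule finite_subset)
  then show ?thesis using assms
  proof (induction rule: finite_induct)
    case empty
    then show ?case by (simp add: flip_def[abs_def] pm_def)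
  next
    case (insert b B)
    have "b \<notin> pm B"
      using insert uminus_notin_J by (auto simp: pm_def)
    then have nb: "- b \<noteq> b" "b \<notin> pm B" "- b \<notin> pm B"
      using insert uminus_neq[of b] subset_pm by auto
    have "flip (insert b B) = Transposition.transpose b (- b) \<circ> flip B"
      using nb insert by (auto simp: flip_def fun_eq_iff Transposition.transpose_def pm_def)
    moreover have "permutation (flip B)"
      using permutes_imp_permutation[OF _ flip_permutes] insert.hyps by simp
    ultimately have "sign (flip (insert b B)) = sign (Transposition.transpose b (- b)) * sign (flip B)"
      by (simp only: sign_compose permutation_swap_id)
    then show ?case
      using insert nb by (simp add: sign_swap_id)
  qed
qed

text \<open>
  Such a permutation is the product of its restriction to \<open>J\<close> and the mirror image
  of that restriction on \<open>- J\<close>; the two have equal signs.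
\<close>

lemma sign_commuting_with_uminus:
  assumes \<psi>: "\<psi> permutes pm J" and im: "\<And>x. x \<in> J \<Longrightarrow> \<psi> x \<in> J"
    and com: "\<And>x. x \<in> pm J \<Longrightarrow> \<psi> (- x) = - \<psi> x"
  shows "sign \<psi> = 1"
proof -
  define \<rho> where "\<rho> = perm_restrict \<psi> J"
  have "inj_on \<psi> J"
    using permutes_inj[OF \<psi>] by (rule inj_on_subset) simp
  then have "bij_betw \<psi> J J"
    using im endo_inj_surj[OF finite_J, of \<psi>] by (auto simp: bij_betw_def)
  then have "\<rho> permutes J"
    unfolding \<rho>_def
    by (intro bij_imp_permutes) (auto simp: perm_restrict_def cong: bij_betw_cong)
  then have perm: "permutation \<rho>" "permutation (flip J)"
    using permutes_imp_permutation[OF _ flip_permutes] permutes_imp_permutation finite_J by auto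
  \<comment> \<open>Conjugating by the flip of all of \<open>J\<close>, unlike by negation, stays within finite permutations, where signs are multiplicative.\<close>
  have "\<psi> = flip J \<circ> (\<rho> \<circ> (flip J \<circ> \<rho>))"
  proof
    fix x
    consider "x \<in> J" | "- x \<in> J" "x \<notin> J" | "x \<notin> pm J"
      using uminus_in_J_iff by blast
    then show "\<psi> x = (flip J \<circ> (\<rho> \<circ> (flip J \<circ> \<rho>))) x"
    proof cases
      case 1
      then show ?thesis
        using im[OF 1] uminus_notin_J subset_pm by (auto simp: flip_def \<rho>_def perm_restrict_def)
    next
      case 2
      then have "x \<in> pm J" using subset_pm by force
      then show ?thesis
        using 2 im[of "- x"] com[of x] subset_pm uminus_in_J_iff[of "\<psi> x"] permutes_in_image[OF \<psi>, of x]
        by (auto simp: flip_def \<rho>_def perm_restrict_def)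
    next
      case 3
      then show ?thesis
        using permutes_not_in[OF \<psi> 3] subset_pm by (auto simp: flip_def \<rho>_def perm_restrict_def)
    qed
  qed
  then have "sign \<psi> = sign (flip J) * (sign \<rho> * (sign (flip J) * sign \<rho>))"
    using perm by (simp add: sign_compose permutation_compose)
  then show ?thesis
    by (simp add: ac_simps)
qed

text \<open>
  The edges of the matching \<open>\<delta>p\<close> are \<open>{x, - p x}\<close>.  The
  permutation \<open>\<theta>\<close> takes the edge \<open>{k, - k}\<close> of
  \<open>\<delta>\<close> with \<open>x \<in> R\<close> among its ends to the edge \<open>{- x,
  inv p x}\<close> of \<open>\<delta>p\<close>, the positive end going to the end at which
  \<open>G\<close> is \<open>1\<close>.  It is the composition of a flip of the badly oriented
  edges, whose sign is a product of values of \<open>G\<close>, with the inverse of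
  \<open>p\<close> on \<open>R\<close>, whose sign is given by the orbit count.
\<close>

lemma alignment_exists:
  assumes p: "reversible J p" and R: "half_system J p R"
    and G: "\<And>x. x \<in> pm J \<Longrightarrow> G x \<in> {1, -1 :: int}"
    and G_flip: "\<And>x. x \<in> pm J \<Longrightarrow> G (- p x) = - G x"
  obtains \<theta> where "\<theta> permutes pm J" "\<And>x. x \<in> pm J \<Longrightarrow> G (\<theta> x) = point_sgn x"
    "\<And>x. x \<in> pm J \<Longrightarrow> \<theta> (- x) = - p (\<theta> x)"
    "sign \<theta> = (- 1) ^ (card J + num_orbits R p) * (\<Prod>k\<in>J. G k) * (\<Prod>k\<in>J \<inter> R. - (G k * G (- k)))"
proof -
  note p' = reversibleD[OF p] and R' = half_systemD[OF R]
  \<comment> \<open>\<open>A\<close> takes the edge \<open>{x, - x}\<close> with \<open>x \<in> R\<close> to \<open>{inv p x, - x}\<close>; \<open>B\<close> collects the edges that \<open>A\<close> alone would orient against \<open>G\<close>.\<close>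
  define A where "A = perm_restrict (inv p) R"
  define B where "B = {k \<in> J. if k \<in> R then G (- k) = 1 else G k = -1}"
  have finR: "finite R" using R'(1) finite_J by (auto intro: finite_subset)
  have "bij_betw A R R"
  proof -
    have "A x \<in> R" if "x \<in> R" for x
      using that half_system_inv[OF R p] by (simp add: A_def perm_restrict_def)
    moreover have "inj_on A R"
      using permutes_inj[OF permutes_inv[OF p'(1)]]
      by (auto simp: A_def perm_restrict_def inj_on_def inj_def)
    ultimately show ?thesis
      using endo_inj_surj[OF finR, of A] by (auto simp: bij_betw_def)
  qed
  then have A: "A permutes R"
    by (rule bij_imp_permutes) (simp add: A_def perm_restrict_def)
  have sgnA: "sign A = (- 1) ^ (card J + num_orbits R p)"
  proof -
    have "num_orbits R A = num_orbits R (inv p)"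
      by (rule num_orbits_cong) (simp_all add: A_def perm_restrict_def half_system_inv[OF R p])
    then show ?thesis
      using sign_eq_card_orbits[OF finR A] card_half_system[OF R] num_orbits_inv[OF p'(1)] finite_J
      by (simp add: num_orbits_def)
  qed
  have BJ: "B \<subseteq> J" by (auto simp: B_def)
  have "pm B \<subseteq> pm J" using BJ by (auto simp: pm_def)
  then have F: "flip B permutes pm J"
    using flip_permutes permutes_subset by blast
  have A_uminus: "A (- y) = - p (A y)" if "y \<in> pm J" for y
    using that R'(3)[of y] by (auto simp: A_def perm_restrict_def p')
  have F_uminus: "flip B (- y) = - flip B y" for y
    by (simp add: flip_def)
  define \<theta> where "\<theta> = A \<circ> flip B"
  have \<theta>: "\<theta> permutes pm J"
    unfolding \<theta>_def using F permutes_subset[OF A R'(1)] by (rule permutes_compose)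
  have \<theta>_uminus: "\<theta> (- x) = - p (\<theta> x)" if "x \<in> pm J" for x
    using that A_uminus permutes_in_image[OF F] by (simp add: \<theta>_def F_uminus)
  have G_inv: "G (inv p y) = - G (- y)" if "y \<in> pm J" for y
    using G_flip[of "- y"] that by (simp add: p')
  have pos: "G (\<theta> k) = 1" if "k \<in> J" for k
  proof -
    have kJ: "k \<in> pm J" using that subset_pm by auto
    have "k \<in> pm B \<longleftrightarrow> k \<in> B"
      using that BJ uminus_notin_J by (auto simp: pm_def)
    then show ?thesis
      using G[OF kJ] G[of "- k"] kJ G_inv[OF kJ] G_inv[of "- k"] that R'(3)[OF kJ]
      by (auto simp: \<theta>_def A_def perm_restrict_def flip_def B_def)
  qed
  have sgn: "G (\<theta> x) = point_sgn x" if x: "x \<in> pm J" for x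
  proof (cases "x \<in> J")
    case False
    then have "- x \<in> J" using uminus_in_J_iff[OF x] by simp
    then show ?thesis
      using pos[of "- x"] \<theta>_uminus[of "- x"] x G_flip[of "\<theta> (- x)"] permutes_in_image[OF \<theta>] False
      by (simp add: point_sgn_eq)
  qed (use pos x in \<open>simp add: point_sgn_eq\<close>)
  have perm: "permutation A" "permutation (flip B)"
    using permutes_imp_permutation[OF finR A] permutes_imp_permutation[OF finite_pm[OF finite_J] F]
    by auto
  have "sign (flip B) = (\<Prod>k\<in>J. if k \<in> B then -1 else 1)"
    using sign_flip[OF BJ] finite_J BJ by (simp add: prod.If_cases Int_absorb1)
  also have "\<dots> = (\<Prod>k\<in>J. G k * (if k \<in> R then - (G k * G (- k)) else 1))"
  proof (intro prod.cong refl)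
    fix k assume "k \<in> J"
    then have "k \<in> pm J" "- k \<in> pm J" using subset_pm by auto
    then show "(if k \<in> B then -1 else 1) = G k * (if k \<in> R then - (G k * G (- k)) else 1)"
      using G[of k] G[of "- k"] \<open>k \<in> J\<close> by (auto simp: B_def)
  qed
  also have "\<dots> = (\<Prod>k\<in>J. G k) * (\<Prod>k\<in>J \<inter> R. - (G k * G (- k)))"
    using finite_J by (simp add: prod.distrib prod.If_cases Int_def)
  finally have "sign \<theta> = (- 1) ^ (card J + num_orbits R p) * (\<Prod>k\<in>J. G k) * (\<Prod>k\<in>J \<inter> R. - (G k * G (- k)))"
    using perm by (simp add: \<theta>_def sign_compose sgnA)
  with \<theta> sgn \<theta>_uminus show ?thesis by (rule that)
qed

text \<open>
  For \<open>\<phi>\<close> a permutation of \<open>J\<close> this is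
  \<open>\<phi>\<^sub>-\<^sup>-\<^sup>1p\<phi>\<close>, the inverse of \<open>K \<phi>
  p\<close>; the corresponding matching \<open>\<delta>p\<close> is conjugated by
  \<open>\<phi>\<close>.
\<close>

definition (in -) conj_perm :: "(point \<Rightarrow> point) \<Rightarrow> (point \<Rightarrow> point) \<Rightarrow> point \<Rightarrow> point" where
  "conj_perm \<phi> p = inv (minus_perm \<phi>) \<circ> p \<circ> \<phi>"

lemma uminus_conj_perm:
  assumes "\<phi> permutes J"
  shows "- conj_perm \<phi> p x = inv \<phi> (- p (\<phi> x))"
  unfolding conj_perm_def inv_minus_perm[OF assms] by (simp add: minus_perm_def)

lemma reversible_conj_perm:
  assumes \<phi>: "\<phi> permutes J" and p: "reversible J p"
  shows "reversible J (conj_perm \<phi> p)"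
proof -
  note p' = reversibleD[OF p]
  have c: "conj_perm \<phi> p x = - inv \<phi> (- p (\<phi> x))" for x
    using uminus_conj_perm[OF \<phi>, of p x] by (metis uminus_point_uminus)
  have V: "\<phi> permutes pm J" using \<phi> subset_pm by (rule permutes_subset)
  have im: "conj_perm \<phi> p x \<in> pm J \<longleftrightarrow> x \<in> pm J" for x
    using permutes_in_image[OF V] permutes_in_image[OF permutes_inv[OF V]] p'(6) by (simp add: c)
  have i1: "conj_perm \<phi> p (- conj_perm \<phi> p (- x)) = x" for x
    by (simp add: c permutes_inverses[OF \<phi>] p')
  have "bij (conj_perm \<phi> p)"
    by (rule o_bij[where g = "\<lambda>x. - conj_perm \<phi> p (- x)"])
      (use i1 in \<open>auto simp: fun_eq_iff\<close>, metis i1 uminus_point_uminus)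
  moreover have "conj_perm \<phi> p x = x" if "x \<notin> pm J" for x
    using permutes_not_in[OF V that] permutes_not_in[OF p'(1) that]
      permutes_not_in[OF permutes_inv[OF V], of "- x"] that
    by (simp add: c)
  ultimately have "conj_perm \<phi> p permutes pm J"
    by (simp add: permutes_def bij_iff)
  moreover have "uminus \<circ> conj_perm \<phi> p \<circ> uminus = inv (conj_perm \<phi> p)"
    using i1 by (intro inv_unique_comp[symmetric]) (auto simp: fun_eq_iff, metis i1 uminus_point_uminus)
  ultimately show ?thesis by (simp add: reversible_def)
qed

text \<open>
  An alignment for the conjugated matching, followed by \<open>\<phi>\<close>, is an alignment
  for the original one up to a permutation that commutes with negation and preserves
  \<open>J\<close>.  So the two alignment signs differ by the sign of \<open>\<phi>\<close>, and
  comparing their two expressions cancels the product of \<open>G\<close> over \<open>J\<close>,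
  which \<open>\<phi>\<close> merely reorders.
\<close>

theorem sign_conj_perm:
  assumes \<phi>: "\<phi> permutes J" and p: "reversible J p" and R: "half_system J p R"
    and R': "half_system J (conj_perm \<phi> p) R'"
    and G: "\<And>x. x \<in> pm J \<Longrightarrow> G x \<in> {1, -1 :: int}"
    and G_flip: "\<And>x. x \<in> pm J \<Longrightarrow> G (- p x) = - G x"
  shows "(- 1) ^ num_orbits R p * (\<Prod>k\<in>J \<inter> R. - (G k * G (- k))) =
    sign \<phi> * (- 1) ^ num_orbits R' (conj_perm \<phi> p) *
      (\<Prod>k\<in>J \<inter> R'. - (G (\<phi> k) * G (\<phi> (- k))))"
proof -
  have V: "\<phi> permutes pm J" using \<phi> subset_pm by (rule permutes_subset)
  obtain \<theta> where \<theta>: "\<theta> permutes pm J" "\<And>x. x \<in> pm J \<Longrightarrow> G (\<theta> x) = point_sgn x"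
    "\<And>x. x \<in> pm J \<Longrightarrow> \<theta> (- x) = - p (\<theta> x)"
    and s\<theta>: "sign \<theta> = (- 1) ^ (card J + num_orbits R p) * (\<Prod>k\<in>J. G k) * (\<Prod>k\<in>J \<inter> R. - (G k * G (- k)))"
  proof (rule alignment_exists[OF p R, of G])
    show "G x \<in> {1, -1}" "G (- p x) = - G x" if "x \<in> pm J" for x
      using G G_flip that by blast+
  qed (rule that)
  obtain \<theta>' where \<theta>': "\<theta>' permutes pm J" "\<And>x. x \<in> pm J \<Longrightarrow> G (\<phi> (\<theta>' x)) = point_sgn x"
    "\<And>x. x \<in> pm J \<Longrightarrow> \<theta>' (- x) = - conj_perm \<phi> p (\<theta>' x)"
    and s\<theta>': "sign \<theta>' = (- 1) ^ (card J + num_orbits R' (conj_perm \<phi> p)) * (\<Prod>k\<in>J. G (\<phi> k)) *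
      (\<Prod>k\<in>J \<inter> R'. - (G (\<phi> k) * G (\<phi> (- k))))"
  proof (rule alignment_exists[OF reversible_conj_perm[OF \<phi> p] R', of "\<lambda>x. G (\<phi> x)"])
    fix x assume x: "x \<in> pm J"
    then show "G (\<phi> x) \<in> {1, -1}"
      using G permutes_in_image[OF V] by blast
    show "G (\<phi> (- conj_perm \<phi> p x)) = - G (\<phi> x)"
      using G_flip[of "\<phi> x"] x permutes_in_image[OF V]
      by (simp add: uminus_conj_perm[OF \<phi>] permutes_inverses[OF \<phi>])
  qed (rule that)
  \<comment> \<open>Both \<open>\<theta>\<close> and \<open>\<phi> \<circ> \<theta>'\<close> take \<open>\<delta>\<close> to the oriented matching \<open>\<delta>p\<close>.\<close>
  define \<psi> where "\<psi> = inv \<theta> \<circ> (\<phi> \<circ> \<theta>')"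
  have \<psi>: "\<psi> permutes pm J"
    unfolding \<psi>_def using \<theta>(1) \<theta>'(1) V by (intro permutes_compose permutes_inv)
  have \<theta>\<psi>: "\<theta> (\<psi> x) = \<phi> (\<theta>' x)" for x
    by (simp add: \<psi>_def permutes_inverses[OF \<theta>(1)])
  have "sign \<psi> = 1"
  proof (rule sign_commuting_with_uminus[OF \<psi>])
    fix x assume x: "x \<in> J"
    then have "x \<in> pm J" "\<psi> x \<in> pm J"
      using subset_pm permutes_in_image[OF \<psi>] by auto
    then have "point_sgn (\<psi> x) = point_sgn x"
      using \<theta>(2)[of "\<psi> x"] \<theta>'(2)[of x] by (simp add: \<theta>\<psi>)
    then show "\<psi> x \<in> J"
      using \<open>x \<in> pm J\<close> \<open>\<psi> x \<in> pm J\<close> x by (simp add: point_sgn_eq split: if_splits)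
  next
    fix x assume x: "x \<in> pm J"
    then have "\<theta> (\<psi> (- x)) = \<theta> (- \<psi> x)"
      using \<theta>(3)[of "\<psi> x"] \<theta>'(3)[OF x] permutes_in_image[OF \<psi>]
      by (simp add: \<theta>\<psi> uminus_conj_perm[OF \<phi>] permutes_inverses[OF \<phi>])
    then show "\<psi> (- x) = - \<psi> x"
      using permutes_inj[OF \<theta>(1)] by (simp add: inj_eq)
  qed
  moreover have "sign \<psi> = sign \<theta> * (sign \<phi> * sign \<theta>')"
  proof -
    have "permutation \<theta>" "permutation \<phi>" "permutation \<theta>'"
      using permutes_imp_permutation[OF finite_pm[OF finite_J]] \<theta>(1) \<theta>'(1) V by auto
    then show ?thesis
      unfolding \<psi>_def
      by (simp only: sign_compose sign_inverse permutation_compose permutation_inverse)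
  qed
  ultimately have e1: "sign \<theta> = sign \<phi> * sign \<theta>'"
    by (metis mult.right_neutral mult.left_commute sign_left_idempotent)
  have e2: "(\<Prod>k\<in>J. G (\<phi> k)) = (\<Prod>k\<in>J. G k)"
    using permutes_imp_bij[OF \<phi>] by (rule prod.reindex_bij_betw)
  have "(\<Prod>k\<in>J. G k) * (\<Prod>k\<in>J. G k) = (\<Prod>k\<in>J. 1)"
    unfolding prod.distrib[symmetric]
    by (intro prod.cong refl) (use G subset_pm in fastforce)
  then have e3: "(\<Prod>k\<in>J. G k) \<noteq> 0" by auto
  have "(- 1) ^ card J * (\<Prod>k\<in>J. G k) * ((- 1) ^ num_orbits R p * (\<Prod>k\<in>J \<inter> R. - (G k * G (- k)))) =
    (- 1) ^ card J * (\<Prod>k\<in>J. G k) * (sign \<phi> * (- 1) ^ num_orbits R' (conj_perm \<phi> p) *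
      (\<Prod>k\<in>J \<inter> R'. - (G (\<phi> k) * G (\<phi> (- k)))))"
    using e1 unfolding s\<theta> s\<theta>' e2 by (simp add: power_add ac_simps)
  then show ?thesis
    using e3 by simp
qed

end

section \<open>Pairings, their cycles and their coloured parts\<close>

lemma reversibleI:
  assumes "finite J" "\<And>x. x \<in> pm J \<Longrightarrow> p x \<in> pm J" "\<And>x. x \<notin> pm J \<Longrightarrow> p x = x"
    and "\<And>x. p (- p (- x)) = x"
  shows "reversible J p"
proof -
  have "p permutes pm J"
    by (rule bij_imp_permutes, rule bij_betw_byWitness[where f' = "\<lambda>x. - p (- x)"])
      (use assms in \<open>auto simp: assms(4)\<close>, use assms(4)[of "- x" for x] in auto)
  moreover have "uminus \<circ> p \<circ> uminus = inv p"
    by (rule inv_unique_comp[symmetric])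
      (use assms(4) assms(4)[of "- x" for x] in \<open>auto simp: fun_eq_iff\<close>)
  ultimately show ?thesis by (simp add: reversible_def)
qed

lemma point_abs_uminus [simp]: "point_abs (- x) = point_abs x"
  by (simp add: point_abs_def max.commute)

lemma point_abs_pos: "0 < x \<Longrightarrow> point_abs x = x"
  by (cases x) (auto simp: point_abs_def zero_extended_def max_def)

text \<open>
  It suffices to exclude \<open>p x = - x\<close>: if \<open>p\<^sup>m\<^sup>+\<^sup>2 x = -
  x\<close>, then cancelling one step at either end gives \<open>p\<^sup>m (p x) = - p
  x\<close>, so a path from a point to its negative shrinks by two steps at a time.
\<close>

lemma PM_iff:
  assumes "signed_set J"
  shows "p \<in> PM J \<longleftrightarrow> reversible J p \<and> (\<forall>x\<in>pm J. p x \<noteq> - x)"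
proof (intro iffI conjI)
  assume p: "p \<in> PM J"
  then show "reversible J p"
    by (simp add: PM_def reversible_def)
  show "\<forall>x\<in>pm J. p x \<noteq> - x"
    using p orbit.base[of p] by (auto simp: PM_def) metis
next
  assume p: "reversible J p \<and> (\<forall>x\<in>pm J. p x \<noteq> - x)"
  then have r: "reversible J p" by blast
  note p' = reversibleD[OF r]
  have *: "x \<in> pm J \<Longrightarrow> (p ^^ m) x \<noteq> - x" for m x
  proof (induction m arbitrary: x rule: induct_nat_012)
    case 0
    then show ?case using signed_set.uminus_neq[OF assms, of x] by auto
  next
    case 1
    then show ?case using p by simp
  next
    case (ge2 m)
    have "(p ^^ m) (p x) \<noteq> - p x"
      using ge2 p'(6) by blast
    then have "p ((p ^^ m) (p x)) \<noteq> p (- p x)"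
      using p'(5) by (simp add: inj_eq)
    then show ?case
      by (simp add: p'(4) funpow_swap1)
  qed
  have "- x \<notin> orbit p x" if "x \<in> pm J" for x
    using *[OF that] by (auto simp: orbit_altdef dest: sym)
  then show "p \<in> PM J"
    using r by (simp add: PM_def reversible_def)
qed

lemma finite_PM: "finite I \<Longrightarrow> finite (PM I)"
  by (rule finite_subset[of _ "{p. p permutes pm I}"]) (auto simp: PM_def finite_permutations)

lemma uminus_Pinf [simp]: "- Pinf = Minf" "- Minf = (Pinf :: 'a::uminus extended)"
  by simp_all

context signed_set
begin

lemma orbit_uminus:
  assumes "reversible J p"
  shows "orbit p (- x) = uminus ` orbit p x"
proof -
  note p = reversibleD[OF assms]
  have "uminus ` orbit (inv p) x = orbit p (- x)"
    using permutes_self_in_orbit[OF permutes_inv[OF p(1)]] finite_J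
    by (intro orbit_inverse) (auto simp: p)
  moreover have "orbit (inv p) x = orbit p x"
    using permutes_imp_permutation[OF _ p(1)] finite_J by (intro orbit_inv_eq) simp
  ultimately show ?thesis by simp
qed

text \<open>
  Away from \<open>\<infinity>\<close>, a cycle contains a point of smallest absolute value,
  unique because the cycle does not contain the negative of any of its points; this point is
  positive in exactly one of the two mirror cycles.
\<close>

lemma half_system_FD:
  assumes p: "p \<in> PM J"
  shows "half_system J p (FD J p)"
  unfolding half_system_def
proof (intro conjI ballI)
  have r: "reversible J p" using p by (simp add: PM_def reversible_def)
  note p' = reversibleD[OF r]
  have perm: "permutation p"
    using permutes_imp_permutation[OF _ p'(1)] finite_J by simp
  show "FD J p \<subseteq> pm J" by (auto simp: FD_def)
  show "p ` FD J p \<subseteq> FD J p"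
    using permutation_orbit_step[OF perm] p'(6) by (auto simp: FD_def)
  fix k assume k: "k \<in> pm J"
  let ?O = "orbit p k"
  have O': "x \<in> orbit p (- k) \<longleftrightarrow> - x \<in> ?O" for x
    unfolding orbit_uminus[OF r] by (metis imageE imageI uminus_point_uminus)
  have sub: "?O \<subseteq> pm J"
    using permutes_orbit_subset[OF p'(1) k] .
  have disj: "- x \<notin> ?O" if "x \<in> ?O" for x
  proof
    assume "- x \<in> ?O"
    moreover have "orbit p x = ?O"
      using that cyclic_on_orbit'[OF perm] orbit_cyclic_eq3 by metis
    ultimately show False
      using p that sub by (auto simp: PM_def)
  qed
  show "k \<in> FD J p \<longleftrightarrow> - k \<notin> FD J p"
  proof (cases "Pinf \<in> ?O \<or> Minf \<in> ?O")
    case True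
    then show ?thesis
      using k disj[of Pinf] disj[of Minf] by (auto simp: FD_def O')
  next
    case False
    let ?min = "\<lambda>m. \<forall>l\<in>?O. point_abs m \<le> point_abs l"
    have pos: "k \<in> FD J p \<longleftrightarrow> (\<exists>m\<in>?O. 0 < m \<and> ?min m)"
      using False k by (simp add: FD_def)
    have neg: "- k \<in> FD J p \<longleftrightarrow> (\<exists>m\<in>?O. 0 < - m \<and> ?min m)"
    proof -
      have "- k \<in> FD J p \<longleftrightarrow> (\<exists>m\<in>orbit p (- k). 0 < m \<and> (\<forall>l\<in>orbit p (- k). point_abs m \<le> point_abs l))"
        using False k by (simp add: FD_def O')
      then show ?thesis
        by (simp add: orbit_uminus[OF r])
    qed
    have f: "finite (point_abs ` ?O)" "point_abs ` ?O \<noteq> {}"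
      using finite_subset[OF sub] finite_J orbit_nonempty[of p k] by simp_all
    obtain m where m: "m \<in> ?O" "?min m"
      using Min_in[OF f] Min_le[OF f(1)] by (metis imageE imageI)
    then have "m \<in> pm J" using sub by auto
    then have "0 < m \<or> 0 < - m"
      using pos_iff[of m] pos_iff[of "- m"] uminus_in_J_iff[of m] by auto
    then have "k \<in> FD J p \<or> - k \<in> FD J p"
      using m pos neg by blast
    moreover have False if "k \<in> FD J p" "- k \<in> FD J p"
    proof -
      obtain x where x: "x \<in> ?O" "0 < x" "?min x"
        using \<open>k \<in> FD J p\<close> pos by auto
      obtain y where y: "y \<in> ?O" "0 < - y" "?min y"
        using \<open>- k \<in> FD J p\<close> neg by auto
      note xy = x y
      then have "point_abs x = point_abs y"
        by (intro antisym) auto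
      then have "x = - y"
        using point_abs_pos[of x] point_abs_pos[of "- y"] xy by simp
      then show False
        using disj[of y] xy by auto
    qed
    ultimately show ?thesis by blast
  qed
qed

lemma conj_perm_PM:
  assumes \<phi>: "\<phi> permutes J" and p: "p \<in> PM J"
  shows "conj_perm \<phi> p \<in> PM J"
proof -
  have J: "signed_set J" by unfold_locales
  have V: "\<phi> permutes pm J" using \<phi> subset_pm by (rule permutes_subset)
  have "conj_perm \<phi> p x \<noteq> - x" if "x \<in> pm J" for x
  proof
    assume "conj_perm \<phi> p x = - x"
    then have "inv \<phi> (- p (\<phi> x)) = x"
      by (metis uminus_conj_perm[OF \<phi>] uminus_point_uminus)
    then have "- p (\<phi> x) = \<phi> x"
      by (metis permutes_inverses(1)[OF \<phi>])
    then have "p (\<phi> x) = - \<phi> x"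
      by (metis uminus_point_uminus)
    moreover have "\<phi> x \<in> pm J" using that permutes_in_image[OF V] by simp
    ultimately show False using p PM_iff[OF J] by blast
  qed
  then show ?thesis
    using reversible_conj_perm[OF \<phi>] p by (simp add: PM_iff[OF J])
qed

lemma inv_K_eq:
  assumes "\<phi> permutes J" "p permutes pm J"
  shows "inv (K \<phi> p) = conj_perm \<phi> p"
proof (rule inv_unique_comp)
  have m: "minus_perm \<phi> (minus_perm (inv \<phi>) x) = x" "minus_perm (inv \<phi>) (minus_perm \<phi> x) = x" for x
    using permutes_inverses[OF assms(1)] by (simp_all add: minus_perm_def)
  show "K \<phi> p \<circ> conj_perm \<phi> p = id" "conj_perm \<phi> p \<circ> K \<phi> p = id"
    using permutes_inverses[OF assms(1)] permutes_inverses[OF assms(2)]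
    by (auto simp: fun_eq_iff K_def conj_perm_def inv_minus_perm[OF assms(1)] m)
qed

lemma double_perm_uminus:
  assumes "\<phi> permutes J" "k \<in> J"
  shows "double_perm \<phi> (- k) = - inv \<phi> k"
proof -
  have "inv \<phi> k \<in> J"
    using assms permutes_in_image[OF permutes_inv] by fast
  then show ?thesis
    using permutes_not_in[OF assms(1)] uminus_notin_J
    by (simp add: double_perm_def inv_minus_perm[OF assms(1)]) (simp add: minus_perm_def)
qed

lemma double_perm_pos:
  assumes "\<phi> permutes J" "k \<in> J"
  shows "double_perm \<phi> k = \<phi> k"
  using permutes_not_in[OF permutes_inv[OF assms(1)] uminus_notin_J[OF assms(2)]]
  by (simp add: double_perm_def inv_minus_perm[OF assms(1)]) (simp add: minus_perm_def)

lemma double_perm_PM: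
  assumes "\<phi> permutes J"
  shows "double_perm \<phi> \<in> PM J"
proof -
  have J: "signed_set J" by unfold_locales
  have iJ: "inv \<phi> k \<in> J \<longleftrightarrow> k \<in> J" "\<phi> k \<in> J \<longleftrightarrow> k \<in> J" for k
    using permutes_in_image[OF permutes_inv[OF assms]] permutes_in_image[OF assms] by auto
  note i = permutes_inverses[OF assms]
  have d: "double_perm \<phi> x = (if x \<in> J then \<phi> x else if - x \<in> J then - inv \<phi> (- x) else x)" for x
  proof (cases "x \<in> J \<or> - x \<in> J")
    case True
    then show ?thesis
      using double_perm_pos[OF assms, of x] double_perm_uminus[OF assms, of "- x"] uminus_notin_J by auto
  next
    case False
    then show ?thesis
      using permutes_not_in[OF assms, of x] permutes_not_in[OF permutes_inv[OF assms], of "- x"]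
      by (simp add: double_perm_def inv_minus_perm[OF assms]) (simp add: minus_perm_def)
  qed
  have "reversible J (double_perm \<phi>)"
  proof (rule reversibleI[OF finite_J])
    fix x
    have "- x \<in> J \<Longrightarrow> x \<in> pm J" using subset_pm by force
    then show "double_perm \<phi> x \<in> pm J" if "x \<in> pm J"
      using that subset_pm iJ by (auto simp: d)
    show "double_perm \<phi> x = x" if "x \<notin> pm J"
      using that \<open>- x \<in> J \<Longrightarrow> x \<in> pm J\<close> subset_pm by (auto simp: d)
    show "double_perm \<phi> (- double_perm \<phi> (- x)) = x"
      using uminus_notin_J iJ i by (simp add: d)
  qed
  moreover have "double_perm \<phi> x \<noteq> - x" if "x \<in> pm J" for x
  proof (cases "x \<in> J")
    case True
    then show ?thesis using iJ(2)[of x] uminus_notin_J[OF True] by (auto simp: d)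
  next
    case False
    then have "inv \<phi> (- x) \<noteq> x" using iJ(1)[of "- x"] uminus_in_J_iff[OF that] by metis
    then show ?thesis using False uminus_in_J_iff[OF that] by (simp add: d)
  qed
  ultimately show ?thesis by (simp add: PM_iff[OF J])
qed

lemma num_orbits_double_perm:
  assumes "\<phi> permutes J"
  shows "num_orbits J (double_perm \<phi>) = num_orbits J \<phi>" "num_orbits (pm J) (double_perm \<phi>) = 2 * num_orbits J \<phi>"
proof -
  have J: "signed_set J" by unfold_locales
  show *: "num_orbits J (double_perm \<phi>) = num_orbits J \<phi>"
    by (rule num_orbits_cong) (simp_all add: double_perm_pos[OF assms] permutes_in_image[OF assms])
  show "num_orbits (pm J) (double_perm \<phi>) = 2 * num_orbits J \<phi>"
    using num_orbits_half_system(2)[OF half_system_J, of "double_perm \<phi>"] double_perm_PM[OF assms] *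
    by (simp add: PM_iff[OF J] double_perm_pos[OF assms] permutes_in_image[OF assms])
qed

lemma half_system_conj:
  assumes p: "p \<in> PM J" and R: "half_system J p R"
    and e: "\<And>x. e (e x) = x" "\<And>x. e (- x) = - e x" "\<And>x. x \<in> pm J \<Longrightarrow> e x \<in> pm J"
  shows "e \<circ> p \<circ> e \<in> PM J" "half_system J (e \<circ> p \<circ> e) (e ` R)"
    "num_orbits (e ` R) (e \<circ> p \<circ> e) = num_orbits R p"
proof -
  have J: "signed_set J" by unfold_locales
  have r: "reversible J p" and np: "\<And>x. x \<in> pm J \<Longrightarrow> p x \<noteq> - x"
    using p by (auto simp: PM_iff[OF J])
  note p' = reversibleD[OF r] and R' = half_systemD[OF R]
  have eV: "e x \<in> pm J \<longleftrightarrow> x \<in> pm J" for x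
    using e(1,3) by metis
  have "reversible J (e \<circ> p \<circ> e)"
  proof (rule reversibleI[OF finite_J])
    show "(e \<circ> p \<circ> e) x \<in> pm J" if "x \<in> pm J" for x
      using that by (simp add: eV p'(6))
    show "(e \<circ> p \<circ> e) x = x" if "x \<notin> pm J" for x
      using that permutes_not_in[OF p'(1), of "e x"] by (simp add: eV e(1))
    show "(e \<circ> p \<circ> e) (- (e \<circ> p \<circ> e) (- x)) = x" for x
    proof -
      have "e (- e (p (e (- x)))) = - p (- e x)"
        by (simp add: e(1,2))
      then show ?thesis by (simp add: p'(3) e(1))
    qed
  qed
  moreover have "e (p (e x)) \<noteq> - x" if "x \<in> pm J" for x
    using np[of "e x"] that e by metis
  ultimately show "e \<circ> p \<circ> e \<in> PM J"
    by (simp add: PM_iff[OF J])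
  have mem: "x \<in> e ` R \<longleftrightarrow> e x \<in> R" for x
    using e(1) by (metis image_iff)
  show "half_system J (e \<circ> p \<circ> e) (e ` R)"
    unfolding half_system_def
  proof (intro conjI ballI)
    show "e ` R \<subseteq> pm J" using R'(1) eV by auto
    show "(e \<circ> p \<circ> e) ` e ` R \<subseteq> e ` R" using R'(2) by (auto simp: e(1))
    show "k \<in> e ` R \<longleftrightarrow> - k \<notin> e ` R" if "k \<in> pm J" for k
      using R'(3)[of "e k"] that eV by (simp add: mem e(2))
  qed
  show "num_orbits (e ` R) (e \<circ> p \<circ> e) = num_orbits R p"
    using finite_J e(1)
    by (intro num_orbits_image permutes_self_in_orbit[OF p'(1)]) (auto simp: inj_def, metis)
qed

end

lemma signed_set_inf_points: "signed_set (inf_points n)"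
  by unfold_locales (auto simp: inf_points_def fin_points_def zero_extended_def)

lemma signed_set_fin_points: "signed_set (fin_points n)"
  by unfold_locales (auto simp: fin_points_def zero_extended_def)

abbreviation (input) color_class :: "nat \<Rightarrow> (point \<Rightarrow> nat) \<Rightarrow> nat \<Rightarrow> point set" where
  "color_class n w d \<equiv> {k \<in> fin_points n. w k = d}"

lemma signed_set_color_class: "signed_set (color_class n w d)"
  using signed_set_fin_points[of n] by (auto simp: signed_set_def)

lemma pm_color_class_disjoint:
  assumes "x \<in> pm (color_class n w c)" "x \<in> pm (color_class n w d)"
  shows "c = d"
  using assms signed_set.uminus_notin_J[OF signed_set_fin_points, of _ n]
  by (auto simp: pm_def)

lemma pm_fin_points_eq:
  assumes "w \<in> fin_points n \<rightarrow> {1..C}"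
  shows "pm (fin_points n) = (\<Union>c\<in>{1..C}. pm (color_class n w c))"
  using assms by (fastforce simp: pm_def)

lemma pm_inf_points: "pm (inf_points n) = {Pinf, Minf} \<union> pm (fin_points n)"
  by (auto simp: pm_def inf_points_def)

lemma infinite_notin_fin [simp]: "Pinf \<notin> pm (fin_points n)" "Minf \<notin> pm (fin_points n)"
  by (auto simp: pm_def fin_points_def)

locale colored_pairing =
  fixes n C :: nat and w :: "point \<Rightarrow> nat" and a :: "nat \<Rightarrow> point \<Rightarrow> point"
  assumes w: "w \<in> fin_points n \<rightarrow> {1..C}"
    and a: "\<And>c. c \<in> {1..C} \<Longrightarrow> a c \<in> PM (color_class n w c)"
begin

abbreviation "I \<equiv> color_class n w"
abbreviation "\<alpha> \<equiv> compose_perms C a"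

lemma a_reversible: "c \<in> {1..C} \<Longrightarrow> reversible (I c) (a c)"
  and a_neq: "c \<in> {1..C} \<Longrightarrow> x \<in> pm (I c) \<Longrightarrow> a c x \<noteq> - x"
  using a PM_iff[OF signed_set_color_class] by blast+

lemma a_outside: "d \<in> {1..C} \<Longrightarrow> y \<notin> pm (I d) \<Longrightarrow> a d y = y"
  using permutes_not_in[OF reversibleD(1)[OF a_reversible]] .

lemma compose_perms_class:
  assumes "c \<in> {1..C}" "x \<in> pm (I c)"
  shows "\<alpha> x = a c x"
proof -
  define F where "F cs = foldr (\<lambda>c p. a c \<circ> p) cs id" for cs
  have F_simps: "F [] z = z" "F (d # cs) z = a d (F cs z)" for d cs z
    by (simp_all add: F_def)
  have im: "a c x \<in> pm (I c)"
    using reversibleD(6)[OF a_reversible[OF assms(1)]] assms(2) by blast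
  have "F cs x = (if c \<in> set cs then a c x else x)"
    if "distinct cs" "set cs \<subseteq> {1..C}" for cs
    using that
  proof (induction cs)
    case (Cons d cs)
    have d: "d \<in> {1..C}" "d \<notin> set cs" and cs: "distinct cs" "set cs \<subseteq> {1..C}"
      using Cons.prems by auto
    have other: "a d z = z" if "z \<in> pm (I c)" "d \<noteq> c" for z
      using a_outside[OF d(1), of z] that pm_color_class_disjoint by blast
    show ?case
      using Cons.IH[OF cs] d(2) other[OF im] other[OF assms(2)]
      by (cases "d = c") (auto simp: F_simps)
  qed (simp add: F_simps)
  from this[of "[1..<Suc C]"] assms(1) show ?thesis
    by (simp add: compose_perms_def F_def atLeastLessThanSuc_atLeastAtMost del: upt_Suc)
qed

lemma compose_perms_outside:
  assumes "y \<notin> pm (fin_points n)"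
  shows "\<alpha> y = y"
proof -
  have "a d y = y" if "d \<in> {1..C}" for d
    using a_outside[OF that, of y] assms by (auto simp: pm_def)
  then have "foldr (\<lambda>c p. a c \<circ> p) cs id y = y" if "set cs \<subseteq> {1..C}" for cs
    using that by (induction cs) auto
  then show ?thesis
    by (simp add: compose_perms_def atLeastLessThanSuc_atLeastAtMost del: upt_Suc)
qed

lemma \<alpha>_infinite [simp]: "\<alpha> Pinf = Pinf" "\<alpha> Minf = Minf"
  by (simp_all add: compose_perms_outside)

text \<open>
  Of the two trivial cycles at infinity the one of \<open>\<infinity>\<close> is chosen; on each
  colour the choice is that of the moment formula.
\<close>

definition "half = insert Pinf (\<Union>c\<in>{1..C}. FD (I c) (a c))"

lemma pm_inf_cases [consumes 1, case_names infinite finite]: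
  assumes "x \<in> pm (inf_points n)"
  obtains "x \<in> {Pinf, Minf}" | c where "c \<in> {1..C}" "x \<in> pm (I c)"
  using assms pm_fin_points_eq[OF w] by (auto simp: pm_inf_points)

lemma FD_class:
  assumes "c \<in> {1..C}"
  shows "FD (I c) (a c) \<subseteq> pm (I c)" "x \<in> FD (I c) (a c) \<Longrightarrow> a c x \<in> FD (I c) (a c)"
    "x \<in> pm (I c) \<Longrightarrow> - x \<in> FD (I c) (a c) \<longleftrightarrow> x \<notin> FD (I c) (a c)"
  using half_systemD[OF signed_set.half_system_FD[OF signed_set_color_class a[OF assms]]] by blast+

lemma pm_color_class_subset: "pm (I c) \<subseteq> pm (fin_points n)"
  by (auto simp: pm_def)

lemma mem_half_iff:
  assumes "c \<in> {1..C}" "x \<in> pm (I c)"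
  shows "x \<in> half \<longleftrightarrow> x \<in> FD (I c) (a c)"
proof -
  have "x \<noteq> Pinf"
    using assms(2) pm_color_class_subset infinite_notin_fin by blast
  moreover have "d = c" if "d \<in> {1..C}" "x \<in> FD (I d) (a d)" for d
    using that FD_class(1)[OF that(1)] assms(2) pm_color_class_disjoint by blast
  ultimately have "x \<in> half \<Longrightarrow> x \<in> FD (I c) (a c)"
    unfolding half_def by blast
  then show ?thesis
    using assms(1) unfolding half_def by blast
qed

lemma Minf_notin_half: "Minf \<notin> half"
  using FD_class(1) pm_color_class_subset infinite_notin_fin by (fastforce simp: half_def)

lemma \<alpha>_PM: "\<alpha> \<in> PM (inf_points n)"
proof -
  interpret J: signed_set "inf_points n" by (rule signed_set_inf_points)
  have im: "\<alpha> x \<in> pm (I c)" if "c \<in> {1..C}" "x \<in> pm (I c)" for c x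
    using reversibleD(6)[OF a_reversible] compose_perms_class that by simp
  have "reversible (inf_points n) \<alpha>"
  proof (rule reversibleI[OF J.finite_J])
    show "\<alpha> x \<in> pm (inf_points n)" if "x \<in> pm (inf_points n)" for x
      using that
    proof (cases rule: pm_inf_cases)
      case (finite c)
      then show ?thesis
        using im[OF finite] pm_color_class_subset by (auto simp: pm_inf_points)
    qed (auto simp: pm_inf_points)
    show out: "\<alpha> x = x" if "x \<notin> pm (inf_points n)" for x
      using that by (intro compose_perms_outside) (auto simp: pm_inf_points)
    show "\<alpha> (- \<alpha> (- x)) = x" for x
    proof (cases "x \<in> pm (inf_points n)")
      case True
      then show ?thesis
      proof (cases rule: pm_inf_cases)
        case (finite c)
        then show ?thesis
          using reversibleD(3,6)[OF a_reversible[OF finite(1)]] im[of c "- x"] compose_perms_class[OF finite(1)]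
          by simp
      qed auto
    qed (simp add: out)
  qed
  moreover have "\<alpha> x \<noteq> - x" if "x \<in> pm (inf_points n)" for x
    using that
  proof (cases rule: pm_inf_cases)
    case (finite c)
    then show ?thesis
      using a_neq[OF finite] by (simp add: compose_perms_class)
  qed auto
  ultimately show ?thesis
    by (simp add: PM_iff[OF signed_set_inf_points])
qed

lemma half_system_half: "half_system (inf_points n) \<alpha> half"
  unfolding half_system_def
proof (intro conjI ballI)
  show "half \<subseteq> pm (inf_points n)"
    using FD_class(1) pm_color_class_subset by (fastforce simp: half_def pm_inf_points)
  show "\<alpha> ` half \<subseteq> half"
  proof (rule image_subsetI)
    fix x assume "x \<in> half"
    then consider "x = Pinf" | c where "c \<in> {1..C}" "x \<in> FD (I c) (a c)"
      by (auto simp: half_def)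
    then show "\<alpha> x \<in> half"
    proof cases
      case (2 c)
      then have "\<alpha> x = a c x"
        using compose_perms_class[OF 2(1)] FD_class(1)[OF 2(1)] by blast
      then have "\<alpha> x \<in> FD (I c) (a c)"
        using FD_class(2)[OF 2] by simp
      then show ?thesis
        using 2(1) unfolding half_def by blast
    qed (simp add: half_def)
  qed
  fix k assume "k \<in> pm (inf_points n)"
  then show "k \<in> half \<longleftrightarrow> - k \<notin> half"
  proof (cases rule: pm_inf_cases)
    case infinite
    then show ?thesis using Minf_notin_half by (auto simp: half_def)
  next
    case (finite c)
    then show ?thesis
      using FD_class(3)[OF finite] mem_half_iff[OF finite(1), of k] mem_half_iff[OF finite(1), of "- k"]
      by simp
  qed
qed

text \<open>
  The summand \<open>1\<close> is the fixed point at infinity.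
\<close>

lemma num_orbits_half:
  "num_orbits half \<alpha> = 1 + (\<Sum>c\<in>{1..C}. num_orbits (pm (I c)) (a c) div 2)"
proof -
  interpret J: signed_set "inf_points n" by (rule signed_set_inf_points)
  have fin: "finite (FD (I c) (a c))" if "c \<in> {1..C}" for c
    using FD_class(1)[OF that] signed_set.finite_J[OF signed_set_color_class]
    by (auto intro: finite_subset)
  have \<alpha>_FD: "\<alpha> x = a c x" "\<alpha> x \<in> FD (I c) (a c)" if "c \<in> {1..C}" "x \<in> FD (I c) (a c)" for c x
  proof -
    show "\<alpha> x = a c x"
      using compose_perms_class[OF that(1)] FD_class(1)[OF that(1)] that(2) by blast
    then show "\<alpha> x \<in> FD (I c) (a c)"
      using FD_class(2)[OF that] by simp
  qed
  have "num_orbits half \<alpha> = num_orbits {Pinf} \<alpha> + num_orbits (\<Union>c\<in>{1..C}. FD (I c) (a c)) \<alpha>"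
    unfolding half_def
  proof (subst insert_is_Un, rule num_orbits_Un)
    show "{Pinf} \<inter> (\<Union>c\<in>{1..C}. FD (I c) (a c)) = {}"
      using FD_class(1) pm_color_class_subset infinite_notin_fin(1)[of n] by blast
    show "finite (\<Union>c\<in>{1..C}. FD (I c) (a c))"
      using fin by blast
    show "\<alpha> x \<in> (\<Union>c\<in>{1..C}. FD (I c) (a c))" if "x \<in> (\<Union>c\<in>{1..C}. FD (I c) (a c))" for x
      using that \<alpha>_FD(2) by blast
  qed simp_all
  also have "num_orbits {Pinf} \<alpha> = 1"
    by (simp add: num_orbits_def)
  also have "num_orbits (\<Union>c\<in>{1..C}. FD (I c) (a c)) \<alpha> = (\<Sum>c\<in>{1..C}. num_orbits (FD (I c) (a c)) \<alpha>)"
  proof (rule num_orbits_UN)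
    show "disjoint_family_on (\<lambda>c. FD (I c) (a c)) {1..C}"
      unfolding disjoint_family_on_def using FD_class(1) pm_color_class_disjoint by blast
    show "\<alpha> x \<in> FD (I c) (a c)" if "c \<in> {1..C}" "x \<in> FD (I c) (a c)" for c x
      using that by (rule \<alpha>_FD(2))
  qed (use fin in simp_all)
  also have "(\<Sum>c\<in>{1..C}. num_orbits (FD (I c) (a c)) \<alpha>) = (\<Sum>c\<in>{1..C}. num_orbits (pm (I c)) (a c) div 2)"
  proof (intro sum.cong refl)
    fix c assume c: "c \<in> {1..C}"
    have "num_orbits (FD (I c) (a c)) \<alpha> = num_orbits (FD (I c) (a c)) (a c)"
      using \<alpha>_FD[OF c] by (intro num_orbits_cong) auto
    then show "num_orbits (FD (I c) (a c)) \<alpha> = num_orbits (pm (I c)) (a c) div 2"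
      using signed_set.num_orbits_half_system(2)[OF signed_set_color_class
          signed_set.half_system_FD[OF signed_set_color_class a[OF c]] a_reversible[OF c]]
      by simp
  qed
  finally show ?thesis by simp
qed

end

section \<open>Traces as sums over signed points\<close>

definition position_set :: "nat \<Rightarrow> (point \<Rightarrow> point) \<Rightarrow> 'N \<Rightarrow> 'N \<Rightarrow> (point \<Rightarrow> 'N) set" where
  "position_set n q r c = {i \<in> pm (inf_points n) \<rightarrow>\<^sub>E UNIV.
     (\<forall>k\<in>pm (inf_points n). i (- k) = i (q k)) \<and> i Minf = r \<and> i Pinf = c}"

definition quaternion_index_set :: "nat \<Rightarrow> (point \<Rightarrow> point) \<Rightarrow> int \<Rightarrow> int \<Rightarrow> (point \<Rightarrow> int) set" where
  "quaternion_index_set n p s t = {h \<in> pm (inf_points n) \<rightarrow>\<^sub>E {1, -1}.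
     (\<forall>k\<in>pm (inf_points n). point_sgn k * h (- k) = point_sgn (p k) * h (p k)) \<and> h Minf = s \<and> h Pinf = t}"

lemma point_sgn_mult_self [simp]: "point_sgn x * point_sgn x = 1" "point_sgn x * (point_sgn x * y) = y"
  by (simp_all add: point_sgn_def)

lemma point_sgn_cases: "point_sgn x \<in> {1, -1}"
  by (simp add: point_sgn_def)

lemma sign_mult_mem: "x \<in> {1, -1 :: int} \<Longrightarrow> y \<in> {1, -1} \<Longrightarrow> x * y \<in> {1, -1}"
  "x \<in> {1, -1 :: int} \<Longrightarrow> - x \<in> {1, -1}"
  by auto

lemma cnj_qentry:
  assumes "s \<in> {1, -1}" "t \<in> {1, -1}"
  shows "cnj (qentry q s t) = of_int (s * t) * qentry q (- s) (- t)"
  using assms by (auto simp: qentry_def complex_eq_iff)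

lemma qentry_qpow:
  assumes "s \<in> {1, -1}" "t \<in> {1, -1}"
  shows "qentry (qpow A e $ u $ v) s t =
    (if e = 1 then qentry (A $ u $ v) s t else of_int (s * t) * qentry (A $ v $ u) (- t) (- s))"
  using assms by (simp add: qpow_def qadjoint_def qentry_qcnj cnj_qentry mult.commute)

lemma qentry_sum: "qentry (\<Sum>x\<in>S. f x) s t = (\<Sum>x\<in>S. qentry (f x) s t)"
  by (induction S rule: infinite_finite_induct)
    (auto simp: qentry_def complex_eq_iff zero_complex.code)

lemma qentry_qmm:
  assumes "s \<in> {1, -1}" "t \<in> {1, -1}"
  shows "qentry (qmm A B $ u $ v) s t =
    (\<Sum>j\<in>UNIV. \<Sum>g\<in>{1, -1}. qentry (A $ u $ j) s g * qentry (B $ j $ v) g t)"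
  using assms by (simp add: qmm_def qentry_sum qentry_qtimes)

lemma finite_inf_points: "finite (inf_points n)" "finite (fin_points n)"
  by (simp_all add: inf_points_def fin_points_def)

lemma fin_points_memD:
  assumes "k \<in> fin_points n"
  shows "k \<in> inf_points n" "k \<in> pm (inf_points n)" "- k \<in> pm (inf_points n)" "k \<noteq> Pinf" "k \<noteq> Minf"
    "- k \<noteq> Pinf" "- k \<noteq> Minf" "0 < k" "\<not> 0 < - k" "point_sgn k = 1" "point_sgn (- k) = -1"
  using assms by (auto simp: inf_points_def fin_points_def pm_def zero_extended_def point_sgn_def)

lemma infinite_mem [simp]: "Pinf \<in> pm (inf_points n)" "Minf \<in> pm (inf_points n)" "Pinf \<in> inf_points n"
  by (auto simp: pm_def inf_points_def)

lemma point_sgn_infinite [simp]: "point_sgn Pinf = 1" "point_sgn Minf = -1"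
  by (simp_all add: point_sgn_def zero_extended_def)

lemma pm_inf_points_cases:
  assumes "x \<in> pm (inf_points n)"
  obtains "x = Pinf" | "x = Minf" | "x \<in> fin_points n" | k where "k \<in> fin_points n" "x = - k"
  using assms by (auto simp: pm_def inf_points_def)

lemma prod_half_system:
  assumes D: "half_system (inf_points n) p D" "Pinf \<in> D"
  shows "(\<Prod>x\<in>D - {Pinf}. f x) = (\<Prod>k\<in>fin_points n. f (if k \<in> D then k else - k))"
proof (rule prod.reindex_bij_witness[where i = "\<lambda>k. if k \<in> D then k else - k" and j = point_abs])
  note D' = half_systemD[OF D(1)]
  have abs: "point_abs k = k" "point_abs (- k) = k" if "k \<in> fin_points n" for k
    using fin_points_memD(8)[OF that] by (simp_all add: point_abs_pos)
  have Minf: "Minf \<notin> D"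
    using D(2) D'(3)[of Pinf] by simp
  fix x
  {
    assume "x \<in> D - {Pinf}"
    then have x: "x \<in> D" "x \<noteq> Pinf" "x \<noteq> Minf" "x \<in> pm (inf_points n)"
      using Minf D'(1) by auto
    have "point_abs x \<in> fin_points n \<and> (if point_abs x \<in> D then point_abs x else - point_abs x) = x"
      using x(4)
    proof (cases rule: pm_inf_points_cases)
      case (4 k)
      then have "k \<notin> D"
        using D'(3)[of k] x fin_points_memD(2) by auto
      then show ?thesis using 4 by (simp add: abs)
    qed (use x abs in auto)
    then show "(if point_abs x \<in> D then point_abs x else - point_abs x) = x"
      "point_abs x \<in> fin_points n" "f (if point_abs x \<in> D then point_abs x else - point_abs x) = f x"
      by auto
  next
    assume x: "x \<in> fin_points n"
    then show "point_abs (if x \<in> D then x else - x) = x"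
      by (simp add: abs)
    show "(if x \<in> D then x else - x) \<in> D - {Pinf}"
      using D'(3)[of x] fin_points_memD[OF x] by auto
  }
qed

text \<open>
  A quaternion index \<open>h\<close> on the cycles in \<open>D\<close> extends to
  \<open>\<plusminus>J\<close> by \<open>sgn x * h x\<close> at \<open>x \<in> D\<close> and
  \<open>sgn x * h (p x)\<close> at \<open>- x\<close>.  The constraint states precisely that
  the two prescriptions fit together along \<open>p\<close>.  For \<open>k\<close> with \<open>-
  k \<in> D\<close> the entry of the adjoint becomes the entry of \<open>A k\<close> at the
  extended indices, times \<open>h k * h (- k)\<close>.
\<close>

theorem re_tr_symmetric:
  fixes A :: "point \<Rightarrow> quat ^ 'N::finite ^ 'N"
  assumes p: "p \<in> PM (inf_points n)" and st: "s \<in> {1, -1}" "t \<in> {1, -1}"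
  defines "D \<equiv> FD (inf_points n) p"
  shows "re_tr n p q A r c s t =
    (\<Sum>i\<in>position_set n q r c. \<Sum>h\<in>quaternion_index_set n p s t.
      of_int (\<Prod>k | k \<in> fin_points n \<and> - k \<in> D. h k * h (- k)) *
      (\<Prod>k\<in>fin_points n. qentry (A k $ i k $ i (- k)) (h k) (h (- k))))
    / (2 ^ (num_orbits D p - 1) * of_nat CARD('N) ^ (num_orbits (FD (inf_points n) q) q - 1))"
proof -
  interpret J: signed_set "inf_points n" by (rule signed_set_inf_points)
  let ?V = "pm (inf_points n)"
  have r: "reversible (inf_points n) p"
    using p PM_iff[OF signed_set_inf_points] by blast
  note p' = reversibleD[OF r]
  have half: "half_system (inf_points n) p D"
    unfolding D_def by (rule J.half_system_FD[OF p])
  note D = half_systemD[OF half]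
  have p_mem: "p x \<in> D \<longleftrightarrow> x \<in> D" for x
    by (rule J.half_system_image_iff[OF half r])
  have Pinf: "Pinf \<in> D"
    using permutes_self_in_orbit[OF p'(1), of Pinf] finite_inf_points by (simp add: D_def FD_def)
  define ext where "ext h = (\<lambda>x\<in>?V. if x \<in> D then point_sgn x * h x else - point_sgn x * h (p (- x)))"
    for h :: "point \<Rightarrow> int"
  define res where "res h = (\<lambda>x\<in>D. point_sgn x * h x)" for h :: "point \<Rightarrow> int"
  have "(\<Sum>h | h \<in> (D \<rightarrow>\<^sub>E {1, -1}) \<and> h (p Pinf) = s \<and> h Pinf = t.
      \<Prod>k\<in>D - {Pinf}. qentry (signed_mat A k $ i k $ i (- k)) (h k) (h (p k))) =
    (\<Sum>h\<in>quaternion_index_set n p s t.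
      of_int (\<Prod>k | k \<in> fin_points n \<and> - k \<in> D. h k * h (- k)) *
      (\<Prod>k\<in>fin_points n. qentry (A k $ i k $ i (- k)) (h k) (h (- k))))"
    (is "sum ?f ?S = sum ?g ?T") for i
  proof (rule sum.reindex_bij_witness[where j = ext and i = res])
    fix h assume "h \<in> ?S"
    then have h: "h \<in> D \<rightarrow>\<^sub>E {1, -1}" "h (p Pinf) = s" "h Pinf = t" by auto
    have hD: "h x \<in> {1, -1}" if "x \<in> D" for x
      using h(1) that by (auto simp: PiE_def)
    show "res (ext h) = h"
    proof
      fix x
      show "res (ext h) x = h x"
      proof (cases "x \<in> D")
        case True
        then have "x \<in> ?V" using D(1) by auto
        then show ?thesis using True by (simp add: res_def ext_def)
      next
        case False
        then show ?thesis by (simp add: res_def PiE_arb[OF h(1)])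
      qed
    qed
    have ext_D: "ext h x = point_sgn x * h x" if "x \<in> D" for x
      using that D(1) by (auto simp: ext_def)
    have ext_neg: "ext h (- x) = point_sgn x * h (p x)" if "x \<in> D" for x
    proof -
      have "x \<in> ?V" using that D(1) by auto
      then show ?thesis
        using that D(3)[of x] by (simp add: ext_def J.point_sgn_uminus)
    qed
    show "ext h \<in> ?T"
      unfolding quaternion_index_set_def
    proof (intro CollectI conjI ballI)
      show "ext h \<in> ?V \<rightarrow>\<^sub>E {1, -1}"
      proof (rule PiE_I)
        fix x assume x: "x \<in> ?V"
        show "ext h x \<in> {1, -1}"
        proof (cases "x \<in> D")
          case True
          then show ?thesis
            unfolding ext_D[OF True] by (intro sign_mult_mem hD point_sgn_cases)
        next
          case False
          then have "p (- x) \<in> D" using D(3)[OF x] p_mem by blast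
          then show ?thesis
            using x False hD[of "p (- x)"] point_sgn_cases[of x] by (auto simp: ext_def)
        qed
      qed (simp add: ext_def)
      fix k assume k: "k \<in> ?V"
      show "point_sgn k * ext h (- k) = point_sgn (p k) * ext h (p k)"
      proof (cases "k \<in> D")
        case True
        then show ?thesis
          using p_mem by (simp add: ext_neg ext_D)
      next
        case False
        then have nk: "- k \<in> D" using D(3)[OF k] by blast
        have npk: "- p k \<in> D"
          using D(3)[of "p k"] p'(6) k False p_mem by blast
        have "ext h (p k) = point_sgn (- p k) * h (p (- p k))"
          using ext_neg[OF npk] by simp
        then show ?thesis
          using k p'(6) by (simp add: ext_D[OF nk] J.point_sgn_uminus p'(4))
      qed
    next
      show "ext h Minf = s"
        using ext_neg[OF Pinf] h(2) by simp
      show "ext h Pinf = t"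
        using ext_D[OF Pinf] h(3) by simp
    qed
    show "?g (ext h) = ?f h"
    proof -
      have "?f h = (\<Prod>k\<in>fin_points n. qentry (signed_mat A (if k \<in> D then k else - k) $
          i (if k \<in> D then k else - k) $ i (- (if k \<in> D then k else - k)))
          (h (if k \<in> D then k else - k)) (h (p (if k \<in> D then k else - k))))"
        by (rule prod_half_system[OF half Pinf])
      also have "\<dots> = (\<Prod>k\<in>fin_points n. of_int (if - k \<in> D then ext h k * ext h (- k) else 1) *
          qentry (A k $ i k $ i (- k)) (ext h k) (ext h (- k)))"
      proof (intro prod.cong refl)
        fix k assume k: "k \<in> fin_points n"
        note k' = fin_points_memD[OF k]
        show "qentry (signed_mat A (if k \<in> D then k else - k) $
            i (if k \<in> D then k else - k) $ i (- (if k \<in> D then k else - k)))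
            (h (if k \<in> D then k else - k)) (h (p (if k \<in> D then k else - k))) =
          of_int (if - k \<in> D then ext h k * ext h (- k) else 1) *
            qentry (A k $ i k $ i (- k)) (ext h k) (ext h (- k))"
        proof (cases "k \<in> D")
          case True
          then have "- k \<notin> D" using D(3) k' by blast
          then show ?thesis
            using True k' by (simp add: signed_mat_def ext_D ext_neg)
        next
          case False
          then have nk: "- k \<in> D" using D(3) k' by blast
          have e: "ext h (- k) = - h (- k)" "ext h k = - h (p (- k))"
            using ext_D[OF nk] ext_neg[OF nk] k' by simp_all
          have s: "h (- k) \<in> {1, -1}" "h (p (- k)) \<in> {1, -1}"
            using hD nk p_mem by blast+
          show ?thesis
            using False nk k' by (simp add: e signed_mat_def qadjoint_def qentry_qcnj[OF s] cnj_qentry[OF s(2,1)])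
        qed
      qed
      also have "\<dots> = ?g (ext h)"
        unfolding prod.inter_filter[OF finite_inf_points(2)] of_int_prod by (rule prod.distrib)
      finally show ?thesis ..
    qed
  next
    fix h assume "h \<in> ?T"
    then have h: "h \<in> ?V \<rightarrow>\<^sub>E {1, -1}" "h Minf = s" "h Pinf = t"
      and rel: "\<And>k. k \<in> ?V \<Longrightarrow> point_sgn k * h (- k) = point_sgn (p k) * h (p k)"
      by (auto simp: quaternion_index_set_def)
    show "ext (res h) = h"
    proof
      fix x
      consider "x \<notin> ?V" | "x \<in> D" "x \<in> ?V" | "- x \<in> D" "x \<notin> D" "x \<in> ?V"
        using D by blast
      then show "ext (res h) x = h x"
      proof cases
        case 3
        then show ?thesis
          using rel[of "- x", symmetric] by (simp add: ext_def res_def p_mem J.point_sgn_uminus)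
      qed (simp_all add: ext_def res_def PiE_arb[OF h(1)])
    qed
    have "res h (p Pinf) = s"
      using rel[of Pinf] p_mem Pinf h by (simp add: res_def)
    moreover have "res h Pinf = t"
      using Pinf h by (simp add: res_def)
    moreover have "res h \<in> D \<rightarrow>\<^sub>E {1, -1}"
    proof (rule PiE_I)
      fix x assume x: "x \<in> D"
      then have "h x \<in> {1, -1}" using D(1) h(1) by (auto simp: PiE_def)
      then show "res h x \<in> {1, -1}"
        using x point_sgn_cases[of x] by (auto simp: res_def)
    qed (simp add: res_def)
    ultimately show "res h \<in> ?S" by simp
  qed
  then show ?thesis
    by (simp add: re_tr_def Let_def D_def position_set_def)
qed

section \<open>Index sums for products and their transport\<close>

text \<open>
  The index functions of a trace along a permutation \<open>\<phi>\<close> of \<open>J\<close>,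
  for positions and quaternion indices alike.
\<close>

definition loop_set :: "nat \<Rightarrow> 'b set \<Rightarrow> (point \<Rightarrow> point) \<Rightarrow> 'b \<Rightarrow> 'b \<Rightarrow> (point \<Rightarrow> 'b) set" where
  "loop_set n T \<phi> b a = {f \<in> pm (inf_points n) \<rightarrow>\<^sub>E T.
     (\<forall>k\<in>pm (inf_points n). f (- k) = f (double_perm \<phi> k)) \<and> f Minf = b \<and> f Pinf = a}"

text \<open>
  The index functions of such a trace after each factor has been split in two: \<open>f
  k\<close> and \<open>f (- k)\<close> are the outer and the new inner index of the
  \<open>k\<close>-th factor.  The value at \<open>-\<infinity>\<close>, where no factor sits,
  is set to that at \<open>\<infinity>\<close>, as is demanded by a pairing that fixes both
  points.
\<close>

definition split_set :: "nat \<Rightarrow> 'b set \<Rightarrow> (point \<Rightarrow> point) \<Rightarrow> 'b \<Rightarrow> 'b \<Rightarrow> (point \<Rightarrow> 'b) set" where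
  "split_set n T \<phi> b a =
     {f \<in> pm (inf_points n) \<rightarrow>\<^sub>E T. f Pinf = a \<and> f Minf = a \<and> f (\<phi> Pinf) = b}"

lemma position_set_double_perm: "position_set n (double_perm \<phi>) r c = loop_set n UNIV \<phi> r c"
  by (simp add: position_set_def loop_set_def)

lemma point_sgn_double_perm:
  assumes "\<phi> permutes inf_points n" "k \<in> pm (inf_points n)"
  shows "point_sgn (double_perm \<phi> k) = point_sgn k"
proof -
  interpret J: signed_set "inf_points n" by (rule signed_set_inf_points)
  have "double_perm \<phi> \<in> PM (inf_points n)" by (rule J.double_perm_PM[OF assms(1)])
  then have "double_perm \<phi> k \<in> pm (inf_points n)"
    using assms(2) reversibleD(6) PM_iff[OF signed_set_inf_points] by blast
  moreover have "double_perm \<phi> k \<in> inf_points n \<longleftrightarrow> k \<in> inf_points n"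
  proof (cases "k \<in> inf_points n")
    case True
    then show ?thesis
      using J.double_perm_pos[OF assms(1) True] permutes_in_image[OF assms(1)] by simp
  next
    case False
    then have "- k \<in> inf_points n" using assms(2) J.uminus_in_J_iff by blast
    then show ?thesis
      using J.double_perm_uminus[OF assms(1), of "- k"] False J.uminus_notin_J
        permutes_in_image[OF permutes_inv[OF assms(1)], of "- k"] by simp
  qed
  ultimately show ?thesis
    using assms(2) by (simp add: J.point_sgn_eq)
qed

text \<open>
  Since \<open>double_perm \<phi>\<close> preserves signs, the signs in the constraint cancel.
\<close>

lemma quaternion_index_set_double_perm:
  assumes "\<phi> permutes inf_points n"
  shows "quaternion_index_set n (double_perm \<phi>) s t = loop_set n {1, -1} \<phi> s t"
proof -
  have "(point_sgn k * h (- k) = point_sgn (double_perm \<phi> k) * h (double_perm \<phi> k)) =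
      (h (- k) = h (double_perm \<phi> k))" if "k \<in> pm (inf_points n)" for k and h :: "point \<Rightarrow> int"
    using point_sgn_cases[of k] by (auto simp: point_sgn_double_perm[OF assms that])
  then show ?thesis
    unfolding quaternion_index_set_def loop_set_def by (intro Collect_cong) auto
qed

lemma re_tr_perm_eq:
  fixes A :: "point \<Rightarrow> quat ^ 'N::finite ^ 'N"
  assumes R: "\<phi>\<^sub>R permutes inf_points n" and t: "\<phi>\<^sub>t permutes inf_points n"
    and st: "s \<in> {1, -1}" "t \<in> {1, -1}"
  shows "re_tr_perm n \<phi>\<^sub>R \<phi>\<^sub>t A r c s t =
    (\<Sum>i\<in>loop_set n UNIV \<phi>\<^sub>t r c. \<Sum>h\<in>loop_set n {1, -1} \<phi>\<^sub>R s t.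
      (\<Prod>k\<in>fin_points n. qentry (A k $ i k $ i (- k)) (h k) (h (- k))))
    / (2 ^ (num_orbits (inf_points n) \<phi>\<^sub>R - 1) * of_nat CARD('N) ^ (num_orbits (inf_points n) \<phi>\<^sub>t - 1))"
proof -
  interpret J: signed_set "inf_points n" by (rule signed_set_inf_points)
  have "{k \<in> fin_points n. - k \<in> inf_points n} = {}"
    using fin_points_memD(1) J.uminus_notin_J by blast
  then show ?thesis
    unfolding re_tr_perm_def
    using re_tr_symmetric[OF J.double_perm_PM[OF R] st, of "double_perm \<phi>\<^sub>t" A r c]
    by (simp add: FD_double_perm[OF R] FD_double_perm[OF t] position_set_double_perm
        quaternion_index_set_double_perm[OF R] J.num_orbits_double_perm(1)[OF R] J.num_orbits_double_perm(1)[OF t]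
        del: Collect_empty_eq)
qed

text \<open>
  In a trace along \<open>\<phi>\<close> the index at \<open>- k\<close> is the one at
  \<open>\<phi> k\<close>, hence redundant; its place is taken by the new index \<open>j
  k\<close>.
\<close>

lemma sum_loop_set_split:
  assumes \<phi>: "\<phi> permutes inf_points n" and a: "a \<in> T"
  shows "(\<Sum>i\<in>loop_set n T \<phi> b a. \<Sum>j\<in>fin_points n \<rightarrow>\<^sub>E T. \<Psi> (\<lambda>k\<in>fin_points n. (i k, j k, i (- k)))) =
    (\<Sum>f\<in>split_set n T \<phi> b a. \<Psi> (\<lambda>k\<in>fin_points n. (f k, f (- k), f (\<phi> k))))"
proof -
  interpret J: signed_set "inf_points n" by (rule signed_set_inf_points)
  let ?V = "pm (inf_points n)"
  have V: "\<phi> permutes ?V" using \<phi> subset_pm by (rule permutes_subset)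
  have \<phi>J: "\<phi> x \<in> inf_points n \<longleftrightarrow> x \<in> inf_points n" for x by (rule permutes_in_image[OF \<phi>])
  have \<phi>_pos: "0 < \<phi> x" "\<phi> x \<in> ?V" if "x \<in> inf_points n" for x
    using that \<phi>J J.pos_J subset_pm by blast+
  have Pinf_pos: "0 < (Pinf :: point)" "\<not> 0 < (Minf :: point)"
    by (simp_all add: zero_extended_def)
  \<comment> \<open>At \<open>-\<infinity>\<close> the boundary value \<open>b\<close> of \<open>i\<close> is the value at \<open>\<phi> \<infinity>\<close>, which frees this place for \<open>a\<close>.\<close>
  define join where "join z = (\<lambda>x\<in>?V. if x = Minf then a else if 0 < x then fst z x else snd z (- x))"
    for z :: "(point \<Rightarrow> 'a) \<times> (point \<Rightarrow> 'a)"
  define cut where "cut f = (\<lambda>x\<in>?V. if 0 < x then f x else f (\<phi> (- x)), \<lambda>k\<in>fin_points n. f (- k))"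
    for f :: "point \<Rightarrow> 'a"
  have "(\<Sum>z\<in>loop_set n T \<phi> b a \<times> (fin_points n \<rightarrow>\<^sub>E T). \<Psi> (\<lambda>k\<in>fin_points n. (fst z k, snd z k, fst z (- k)))) =
    (\<Sum>f\<in>split_set n T \<phi> b a. \<Psi> (\<lambda>k\<in>fin_points n. (f k, f (- k), f (\<phi> k))))"
  proof (rule sum.reindex_bij_witness[where j = join and i = cut])
    fix z assume "z \<in> loop_set n T \<phi> b a \<times> (fin_points n \<rightarrow>\<^sub>E T)"
    then obtain i j where z: "z = (i, j)" and i: "i \<in> ?V \<rightarrow>\<^sub>E T" "i Minf = b" "i Pinf = a"
      and rel: "\<And>k. k \<in> ?V \<Longrightarrow> i (- k) = i (double_perm \<phi> k)" and j: "j \<in> fin_points n \<rightarrow>\<^sub>E T"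
      by (auto simp: loop_set_def)
    have rel': "i (- k) = i (\<phi> k)" if "k \<in> inf_points n" for k
      using rel[of k] that subset_pm J.double_perm_pos[OF \<phi> that] by auto
    have join_pos: "join z x = i x" if "0 < x" "x \<in> ?V" for x
      using that Pinf_pos by (auto simp: join_def z)
    have join_neg: "join z (- k) = j k" if "k \<in> fin_points n" for k
      using fin_points_memD[OF that] by (simp add: join_def z)
    have join_Minf: "join z Minf = a"
      by (simp add: join_def)
    have mem: "i x \<in> T" if "x \<in> ?V" for x
      using i(1) that by (rule PiE_mem)
    show "cut (join z) = z"
    proof -
      have "fst (cut (join z)) x = i x" for x
      proof (cases "x \<in> ?V")
        case True
        show ?thesis
        proof (cases "0 < x")
          case True
          then show ?thesis using \<open>x \<in> ?V\<close> by (simp add: cut_def join_pos)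
        next
          case False
          then have x: "- x \<in> inf_points n"
            using True J.pos_iff J.uminus_in_J_iff by blast
          then show ?thesis
            using True False rel'[OF x] \<phi>_pos[OF x] by (simp add: cut_def join_pos)
        qed
      qed (simp add: cut_def PiE_arb[OF i(1)])
      moreover have "snd (cut (join z)) x = j x" for x
        by (cases "x \<in> fin_points n") (simp_all add: cut_def join_neg PiE_arb[OF j])
      ultimately show ?thesis
        by (auto simp: z prod_eq_iff)
    qed
    show "join z \<in> split_set n T \<phi> b a"
      unfolding split_set_def
    proof (intro CollectI conjI)
      show "join z \<in> ?V \<rightarrow>\<^sub>E T"
      proof (rule PiE_I)
        fix x assume "x \<in> ?V"
        then show "join z x \<in> T"
        proof (cases rule: pm_inf_points_cases)
          case 1
          then show ?thesis using join_pos[of Pinf] Pinf_pos mem by simp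
        next
          case 2
          then show ?thesis using a by (simp add: join_Minf)
        next
          case 3
          then show ?thesis using fin_points_memD[OF 3] by (simp add: join_pos mem)
        next
          case (4 k)
          then show ?thesis using PiE_mem[OF j] by (simp add: join_neg)
        qed
      qed (simp add: join_def)
      show "join z Pinf = a" using join_pos[of Pinf] Pinf_pos i by simp
      show "join z Minf = a" by (rule join_Minf)
      show "join z (\<phi> Pinf) = b"
        using join_pos[of "\<phi> Pinf"] \<phi>_pos[of Pinf] rel'[of Pinf] i by simp
    qed
    have "(\<lambda>k\<in>fin_points n. (join z k, join z (- k), join z (\<phi> k))) =
        (\<lambda>k\<in>fin_points n. (fst z k, snd z k, fst z (- k)))"
    proof (intro restrict_ext)
      fix k assume k: "k \<in> fin_points n"
      note k' = fin_points_memD[OF k]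
      show "(join z k, join z (- k), join z (\<phi> k)) = (fst z k, snd z k, fst z (- k))"
        using join_pos[OF k'(8,2)] join_neg[OF k] join_pos[OF \<phi>_pos[OF k'(1)]] rel'[OF k'(1)]
        by (simp add: z)
    qed
    then show "\<Psi> (\<lambda>k\<in>fin_points n. (join z k, join z (- k), join z (\<phi> k))) =
        \<Psi> (\<lambda>k\<in>fin_points n. (fst z k, snd z k, fst z (- k)))"
      by simp
  next
    fix f assume "f \<in> split_set n T \<phi> b a"
    then have f: "f \<in> ?V \<rightarrow>\<^sub>E T" "f Pinf = a" "f Minf = a" "f (\<phi> Pinf) = b"
      by (auto simp: split_set_def)
    have mem: "f x \<in> T" if "x \<in> ?V" for x
      using f(1) that by (rule PiE_mem)
    have fst_pos: "fst (cut f) x = f x" if "x \<in> inf_points n" for x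
      using that J.pos_J subset_pm by (auto simp: cut_def)
    have fst_neg: "fst (cut f) (- x) = f (\<phi> x)" if "x \<in> inf_points n" for x
    proof -
      have "\<not> 0 < - x" "x \<in> ?V"
        using that J.pos_iff[of "- x"] J.uminus_notin_J subset_pm by auto
      then show ?thesis by (simp add: cut_def)
    qed
    show "join (cut f) = f"
    proof
      fix x
      show "join (cut f) x = f x"
      proof (cases "x \<in> ?V")
        case True
        then show ?thesis
        proof (cases rule: pm_inf_points_cases)
          case 1
          then show ?thesis using fst_pos[of Pinf] Pinf_pos by (simp add: join_def)
        next
          case 3
          then show ?thesis using fin_points_memD[OF 3] by (simp add: join_def fst_pos)
        next
          case (4 k)
          then show ?thesis
            using fin_points_memD[OF 4(1)] by (simp add: join_def) (simp add: cut_def)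
        qed (simp add: join_def f)
      qed (simp add: join_def PiE_arb[OF f(1)])
    qed
    have "fst (cut f) \<in> loop_set n T \<phi> b a"
      unfolding loop_set_def
    proof (intro CollectI conjI ballI)
      show "fst (cut f) \<in> ?V \<rightarrow>\<^sub>E T"
      proof (rule PiE_I)
        fix x assume x: "x \<in> ?V"
        then consider "x \<in> inf_points n" | "- x \<in> inf_points n"
          using J.uminus_in_J_iff by blast
        then show "fst (cut f) x \<in> T"
        proof cases
          case 1
          then show ?thesis using x by (simp add: fst_pos mem)
        next
          case 2
          then show ?thesis using fst_neg[OF 2] \<phi>_pos[OF 2] by (simp add: mem)
        qed
      qed (simp add: cut_def)
      show "fst (cut f) Minf = b" using fst_neg[of Pinf] f by simp
      show "fst (cut f) Pinf = a" using fst_pos[of Pinf] f by simp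
      fix k assume k: "k \<in> ?V"
      show "fst (cut f) (- k) = fst (cut f) (double_perm \<phi> k)"
      proof (cases "k \<in> inf_points n")
        case True
        then show ?thesis
          using \<phi>J by (simp add: fst_neg fst_pos J.double_perm_pos[OF \<phi>])
      next
        case False
        then have nk: "- k \<in> inf_points n" using k J.uminus_in_J_iff by blast
        have "inv \<phi> (- k) \<in> inf_points n"
          using nk permutes_in_image[OF permutes_inv[OF \<phi>]] by blast
        then show ?thesis
          using J.double_perm_uminus[OF \<phi> nk] nk
          by (simp add: fst_pos fst_neg permutes_inverses[OF \<phi>])
      qed
    qed
    moreover have "snd (cut f) \<in> fin_points n \<rightarrow>\<^sub>E T"
      using mem fin_points_memD(2) by (auto simp: cut_def)
    ultimately show "cut f \<in> loop_set n T \<phi> b a \<times> (fin_points n \<rightarrow>\<^sub>E T)"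
      by (simp add: mem_Times_iff)
  qed
  then show ?thesis
    by (simp add: sum.cartesian_product split_beta)
qed

text \<open>
  The substitution is \<open>i = f \<circ> \<phi> \<circ> \<delta>\<close>; here
  \<open>\<phi>\<close> takes \<open>- q x\<close> to \<open>- \<beta> (\<phi> x)\<close>.  The
  relation \<open>rel\<close> depends on the points only through their signs, which
  \<open>\<phi>\<close> preserves, and so covers both the position and the quaternion
  constraint.  That \<open>rel 1 1\<close> implies equality is used at the fixed point
  \<open>\<infinity>\<close> of \<open>\<beta>\<close>, where it recovers the boundary value of
  \<open>f\<close>.
\<close>

lemma sum_split_set_conj:
  fixes rel :: "int \<Rightarrow> int \<Rightarrow> 'b \<Rightarrow> 'b \<Rightarrow> bool"
  assumes \<phi>: "\<phi> permutes inf_points n" and \<beta>: "\<beta> \<in> PM (inf_points n)" "\<beta> Pinf = Pinf"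
    and rel: "\<And>u v. rel 1 1 u v \<Longrightarrow> u = v"
  defines "q \<equiv> conj_perm \<phi> \<beta>"
  shows "(\<Sum>f | f \<in> split_set n T \<phi> b a \<and>
        (\<forall>x\<in>pm (inf_points n). rel (point_sgn x) (point_sgn (\<beta> x)) (f x) (f (- \<beta> x))).
      F (\<lambda>x\<in>pm (inf_points n). f (\<phi> (- x)))) =
    (\<Sum>i | i \<in> pm (inf_points n) \<rightarrow>\<^sub>E T \<and>
        (\<forall>x\<in>pm (inf_points n). rel (point_sgn x) (point_sgn (q x)) (i (- x)) (i (q x))) \<and>
        i Minf = b \<and> i Pinf = a. F i)"
  (is "sum ?G ?S = sum ?F ?T")
proof -
  interpret J: signed_set "inf_points n" by (rule signed_set_inf_points)
  let ?V = "pm (inf_points n)"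
  have V: "\<phi> permutes ?V" using \<phi> subset_pm by (rule permutes_subset)
  have \<phi>V: "\<phi> x \<in> ?V \<longleftrightarrow> x \<in> ?V" "inv \<phi> x \<in> ?V \<longleftrightarrow> x \<in> ?V" for x
    by (rule permutes_in_image[OF V], rule permutes_in_image[OF permutes_inv[OF V]])
  note inv = permutes_inverses[OF \<phi>]
  have q: "q x = - inv \<phi> (- \<beta> (\<phi> x))" for x
    using J.uminus_conj_perm[OF \<phi>, of \<beta> x] unfolding q_def by (metis uminus_point_uminus)
  have r: "reversible (inf_points n) \<beta>"
    using \<beta>(1) PM_iff[OF signed_set_inf_points] by blast
  have \<beta>V: "\<beta> x \<in> ?V \<longleftrightarrow> x \<in> ?V" for x by (rule reversibleD(6)[OF r])
  have qV: "q x \<in> ?V \<longleftrightarrow> x \<in> ?V" for x by (simp add: q \<phi>V \<beta>V)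
  have sgn_\<phi>: "point_sgn (\<phi> x) = point_sgn x" "point_sgn (inv \<phi> x) = point_sgn x" if "x \<in> ?V" for x
    using that permutes_in_image[OF \<phi>] permutes_in_image[OF permutes_inv[OF \<phi>]] \<phi>V
    by (simp_all add: J.point_sgn_eq)
  have sgn_q: "point_sgn (q x) = point_sgn (\<beta> (\<phi> x))" if "x \<in> ?V" for x
    using that by (simp add: q J.point_sgn_uminus \<phi>V \<beta>V sgn_\<phi>)
  have \<phi>_Minf: "\<phi> Minf = Minf"
    using permutes_not_in[OF \<phi> J.uminus_notin_J[of Pinf]] by simp
  show ?thesis
  proof (rule sum.reindex_bij_witness[where j = "\<lambda>f. \<lambda>x\<in>?V. f (\<phi> (- x))" and i = "\<lambda>i. \<lambda>x\<in>?V. i (- inv \<phi> x)"])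
    fix f assume "f \<in> ?S"
    then have f: "f \<in> ?V \<rightarrow>\<^sub>E T" "f Pinf = a" "f Minf = a" "f (\<phi> Pinf) = b"
      and frel: "\<And>x. x \<in> ?V \<Longrightarrow> rel (point_sgn x) (point_sgn (\<beta> x)) (f x) (f (- \<beta> x))"
      by (auto simp: split_set_def)
    show "(\<lambda>x\<in>?V. (\<lambda>x\<in>?V. f (\<phi> (- x))) (- inv \<phi> x)) = f"
    proof
      fix x
      show "(\<lambda>x\<in>?V. (\<lambda>x\<in>?V. f (\<phi> (- x))) (- inv \<phi> x)) x = f x"
        by (cases "x \<in> ?V") (simp_all add: \<phi>V inv PiE_arb[OF f(1)])
    qed
    show "(\<lambda>x\<in>?V. f (\<phi> (- x))) \<in> ?T"
    proof (intro CollectI conjI ballI)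
      show "(\<lambda>x\<in>?V. f (\<phi> (- x))) \<in> ?V \<rightarrow>\<^sub>E T"
        using PiE_mem[OF f(1)] \<phi>V by auto
      show "(\<lambda>x\<in>?V. f (\<phi> (- x))) Minf = b" "(\<lambda>x\<in>?V. f (\<phi> (- x))) Pinf = a"
        using f \<phi>_Minf by simp_all
      fix x assume x: "x \<in> ?V"
      have "\<phi> (- q x) = - \<beta> (\<phi> x)" by (simp add: q inv)
      then show "rel (point_sgn x) (point_sgn (q x)) ((\<lambda>x\<in>?V. f (\<phi> (- x))) (- x)) ((\<lambda>x\<in>?V. f (\<phi> (- x))) (q x))"
        using frel[of "\<phi> x"] x by (simp add: \<phi>V qV sgn_\<phi> sgn_q)
    qed
  next
    fix i assume "i \<in> ?T"
    then have i: "i \<in> ?V \<rightarrow>\<^sub>E T" "i Minf = b" "i Pinf = a"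
      and irel: "\<And>x. x \<in> ?V \<Longrightarrow> rel (point_sgn x) (point_sgn (q x)) (i (- x)) (i (q x))"
      by auto
    let ?f = "\<lambda>x\<in>?V. i (- inv \<phi> x)"
    show "(\<lambda>x\<in>?V. ?f (\<phi> (- x))) = i"
    proof
      fix x
      show "(\<lambda>x\<in>?V. ?f (\<phi> (- x))) x = i x"
        by (cases "x \<in> ?V") (simp_all add: \<phi>V inv PiE_arb[OF i(1)])
    qed
    have frel: "rel (point_sgn x) (point_sgn (\<beta> x)) (?f x) (?f (- \<beta> x))" if x: "x \<in> ?V" for x
      using irel[of "inv \<phi> x"] x by (simp add: \<phi>V \<beta>V sgn_\<phi> sgn_q inv) (simp add: q inv)
    have inv_Minf: "inv \<phi> Minf = Minf"
      using \<phi>_Minf inv(2) by metis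
    have "?f Pinf = ?f Minf"
      using frel[of Pinf] rel by (simp add: \<beta>(2))
    moreover have "?f Minf = a"
      using i by (simp add: inv_Minf)
    moreover have "?f (\<phi> Pinf) = b"
      using i by (simp add: \<phi>V inv)
    moreover have "?f \<in> ?V \<rightarrow>\<^sub>E T"
      using PiE_mem[OF i(1)] \<phi>V by auto
    ultimately show "?f \<in> ?S"
      using frel unfolding split_set_def by auto
  qed simp
qed

lemma re_tr_perm_qmm:
  fixes B Y :: "point \<Rightarrow> quat ^ 'N::finite ^ 'N"
  assumes R: "\<phi>\<^sub>R permutes inf_points n" and t: "\<phi>\<^sub>t permutes inf_points n"
    and st: "s \<in> {1, -1}" "t \<in> {1, -1}"
  shows "re_tr_perm n \<phi>\<^sub>R \<phi>\<^sub>t (\<lambda>k. qmm (B k) (Y k)) r c s t =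
    (\<Sum>i\<in>split_set n UNIV \<phi>\<^sub>t r c. \<Sum>h\<in>split_set n {1, -1} \<phi>\<^sub>R s t.
      (\<Prod>k\<in>fin_points n. qentry (B k $ i k $ i (- k)) (h k) (h (- k))) *
      (\<Prod>k\<in>fin_points n. qentry (Y k $ i (- k) $ i (\<phi>\<^sub>t k)) (h (- k)) (h (\<phi>\<^sub>R k))))
    / (2 ^ (num_orbits (inf_points n) \<phi>\<^sub>R - 1) * of_nat CARD('N) ^ (num_orbits (inf_points n) \<phi>\<^sub>t - 1))"
proof -
  define E where "E x y k = qentry (B k $ fst x $ fst (snd x)) (fst y) (fst (snd y)) *
      qentry (Y k $ fst (snd x) $ snd (snd x)) (fst (snd y)) (snd (snd y))"
    for x :: "'N \<times> 'N \<times> 'N" and y :: "int \<times> int \<times> int" and k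
  let ?F = "fin_points n"
  let ?L\<^sub>t = "loop_set n (UNIV :: 'N set) \<phi>\<^sub>t r c" and ?L\<^sub>R = "loop_set n {1, -1 :: int} \<phi>\<^sub>R s t"
  have expand: "(\<Prod>k\<in>?F. qentry (qmm (B k) (Y k) $ i k $ i (- k)) (h k) (h (- k))) =
      (\<Sum>j\<in>?F \<rightarrow>\<^sub>E UNIV. \<Sum>g\<in>?F \<rightarrow>\<^sub>E {1, -1}. \<Prod>k\<in>?F. E (i k, j k, i (- k)) (h k, g k, h (- k)) k)"
    if h: "h \<in> ?L\<^sub>R" for i h
  proof -
    have h: "h k \<in> {1, -1}" "h (- k) \<in> {1, -1}" if "k \<in> ?F" for k
      using h fin_points_memD(2,3)[OF that] PiE_mem[of h "pm (inf_points n)" "\<lambda>_. {1, -1}"]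
      unfolding loop_set_def by blast+
    have "(\<Prod>k\<in>?F. qentry (qmm (B k) (Y k) $ i k $ i (- k)) (h k) (h (- k))) =
        (\<Prod>k\<in>?F. \<Sum>j\<in>UNIV. \<Sum>g\<in>{1, -1}. E (i k, j, i (- k)) (h k, g, h (- k)) k)"
      by (intro prod.cong refl) (simp only: qentry_qmm[OF h] E_def fst_conv snd_conv)
    also have "\<dots> = (\<Sum>j\<in>?F \<rightarrow>\<^sub>E UNIV. \<Prod>k\<in>?F. \<Sum>g\<in>{1, -1}. E (i k, j k, i (- k)) (h k, g, h (- k)) k)"
      by (rule prod_sum_PiE) (simp_all add: finite_inf_points)
    also have "\<dots> = (\<Sum>j\<in>?F \<rightarrow>\<^sub>E UNIV. \<Sum>g\<in>?F \<rightarrow>\<^sub>E {1, -1}. \<Prod>k\<in>?F. E (i k, j k, i (- k)) (h k, g k, h (- k)) k)"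
      by (intro sum.cong refl prod_sum_PiE) (simp_all add: finite_inf_points)
    finally show ?thesis .
  qed
  have "(\<Sum>i\<in>?L\<^sub>t. \<Sum>h\<in>?L\<^sub>R. \<Prod>k\<in>?F. qentry (qmm (B k) (Y k) $ i k $ i (- k)) (h k) (h (- k))) =
    (\<Sum>i\<in>?L\<^sub>t. \<Sum>j\<in>?F \<rightarrow>\<^sub>E UNIV. \<Sum>h\<in>?L\<^sub>R. \<Sum>g\<in>?F \<rightarrow>\<^sub>E {1, -1}.
      \<Prod>k\<in>?F. E (i k, j k, i (- k)) (h k, g k, h (- k)) k)"
    by (intro sum.cong refl) (simp only: expand sum.swap[of _ "?F \<rightarrow>\<^sub>E UNIV" ?L\<^sub>R] cong: sum.cong)
  also have "\<dots> = (\<Sum>i\<in>?L\<^sub>t. \<Sum>j\<in>?F \<rightarrow>\<^sub>E UNIV. \<Sum>h\<in>split_set n {1, -1} \<phi>\<^sub>R s t.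
      \<Prod>k\<in>?F. E (i k, j k, i (- k)) (h k, h (- k), h (\<phi>\<^sub>R k)) k)"
    using sum_loop_set_split[OF R st(2), where \<Psi> = "\<lambda>z. \<Prod>k\<in>?F. E (i k, j k, i (- k)) (z k) k" and b = s for i j]
    by simp
  also have "\<dots> = (\<Sum>i\<in>split_set n UNIV \<phi>\<^sub>t r c. \<Sum>h\<in>split_set n {1, -1} \<phi>\<^sub>R s t.
      \<Prod>k\<in>?F. E (i k, i (- k), i (\<phi>\<^sub>t k)) (h k, h (- k), h (\<phi>\<^sub>R k)) k)"
    using sum_loop_set_split[OF t UNIV_I, where b = r and a = c and
        \<Psi> = "\<lambda>z. \<Sum>h\<in>split_set n {1, -1} \<phi>\<^sub>R s t. \<Prod>k\<in>?F. E (z k) (h k, h (- k), h (\<phi>\<^sub>R k)) k"]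
    by simp
  finally show ?thesis
    unfolding re_tr_perm_eq[OF R t st] by (simp add: E_def prod.distrib)
qed

section \<open>The sign of the remaining trace\<close>

lemma card_inf_points: "card (inf_points n) = n + 1"
proof -
  have "Pinf \<notin> fin_points n" by (auto simp: fin_points_def)
  moreover have "card (fin_points n) = n"
    by (simp add: fin_points_def card_image inj_on_def)
  ultimately show ?thesis
    by (simp add: inf_points_def finite_inf_points)
qed

text \<open>
  This is the invariance of the alignment sign for \<open>G = sgn \<cdot> h\<close>.  It is
  applied to the complements of \<open>R\<close> and \<open>D\<close>, because \<open>k \<in>
  J\<close> lies in the complement if and only if \<open>- k\<close> lies in the set.
\<close>

lemma quaternion_sign_transfer:
  fixes h :: "point \<Rightarrow> int"
  assumes \<phi>: "\<phi> permutes inf_points n" and \<beta>: "\<beta> \<in> PM (inf_points n)"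
    and R: "half_system (inf_points n) \<beta> R" "Pinf \<in> R"
    and h: "\<And>x. x \<in> pm (inf_points n) \<Longrightarrow> h x \<in> {1, -1}"
    and rel: "\<And>x. x \<in> pm (inf_points n) \<Longrightarrow> point_sgn x * h x = point_sgn (\<beta> x) * h (- \<beta> x)"
  defines "p \<equiv> conj_perm \<phi> \<beta>"
  defines "D \<equiv> FD (inf_points n) p"
  shows "(\<Prod>k | k \<in> fin_points n \<and> - k \<in> R. h k * h (- k)) =
    (- 1) ^ (n + 1 + num_orbits (inf_points n) \<phi> + num_orbits R \<beta> + num_orbits D p) *
    (\<Prod>k | k \<in> fin_points n \<and> - k \<in> D. h (- k) * h (\<phi> k))"
proof -
  interpret J: signed_set "inf_points n" by (rule signed_set_inf_points)
  let ?J = "inf_points n"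
  have r: "reversible ?J \<beta>"
    using \<beta> PM_iff[OF signed_set_inf_points] by blast
  have p: "p \<in> PM ?J"
    unfolding p_def by (rule J.conj_perm_PM[OF \<phi> \<beta>])
  then have rp: "reversible ?J p"
    using PM_iff[OF signed_set_inf_points] by blast
  have D: "half_system ?J p D"
    unfolding D_def by (rule J.half_system_FD[OF p])
  have "Pinf \<in> D"
    using permutes_self_in_orbit[OF reversibleD(1)[OF rp], of Pinf] finite_inf_points
    by (simp add: D_def FD_def)
  have V: "\<phi> permutes pm ?J" using \<phi> subset_pm by (rule permutes_subset)
  define G where "G x = point_sgn x * h x" for x
  have "(- 1) ^ num_orbits (pm ?J - R) \<beta> * (\<Prod>k\<in>?J \<inter> (pm ?J - R). - (G k * G (- k))) =
    sign \<phi> * (- 1) ^ num_orbits (pm ?J - D) p * (\<Prod>k\<in>?J \<inter> (pm ?J - D). - (G (\<phi> k) * G (\<phi> (- k))))"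
    unfolding p_def
  proof (rule J.sign_conj_perm[OF \<phi> r])
    show "half_system ?J \<beta> (pm ?J - R)"
      by (rule J.half_system_compl(1)[OF R(1) r])
    show "half_system ?J (conj_perm \<phi> \<beta>) (pm ?J - D)"
      using J.half_system_compl(1)[OF D rp] by (simp add: p_def)
    fix x assume x: "x \<in> pm ?J"
    show "G x \<in> {1, -1}"
      unfolding G_def using h[OF x] by (intro sign_mult_mem point_sgn_cases)
    show "G (- \<beta> x) = - G x"
      using rel[OF x] x by (simp add: G_def J.point_sgn_uminus reversibleD(6)[OF r])
  qed
  moreover have "num_orbits (pm ?J - R) \<beta> = num_orbits R \<beta>"
    by (rule J.num_orbits_half_system(1)[OF R(1) r])
  moreover have "num_orbits (pm ?J - D) p = num_orbits D p"
    by (rule J.num_orbits_half_system(1)[OF D rp])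
  moreover have sets: "?J \<inter> (pm ?J - S) = {k \<in> fin_points n. - k \<in> S}"
    if "half_system ?J \<pi> S" "Pinf \<in> S" for \<pi> S
  proof -
    have "k \<in> pm ?J - S \<longleftrightarrow> - k \<in> S" if "k \<in> ?J" for k
      using half_systemD(3)[OF \<open>half_system ?J \<pi> S\<close>, of k] that subset_pm by blast
    moreover have "Minf \<notin> S"
      using half_systemD(3)[OF that(1), of Pinf] that(2) by simp
    ultimately have "?J \<inter> (pm ?J - S) = {k \<in> ?J. - k \<in> S \<and> k \<noteq> Pinf}"
      using that(2) by auto
    moreover have "{k \<in> ?J. - k \<in> S \<and> k \<noteq> Pinf} = {k \<in> fin_points n. - k \<in> S}"
      using fin_points_memD(4) by (auto simp: inf_points_def)
    ultimately show ?thesis by simp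
  qed
  moreover have "(\<Prod>k | k \<in> fin_points n \<and> - k \<in> R. - (G k * G (- k))) =
      (\<Prod>k | k \<in> fin_points n \<and> - k \<in> R. h k * h (- k))"
  proof (intro prod.cong refl)
    fix k assume "k \<in> {k \<in> fin_points n. - k \<in> R}"
    then have "k \<in> fin_points n" by simp
    then show "- (G k * G (- k)) = h k * h (- k)"
      using fin_points_memD(10,11) by (simp add: G_def)
  qed
  moreover have "(\<Prod>k | k \<in> fin_points n \<and> - k \<in> D. - (G (\<phi> k) * G (\<phi> (- k)))) =
      (\<Prod>k | k \<in> fin_points n \<and> - k \<in> D. h (- k) * h (\<phi> k))"
  proof (intro prod.cong refl)
    fix k assume "k \<in> {k \<in> fin_points n. - k \<in> D}"
    then have k: "k \<in> fin_points n" by simp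
    have "\<phi> (- k) = - k"
      using permutes_not_in[OF \<phi> J.uminus_notin_J[OF fin_points_memD(1)[OF k]]] .
    moreover have "point_sgn (\<phi> k) = 1"
      using permutes_in_image[OF \<phi>, of k] fin_points_memD(1)[OF k] J.pos_J by (simp add: point_sgn_def)
    ultimately show "- (G (\<phi> k) * G (\<phi> (- k))) = h (- k) * h (\<phi> k)"
      using fin_points_memD[OF k] by (simp add: G_def)
  qed
  ultimately have "(- 1) ^ num_orbits R \<beta> * (\<Prod>k | k \<in> fin_points n \<and> - k \<in> R. h k * h (- k)) =
    sign \<phi> * (- 1) ^ num_orbits D p * (\<Prod>k | k \<in> fin_points n \<and> - k \<in> D. h (- k) * h (\<phi> k))"
    using sets[OF R] sets[OF D \<open>Pinf \<in> D\<close>] by simp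
  moreover have "sign \<phi> = (- 1) ^ (n + 1 + num_orbits ?J \<phi>)"
    using sign_eq_card_orbits[OF finite_inf_points(1) \<phi>] by (simp add: num_orbits_def card_inf_points)
  ultimately have "(- 1) ^ num_orbits R \<beta> * ((- 1) ^ num_orbits R \<beta> *
      (\<Prod>k | k \<in> fin_points n \<and> - k \<in> R. h k * h (- k))) =
    (- 1) ^ (n + 1 + num_orbits (inf_points n) \<phi> + num_orbits R \<beta> + num_orbits D p) *
    (\<Prod>k | k \<in> fin_points n \<and> - k \<in> D. h (- k) * h (\<phi> k))"
    by (simp only: power_add ac_simps)
  then show ?thesis
    by (simp flip: power_add mult.assoc)
qed

text \<open>
  After the substitution the index sums are those of the trace along \<open>p\<close> and
  \<open>q\<close>, term by term up to the constant sign provided by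
  \<open>quaternion_sign_transfer\<close>.
\<close>

theorem remaining_trace:
  fixes Y :: "point \<Rightarrow> quat ^ 'N::finite ^ 'N"
  assumes \<phi>\<^sub>R: "\<phi>\<^sub>R permutes inf_points n" and \<phi>\<^sub>t: "\<phi>\<^sub>t permutes inf_points n"
    and \<beta>: "\<beta> \<in> PM (inf_points n)" "\<beta> Pinf = Pinf"
    and R: "half_system (inf_points n) \<beta> R" "Pinf \<in> R"
    and st: "s \<in> {1, -1}" "t \<in> {1, -1}"
  defines "p \<equiv> conj_perm \<phi>\<^sub>R \<beta>" and "q \<equiv> conj_perm \<phi>\<^sub>t \<beta>"
  defines "D \<equiv> FD (inf_points n) p"
  shows "(\<Sum>i | i \<in> split_set n UNIV \<phi>\<^sub>t r c \<and> (\<forall>x\<in>pm (inf_points n). i x = i (- \<beta> x)).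
      \<Sum>h | h \<in> split_set n {1, -1} \<phi>\<^sub>R s t \<and>
        (\<forall>x\<in>pm (inf_points n). point_sgn x * h x = point_sgn (\<beta> x) * h (- \<beta> x)).
        of_int (\<Prod>k | k \<in> fin_points n \<and> - k \<in> R. h k * h (- k)) *
        (\<Prod>k\<in>fin_points n. qentry (Y k $ i (- k) $ i (\<phi>\<^sub>t k)) (h (- k)) (h (\<phi>\<^sub>R k)))) =
    (- 1) ^ (n + 1 + num_orbits (inf_points n) \<phi>\<^sub>R + num_orbits R \<beta> + num_orbits D p) *
    (2 ^ (num_orbits D p - 1) * of_nat CARD('N) ^ (num_orbits (FD (inf_points n) q) q - 1)) *
    re_tr n p q Y r c s t"
proof -
  interpret J: signed_set "inf_points n" by (rule signed_set_inf_points)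
  let ?V = "pm (inf_points n)"
  let ?\<sigma> = "(- 1) ^ (n + 1 + num_orbits (inf_points n) \<phi>\<^sub>R + num_orbits R \<beta> + num_orbits D p) :: complex"
  have p: "p \<in> PM (inf_points n)"
    unfolding p_def by (rule J.conj_perm_PM[OF \<phi>\<^sub>R \<beta>(1)])
  have neg: "\<phi> (- k) = - k" if "\<phi> permutes inf_points n" "k \<in> fin_points n" for \<phi> k
    using permutes_not_in[OF that(1) J.uminus_notin_J[OF fin_points_memD(1)[OF that(2)]]] .
  define F where "F i h = ?\<sigma> * (of_int (\<Prod>k | k \<in> fin_points n \<and> - k \<in> D. h k * h (- k)) *
      (\<Prod>k\<in>fin_points n. qentry (Y k $ i k $ i (- k)) (h k) (h (- k))))"
    for i :: "point \<Rightarrow> 'N" and h :: "point \<Rightarrow> int"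
  have "(\<Sum>i | i \<in> split_set n UNIV \<phi>\<^sub>t r c \<and> (\<forall>x\<in>?V. i x = i (- \<beta> x)).
      \<Sum>h | h \<in> split_set n {1, -1} \<phi>\<^sub>R s t \<and> (\<forall>x\<in>?V. point_sgn x * h x = point_sgn (\<beta> x) * h (- \<beta> x)).
        of_int (\<Prod>k | k \<in> fin_points n \<and> - k \<in> R. h k * h (- k)) *
        (\<Prod>k\<in>fin_points n. qentry (Y k $ i (- k) $ i (\<phi>\<^sub>t k)) (h (- k)) (h (\<phi>\<^sub>R k)))) =
    (\<Sum>i | i \<in> split_set n UNIV \<phi>\<^sub>t r c \<and> (\<forall>x\<in>?V. i x = i (- \<beta> x)).
      \<Sum>h | h \<in> split_set n {1, -1} \<phi>\<^sub>R s t \<and> (\<forall>x\<in>?V. point_sgn x * h x = point_sgn (\<beta> x) * h (- \<beta> x)).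
        F (\<lambda>x\<in>?V. i (\<phi>\<^sub>t (- x))) (\<lambda>x\<in>?V. h (\<phi>\<^sub>R (- x))))"
  proof (intro sum.cong refl)
    fix i :: "point \<Rightarrow> 'N" and h
    assume "h \<in> {h \<in> split_set n {1, -1} \<phi>\<^sub>R s t. \<forall>x\<in>?V. point_sgn x * h x = point_sgn (\<beta> x) * h (- \<beta> x)}"
    then have h: "h \<in> ?V \<rightarrow>\<^sub>E {1, -1}" and rel: "\<And>x. x \<in> ?V \<Longrightarrow> point_sgn x * h x = point_sgn (\<beta> x) * h (- \<beta> x)"
      by (auto simp: split_set_def)
    have "(\<Prod>k | k \<in> fin_points n \<and> - k \<in> D. h (- k) * h (\<phi>\<^sub>R k)) =
        (\<Prod>k | k \<in> fin_points n \<and> - k \<in> D. (\<lambda>x\<in>?V. h (\<phi>\<^sub>R (- x))) k * (\<lambda>x\<in>?V. h (\<phi>\<^sub>R (- x))) (- k))"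
      by (intro prod.cong refl) (simp add: fin_points_memD neg[OF \<phi>\<^sub>R])
    moreover have "(\<Prod>k\<in>fin_points n. qentry (Y k $ i (- k) $ i (\<phi>\<^sub>t k)) (h (- k)) (h (\<phi>\<^sub>R k))) =
        (\<Prod>k\<in>fin_points n. qentry (Y k $ (\<lambda>x\<in>?V. i (\<phi>\<^sub>t (- x))) k $ (\<lambda>x\<in>?V. i (\<phi>\<^sub>t (- x))) (- k))
          ((\<lambda>x\<in>?V. h (\<phi>\<^sub>R (- x))) k) ((\<lambda>x\<in>?V. h (\<phi>\<^sub>R (- x))) (- k)))"
      by (intro prod.cong refl) (simp add: fin_points_memD neg[OF \<phi>\<^sub>R] neg[OF \<phi>\<^sub>t])
    moreover have "(\<Prod>k | k \<in> fin_points n \<and> - k \<in> R. h k * h (- k)) =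
        (- 1) ^ (n + 1 + num_orbits (inf_points n) \<phi>\<^sub>R + num_orbits R \<beta> + num_orbits D p) *
        (\<Prod>k | k \<in> fin_points n \<and> - k \<in> D. h (- k) * h (\<phi>\<^sub>R k))"
      unfolding D_def p_def
      by (rule quaternion_sign_transfer[OF \<phi>\<^sub>R \<beta>(1) R]) (use PiE_mem[OF h] rel in auto)
    ultimately show "of_int (\<Prod>k | k \<in> fin_points n \<and> - k \<in> R. h k * h (- k)) *
        (\<Prod>k\<in>fin_points n. qentry (Y k $ i (- k) $ i (\<phi>\<^sub>t k)) (h (- k)) (h (\<phi>\<^sub>R k))) =
        F (\<lambda>x\<in>?V. i (\<phi>\<^sub>t (- x))) (\<lambda>x\<in>?V. h (\<phi>\<^sub>R (- x)))"
      by (simp only: F_def of_int_mult of_int_power of_int_minus of_int_1 mult.assoc)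
  qed
  also have "\<dots> = (\<Sum>i | i \<in> split_set n UNIV \<phi>\<^sub>t r c \<and> (\<forall>x\<in>?V. i x = i (- \<beta> x)).
      \<Sum>h\<in>quaternion_index_set n p s t. F (\<lambda>x\<in>?V. i (\<phi>\<^sub>t (- x))) h)"
    by (rule sum.cong[OF refl])
      (use sum_split_set_conj[OF \<phi>\<^sub>R \<beta>, where rel = "\<lambda>u v x y. u * x = v * y" and T = "{1, -1 :: int}" and b = s and a = t
        and F = "F i" for i]
       in \<open>simp add: quaternion_index_set_def p_def\<close>)
  also have "\<dots> = (\<Sum>i\<in>position_set n q r c. \<Sum>h\<in>quaternion_index_set n p s t. F i h)"
    using sum_split_set_conj[OF \<phi>\<^sub>t \<beta>, where rel = "\<lambda>u v x y. x = y" and T = UNIV and b = r and a = c and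
        F = "\<lambda>i. \<Sum>h\<in>quaternion_index_set n p s t. F i h"]
    unfolding position_set_def q_def by simp
  also have "\<dots> = ?\<sigma> * (\<Sum>i\<in>position_set n q r c. \<Sum>h\<in>quaternion_index_set n p s t.
      of_int (\<Prod>k | k \<in> fin_points n \<and> - k \<in> D. h k * h (- k)) *
      (\<Prod>k\<in>fin_points n. qentry (Y k $ i k $ i (- k)) (h k) (h (- k))))"
    unfolding F_def by (simp only: sum_distrib_left)
  finally show ?thesis
    unfolding re_tr_symmetric[OF p st] D_def[symmetric] by simp
qed

section \<open>Integrating out one of two independent families\<close>

text \<open>
  Only the total is integrable, not each term: the integral over the joint law is an iterated
  integral, and in its inner integral the factors \<open>B z y\<close> are constants.
\<close>

lemma (in prob_space) integral_sum_products_indep: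
  fixes A :: "'i \<Rightarrow> 's \<Rightarrow> complex" and B :: "'i \<Rightarrow> 's \<Rightarrow> complex"
  assumes indep: "indep_var S X T Y"
    and A: "\<And>z. z \<in> Z \<Longrightarrow> A z \<in> borel_measurable S"
    and B: "\<And>z. z \<in> Z \<Longrightarrow> B z \<in> borel_measurable T"
    and A_int: "\<And>z. z \<in> Z \<Longrightarrow> integrable M (\<lambda>\<omega>. A z (X \<omega>))"
    and total: "integrable M (\<lambda>\<omega>. \<Sum>z\<in>Z. A z (X \<omega>) * B z (Y \<omega>))"
  shows "(LINT \<omega>|M. (\<Sum>z\<in>Z. A z (X \<omega>) * B z (Y \<omega>))) =
    (LINT \<omega>|M. (\<Sum>z\<in>Z. (LINT \<omega>'|M. A z (X \<omega>')) * B z (Y \<omega>)))"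
proof -
  have X [measurable]: "X \<in> measurable M S" and Y [measurable]: "Y \<in> measurable M T"
    and prod: "distr M S X \<Otimes>\<^sub>M distr M T Y = distr M (S \<Otimes>\<^sub>M T) (\<lambda>x. (X x, Y x))"
    using indep unfolding indep_var_distribution_eq by auto
  interpret P: prob_space "distr M S X" by (rule prob_space_distr) simp
  interpret Q: prob_space "distr M T Y" by (rule prob_space_distr) simp
  interpret PQ: pair_sigma_finite "distr M S X" "distr M T Y" ..
  define f where "f x y = (\<Sum>z\<in>Z. A z x * B z y)" for x y
  have f [measurable]: "case_prod f \<in> borel_measurable (S \<Otimes>\<^sub>M T)"
    unfolding f_def using A B by measurable
  have "integrable (distr M (S \<Otimes>\<^sub>M T) (\<lambda>x. (X x, Y x))) (case_prod f)"
    using total by (subst integrable_distr_eq) (simp_all add: f_def)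
  then have "(\<integral>y. (\<integral>x. f x y \<partial>distr M S X) \<partial>distr M T Y) =
      integral\<^sup>L (distr M (S \<Otimes>\<^sub>M T) (\<lambda>x. (X x, Y x))) (case_prod f)"
    using PQ.integral_snd[of f] by (simp add: prod)
  also have "\<dots> = (LINT \<omega>|M. (\<Sum>z\<in>Z. A z (X \<omega>) * B z (Y \<omega>)))"
    by (subst integral_distr) (simp_all add: f_def)
  also have "(\<lambda>y. \<integral>x. f x y \<partial>distr M S X) = (\<lambda>y. \<Sum>z\<in>Z. (LINT \<omega>'|M. A z (X \<omega>')) * B z y)"
  proof
    fix y
    have "integrable (distr M S X) (A z)" if "z \<in> Z" for z
      using A_int[OF that] A[OF that] by (subst integrable_distr_eq) simp_all
    then have "(\<integral>x. f x y \<partial>distr M S X) = (\<Sum>z\<in>Z. (\<integral>x. A z x \<partial>distr M S X) * B z y)"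
      unfolding f_def by (subst Bochner_Integration.integral_sum) simp_all
    also have "\<dots> = (\<Sum>z\<in>Z. (LINT \<omega>'|M. A z (X \<omega>')) * B z y)"
      using A by (intro sum.cong refl) (simp add: integral_distr)
    finally show "(\<integral>x. f x y \<partial>distr M S X) = (\<Sum>z\<in>Z. (LINT \<omega>'|M. A z (X \<omega>')) * B z y)" .
  qed
  also have "(\<integral>y. (\<Sum>z\<in>Z. (LINT \<omega>'|M. A z (X \<omega>')) * B z y) \<partial>distr M T Y) =
      (LINT \<omega>|M. (\<Sum>z\<in>Z. (LINT \<omega>'|M. A z (X \<omega>')) * B z (Y \<omega>)))"
  proof (rule integral_distr[OF Y])
    show "(\<lambda>y. \<Sum>z\<in>Z. (LINT \<omega>'|M. A z (X \<omega>')) * B z y) \<in> borel_measurable T"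
      using B by measurable
  qed
  finally show ?thesis by simp
qed

lemma borel_measurable_qentry: "(\<lambda>A :: quat ^ 'n::finite ^ 'n. qentry (A $ i $ j) s t) \<in> borel_measurable borel"
proof (rule borel_measurable_continuous_onI)
  show "continuous_on UNIV (\<lambda>A :: quat ^ 'n ^ 'n. qentry (A $ i $ j) s t)"
    unfolding qentry_def Complex_eq by (cases "s = 1"; cases "t = 1") (auto intro!: continuous_intros)
qed

lemma borel_measurable_prod_qentry:
  fixes i j :: "point \<Rightarrow> 'n::finite"
  assumes "G \<subseteq> F"
  shows "(\<lambda>x. \<Prod>k\<in>G. qentry (x k $ i k $ j k) (u k) (v k)) \<in> borel_measurable (\<Pi>\<^sub>M k\<in>F. borel)"
proof (rule borel_measurable_prod)
  fix k assume "k \<in> G"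
  then have "(\<lambda>x. x k) \<in> measurable (\<Pi>\<^sub>M k\<in>F. borel) (borel :: (quat ^ 'n ^ 'n) measure)"
    using assms by (intro measurable_component_singleton) auto
  then show "(\<lambda>x. qentry (x k $ i k $ j k) (u k) (v k)) \<in> borel_measurable (\<Pi>\<^sub>M k\<in>F. borel)"
    using borel_measurable_qentry by (rule measurable_compose)
qed

lemma prod_power_int_eq:
  fixes x :: "'a :: field"
  assumes "x \<noteq> 0"
  shows "(\<Prod>c\<in>S. x powi f c) = x powi (\<Sum>c\<in>S. f c)"
  using assms by (induction S rule: infinite_finite_induct) (simp_all add: power_int_add)

lemma prod_color_classes:
  assumes "w \<in> fin_points n \<rightarrow> {1..C}"
  shows "(\<Prod>c\<in>{1..C}. \<Prod>k\<in>color_class n w c. g k) = (\<Prod>k\<in>fin_points n. g k :: 'b :: comm_monoid_mult)"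
  using assms by (intro prod.group) (auto simp: finite_inf_points)

lemma sum_card_color_classes:
  assumes "w \<in> fin_points n \<rightarrow> {1..C}"
  shows "(\<Sum>c\<in>{1..C}. card (color_class n w c)) = n"
proof -
  have "(\<Sum>c\<in>{1..C}. \<Sum>k\<in>color_class n w c. 1) = (\<Sum>k\<in>fin_points n. 1 :: nat)"
    using assms by (intro sum.group) (auto simp: finite_inf_points)
  then show ?thesis
    by (simp add: fin_points_def card_image inj_on_def)
qed

lemma moment_factorization:
  fixes X :: "nat \<Rightarrow> point \<Rightarrow> 'a \<Rightarrow> quat ^ 'N::finite ^ 'N"
  assumes M: "prob_space M"
    and X_indep:
      "prob_space.indep_vars M (\<lambda>_. \<Pi>\<^sub>M k\<in>fin_points n. borel)
         (\<lambda>c \<omega>. \<lambda>k\<in>fin_points n. X c k \<omega>) {1..C}"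
    and X_integrable:
      "\<And>c I \<iota> \<eta>. c \<in> {1..C} \<Longrightarrow> I \<subseteq> fin_points n \<Longrightarrow> \<eta> \<in> pm I \<rightarrow> {1, -1} \<Longrightarrow>
         integrable M (\<lambda>\<omega>. \<Prod>k\<in>I. qentry (X c k \<omega> $ \<iota> k $ \<iota> (- k)) (\<eta> k) (\<eta> (- k)))"
    and w: "w \<in> fin_points n \<rightarrow> {1..C}"
    and \<eta>: "\<eta> \<in> pm (fin_points n) \<rightarrow> {1, -1}"
  shows "integrable M (\<lambda>\<omega>. \<Prod>k\<in>fin_points n. qentry (X (w k) k \<omega> $ \<iota> k $ \<iota> (- k)) (\<eta> k) (\<eta> (- k)))"
    and "(LINT \<omega>|M. (\<Prod>k\<in>fin_points n. qentry (X (w k) k \<omega> $ \<iota> k $ \<iota> (- k)) (\<eta> k) (\<eta> (- k)))) =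
      (\<Prod>c\<in>{1..C}. LINT \<omega>|M. (\<Prod>k\<in>color_class n w c. qentry (X c k \<omega> $ \<iota> k $ \<iota> (- k)) (\<eta> k) (\<eta> (- k))))"
proof -
  interpret prob_space M by (rule M)
  define E where "E c x = (\<Prod>k\<in>color_class n w c. qentry (x k $ \<iota> k $ \<iota> (- k)) (\<eta> k) (\<eta> (- k)))"
    for c and x :: "point \<Rightarrow> quat ^ 'N ^ 'N"
  have E_restrict: "E c (\<lambda>k\<in>fin_points n. X c k \<omega>) = E c (\<lambda>k. X c k \<omega>)" for c \<omega>
    unfolding E_def by (intro prod.cong refl) simp
  have "E c \<in> borel_measurable (\<Pi>\<^sub>M k\<in>fin_points n. borel)" for c
    unfolding E_def by (rule borel_measurable_prod_qentry) auto
  then have "indep_vars (\<lambda>_. borel) (\<lambda>c \<omega>. E c (\<lambda>k\<in>fin_points n. X c k \<omega>)) {1..C}"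
    by (rule indep_vars_compose2[OF X_indep, of E "\<lambda>_. borel"])
  then have indep: "indep_vars (\<lambda>_. borel) (\<lambda>c \<omega>. E c (\<lambda>k. X c k \<omega>)) {1..C}"
    by (simp only: E_restrict)
  have int: "integrable M (\<lambda>\<omega>. E c (\<lambda>k. X c k \<omega>))" if "c \<in> {1..C}" for c
    unfolding E_def
  proof (rule X_integrable[OF that])
    show "\<eta> \<in> pm (color_class n w c) \<rightarrow> {1, - 1}"
      using \<eta> by (rule Pi_anti_mono[THEN subsetD, rotated]) (auto simp: pm_def)
  qed auto
  have split: "(\<Prod>k\<in>fin_points n. qentry (X (w k) k \<omega> $ \<iota> k $ \<iota> (- k)) (\<eta> k) (\<eta> (- k))) =
      (\<Prod>c\<in>{1..C}. E c (\<lambda>k. X c k \<omega>))" for \<omega>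
    unfolding E_def prod_color_classes[OF w, symmetric] by (intro prod.cong refl) simp
  show "integrable M (\<lambda>\<omega>. \<Prod>k\<in>fin_points n. qentry (X (w k) k \<omega> $ \<iota> k $ \<iota> (- k)) (\<eta> k) (\<eta> (- k)))"
    unfolding split using indep int by (intro indep_vars_integrable) auto
  show "(LINT \<omega>|M. (\<Prod>k\<in>fin_points n. qentry (X (w k) k \<omega> $ \<iota> k $ \<iota> (- k)) (\<eta> k) (\<eta> (- k)))) =
      (\<Prod>c\<in>{1..C}. LINT \<omega>|M. (\<Prod>k\<in>color_class n w c. qentry (X c k \<omega> $ \<iota> k $ \<iota> (- k)) (\<eta> k) (\<eta> (- k))))"
    unfolding split E_def[symmetric] using indep int by (intro indep_vars_lebesgue_integral) auto
qed

section \<open>Adjoints as conjugation of the pairing, and the exponents\<close>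

lemma delta_eps_involution [simp]: "delta_eps n e (delta_eps n e x) = x"
  and delta_eps_uminus: "delta_eps n e (- x) = - delta_eps n e x"
  by (auto simp: delta_eps_def)

lemma delta_eps_fin:
  assumes "k \<in> fin_points n"
  shows "delta_eps n e k = (if e k = -1 then - k else k)" "delta_eps n e (- k) = (if e k = -1 then k else - k)"
  using assms fin_points_memD(8)[OF assms] subset_pm
  by (auto simp: delta_eps_def point_abs_pos)

lemma delta_eps_infinite [simp]: "delta_eps n e Pinf = Pinf" "delta_eps n e Minf = Minf"
  by (simp_all add: delta_eps_def)

lemma delta_eps_pm: "delta_eps n e x \<in> pm S \<longleftrightarrow> x \<in> pm S"
  by (simp add: delta_eps_def)

context colored_pairing
begin

context
  fixes \<epsilon> :: "point \<Rightarrow> int"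
  assumes \<epsilon>: "\<epsilon> \<in> fin_points n \<rightarrow> {1, -1}"
begin

abbreviation "e \<equiv> delta_eps n \<epsilon>"
abbreviation "\<beta> \<equiv> e \<circ> \<alpha> \<circ> e"

lemma twisted_PM: "\<beta> \<in> PM (inf_points n)"
  and half_system_twisted: "half_system (inf_points n) \<beta> (e ` half)"
  and num_orbits_twisted: "num_orbits (e ` half) \<beta> = 1 + (\<Sum>c\<in>{1..C}. num_orbits (pm (I c)) (a c) div 2)"
  using signed_set.half_system_conj[OF signed_set_inf_points \<alpha>_PM half_system_half, of e]
  by (simp_all add: delta_eps_uminus delta_eps_pm num_orbits_half)

lemma twisted_infinite [simp]: "\<beta> Pinf = Pinf" "\<beta> Minf = Minf" "Pinf \<in> e ` half"
proof -
  have "e Pinf \<in> e ` half" by (rule imageI) (simp add: half_def)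
  then show "Pinf \<in> e ` half" by simp
qed simp_all

text \<open>
  The constraints of the moment formula at \<open>x\<close>, for the indices
  \<open>\<iota>\<close> and \<open>\<eta>\<close> read through
  \<open>\<delta>\<^sub>\<epsilon>\<close>, are those of \<open>\<beta>\<close> at
  \<open>\<delta>\<^sub>\<epsilon> x\<close>.  At infinity the constraints reduce to the two
  boundary equations.
\<close>

lemma twisted_index_conditions:
  fixes i :: "point \<Rightarrow> 'b" and h :: "point \<Rightarrow> int"
  assumes i: "i Pinf = i Minf" and h: "h Pinf = h Minf"
  defines "\<iota> \<equiv> \<lambda>x. i (e x)" and "\<eta> \<equiv> \<lambda>x. point_sgn x * point_sgn (e x) * h (e x)"
  shows "(\<forall>c\<in>{1..C}. a c \<in> moment_index_set (I c) \<iota> \<eta>) \<longleftrightarrow>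
    (\<forall>x\<in>pm (inf_points n). i x = i (- \<beta> x)) \<and>
    (\<forall>x\<in>pm (inf_points n). point_sgn x * h x = point_sgn (\<beta> x) * h (- \<beta> x))"
proof -
  have sgn: "point_sgn (- x) = - point_sgn x" if "x \<in> pm (fin_points n)" for x
    by (rule signed_set.point_sgn_uminus[OF signed_set_fin_points that])
  have \<alpha>F: "\<alpha> x \<in> pm (fin_points n)" if "x \<in> pm (fin_points n)" for x
  proof -
    have "x \<in> pm (inf_points n)" using that by (simp add: pm_inf_points)
    then have "\<alpha> x \<in> pm (inf_points n)"
      using \<alpha>_PM reversibleD(6) PM_iff[OF signed_set_inf_points] by blast
    moreover have "\<alpha> x \<noteq> Pinf" "\<alpha> x \<noteq> Minf"
    proof -
      have "inj \<alpha>" using \<alpha>_PM reversibleD(5) PM_iff[OF signed_set_inf_points] by blast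
      then show "\<alpha> x \<noteq> Pinf" "\<alpha> x \<noteq> Minf"
        using that \<alpha>_infinite infinite_notin_fin by (metis injD)+
    qed
    ultimately show ?thesis by (simp add: pm_inf_points)
  qed
  have "(\<forall>c\<in>{1..C}. a c \<in> moment_index_set (I c) \<iota> \<eta>) \<longleftrightarrow>
    (\<forall>c\<in>{1..C}. \<forall>x\<in>pm (I c). \<iota> x = \<iota> (- \<alpha> x) \<and> point_sgn x * \<eta> x = point_sgn (\<alpha> x) * \<eta> (- \<alpha> x))"
    using a by (auto simp: moment_index_set_def compose_perms_class)
  also have "\<dots> \<longleftrightarrow> (\<forall>x\<in>pm (fin_points n). \<iota> x = \<iota> (- \<alpha> x) \<and> point_sgn x * \<eta> x = point_sgn (\<alpha> x) * \<eta> (- \<alpha> x))"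
    unfolding pm_fin_points_eq[OF w] by blast
  also have "\<dots> \<longleftrightarrow> (\<forall>x\<in>pm (fin_points n). i (e x) = i (- \<beta> (e x)) \<and>
      point_sgn (e x) * h (e x) = point_sgn (\<beta> (e x)) * h (- \<beta> (e x)))"
  proof (intro ball_cong refl conj_cong)
    fix x assume x: "x \<in> pm (fin_points n)"
    have e1: "- \<beta> (e x) = e (- \<alpha> x)" by (simp add: delta_eps_uminus)
    show "(\<iota> x = \<iota> (- \<alpha> x)) = (i (e x) = i (- \<beta> (e x)))"
      unfolding e1 by (simp add: \<iota>_def)
    have "point_sgn (\<alpha> x) * \<eta> (- \<alpha> x) = point_sgn (e (\<alpha> x)) * h (e (- \<alpha> x))"
      using \<alpha>F[OF x] by (simp add: \<eta>_def sgn delta_eps_uminus delta_eps_pm mult.assoc)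
    moreover have "point_sgn x * \<eta> x = point_sgn (e x) * h (e x)"
      by (simp add: \<eta>_def mult.assoc)
    ultimately show "(point_sgn x * \<eta> x = point_sgn (\<alpha> x) * \<eta> (- \<alpha> x)) =
        (point_sgn (e x) * h (e x) = point_sgn (\<beta> (e x)) * h (- \<beta> (e x)))"
      unfolding e1 by simp
  qed
  also have "\<dots> \<longleftrightarrow> (\<forall>x\<in>pm (fin_points n). i x = i (- \<beta> x) \<and> point_sgn x * h x = point_sgn (\<beta> x) * h (- \<beta> x))"
    (is "?A \<longleftrightarrow> ?B")
  proof
    assume A: ?A
    show ?B
    proof
      fix x assume "x \<in> pm (fin_points n)"
      then have "e x \<in> pm (fin_points n)" by (simp add: delta_eps_pm)
      with A have "i (e (e x)) = i (- \<beta> (e (e x))) \<and>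
        point_sgn (e (e x)) * h (e (e x)) = point_sgn (\<beta> (e (e x))) * h (- \<beta> (e (e x)))" by (rule bspec)
      then show "i x = i (- \<beta> x) \<and> point_sgn x * h x = point_sgn (\<beta> x) * h (- \<beta> x)"
        by (simp only: delta_eps_involution)
    qed
  qed (simp add: delta_eps_pm)
  also have "\<dots> \<longleftrightarrow> (\<forall>x\<in>pm (inf_points n). i x = i (- \<beta> x)) \<and>
    (\<forall>x\<in>pm (inf_points n). point_sgn x * h x = point_sgn (\<beta> x) * h (- \<beta> x))"
    using i h by (auto simp: pm_inf_points)
  finally show ?thesis .
qed

text \<open>
  A factor \<open>h k * h (- k)\<close> comes from each adjoint and from each \<open>k\<close>
  with \<open>- k\<close> in the half system of \<open>\<alpha>\<close>.  Where both occur they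
  cancel, which is exactly where \<open>\<delta>\<^sub>\<epsilon>\<close> moves \<open>-
  k\<close> out of the half system.
\<close>

lemma twisted_sign:
  fixes h :: "point \<Rightarrow> int"
  assumes h: "\<And>x. x \<in> pm (inf_points n) \<Longrightarrow> h x \<in> {1, -1}"
  defines "\<eta> \<equiv> \<lambda>x. point_sgn x * point_sgn (e x) * h (e x)"
  shows "(\<Prod>k\<in>fin_points n. if \<epsilon> k = -1 then h k * h (- k) else 1) *
      (\<Prod>c\<in>{1..C}. \<Prod>k | k \<in> I c \<and> - k \<in> FD (I c) (a c). \<eta> k * \<eta> (- k)) =
    (\<Prod>k | k \<in> fin_points n \<and> - k \<in> e ` half. h k * h (- k))"
proof -
  have mem: "x \<in> e ` half \<longleftrightarrow> e x \<in> half" for x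
    by (auto intro: image_eqI[of _ _ "e x"])
  have half: "- k \<in> half \<longleftrightarrow> k \<notin> half" if "k \<in> fin_points n" for k
    using half_systemD(3)[OF half_system_half] fin_points_memD(2)[OF that] by blast
  have \<eta>: "\<eta> k * \<eta> (- k) = h k * h (- k)" if k: "k \<in> fin_points n" for k
    using fin_points_memD(10,11)[OF k] by (simp add: \<eta>_def delta_eps_fin[OF k])
  have "(\<Prod>c\<in>{1..C}. \<Prod>k | k \<in> I c \<and> - k \<in> FD (I c) (a c). \<eta> k * \<eta> (- k)) =
      (\<Prod>c\<in>{1..C}. \<Prod>k\<in>I c. if - k \<in> half then h k * h (- k) else 1)"
  proof (rule prod.cong[OF refl])
    fix c assume c: "c \<in> {1..C}"
    have "finite (I c)" by (simp add: finite_inf_points)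
    moreover have "- k \<in> FD (I c) (a c) \<longleftrightarrow> - k \<in> half" if "k \<in> I c" for k
      using mem_half_iff[OF c, of "- k"] that subset_pm[of "I c"] by (auto simp del: mem_Collect_eq)
    ultimately show "(\<Prod>k | k \<in> I c \<and> - k \<in> FD (I c) (a c). \<eta> k * \<eta> (- k)) =
        (\<Prod>k\<in>I c. if - k \<in> half then h k * h (- k) else 1)"
      by (subst prod.inter_filter) (auto intro!: prod.cong simp: \<eta>)
  qed
  also have "\<dots> = (\<Prod>k\<in>fin_points n. if - k \<in> half then h k * h (- k) else 1)"
    by (rule prod_color_classes[OF w])
  also have "(\<Prod>k\<in>fin_points n. if \<epsilon> k = -1 then h k * h (- k) else 1) * \<dots> =
      (\<Prod>k\<in>fin_points n. if - k \<in> e ` half then h k * h (- k) else 1)"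
    unfolding prod.distrib[symmetric]
  proof (intro prod.cong refl)
    fix k assume k: "k \<in> fin_points n"
    have "h k * h (- k) * (h k * h (- k)) = 1"
      using h[OF fin_points_memD(2)[OF k]] h[OF fin_points_memD(3)[OF k]] by auto
    then show "(if \<epsilon> k = -1 then h k * h (- k) else 1) * (if - k \<in> half then h k * h (- k) else 1) =
        (if - k \<in> e ` half then h k * h (- k) else 1)"
      unfolding mem delta_eps_fin[OF k] using half[OF k] by simp
  qed
  also have "\<dots> = (\<Prod>k | k \<in> fin_points n \<and> - k \<in> e ` half. h k * h (- k))"
    by (rule prod.inter_filter[symmetric]) (rule finite_inf_points)
  finally show ?thesis .
qed

end

end

text \<open>
  Taking the adjoint exchanges \<open>k\<close> with \<open>- k\<close>, so that
  \<open>\<delta>\<^sub>\<epsilon>\<close> acts on the indices; the product of the two point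
  signs negates the quaternion indices where the adjoint is taken.
\<close>

lemma qpow_factor:
  fixes A :: "quat ^ 'N::finite ^ 'N" and i :: "point \<Rightarrow> 'N" and h :: "point \<Rightarrow> int"
  assumes k: "k \<in> fin_points n" and \<epsilon>: "\<epsilon> k \<in> {1, -1}" and h: "h k \<in> {1, -1}" "h (- k) \<in> {1, -1}"
  defines "e \<equiv> delta_eps n \<epsilon>"
  defines "\<iota> \<equiv> \<lambda>x. i (e x)" and "\<eta> \<equiv> \<lambda>x. point_sgn x * point_sgn (e x) * h (e x)"
  shows "qentry (qpow A (\<epsilon> k) $ i k $ i (- k)) (h k) (h (- k)) =
    of_int (if \<epsilon> k = -1 then h k * h (- k) else 1) * qentry (A $ \<iota> k $ \<iota> (- k)) (\<eta> k) (\<eta> (- k))"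
  using fin_points_memD(10,11)[OF k] \<epsilon>
  by (auto simp: qentry_qpow[OF h] \<iota>_def \<eta>_def e_def delta_eps_fin[OF k])

text \<open>
  In the application \<open>b\<close>, \<open>d\<close> and \<open>d'\<close> are the cycle
  pairs of \<open>\<beta>\<close> and of the two permutations of the remaining trace,
  \<open>f\<^sub>R\<close> and \<open>f\<^sub>t\<close> the cycles of
  \<open>\<phi>\<^sub>R\<close> and \<open>\<phi>\<^sub>t\<close>, and \<open>m = n + 1\<close>.
\<close>

lemma coefficient_identity:
  fixes N :: complex
  assumes N: "N \<noteq> 0" and pos: "1 \<le> f\<^sub>R" "1 \<le> f\<^sub>t" "1 \<le> d" "1 \<le> d'"
  shows "(2 * N) powi (int b - int m) / (2 ^ (f\<^sub>R - 1) * N ^ (f\<^sub>t - 1)) *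
      ((- 1) ^ (m + f\<^sub>R + b + d) * (2 ^ (d - 1) * N ^ (d' - 1))) =
    (- 2) powi (int f\<^sub>R + int b + int d - int m - 2 * int f\<^sub>R) *
      N powi (int f\<^sub>t + int b + int d' - int m - 2 * int f\<^sub>t)"
proof -
  have step: "x powi (int f + int b + int d - int m - 2 * int f) =
      x powi (int b - int m) * x ^ (d - 1) / x ^ (f - 1)"
    if "x \<noteq> 0" "1 \<le> f" "1 \<le> d" for x :: complex and f d :: nat
  proof -
    have "int f + int b + int d - int m - 2 * int f = int b - int m + int (d - 1) - int (f - 1)"
      using that by simp
    then show ?thesis
      using that(1)
      by (simp only: power_int_add[OF disjI1] power_int_diff[OF disjI1] power_int_of_nat not_False_eq_True)
  qed
  have sgn: "(- 1 :: complex) powi (int f\<^sub>R + int b + int d - int m - 2 * int f\<^sub>R) = (- 1) ^ (m + f\<^sub>R + b + d)"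
  proof -
    have "even (int f\<^sub>R + int b + int d - int m - 2 * int f\<^sub>R) \<longleftrightarrow> even (m + f\<^sub>R + b + d)"
      by simp presburger
    then show ?thesis
      by (cases "even (m + f\<^sub>R + b + d)") (simp_all add: power_int_minus_left)
  qed
  have "(- 2 :: complex) powi (int f\<^sub>R + int b + int d - int m - 2 * int f\<^sub>R) =
      (- 1 * 2) powi (int f\<^sub>R + int b + int d - int m - 2 * int f\<^sub>R)"
    by simp
  also have "\<dots> = (- 1) ^ (m + f\<^sub>R + b + d) * (2 powi (int b - int m) * 2 ^ (d - 1) / 2 ^ (f\<^sub>R - 1))"
    unfolding power_int_mult_distrib sgn using pos step[of 2 f\<^sub>R d] by simp
  finally have two: "(- 2 :: complex) powi (int f\<^sub>R + int b + int d - int m - 2 * int f\<^sub>R) = \<dots>" .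
  show ?thesis
    unfolding two step[OF N pos(2,4)] by (simp add: power_int_mult_distrib)
qed

section \<open>The integration formula\<close>

lemma num_orbits_pos: "finite S \<Longrightarrow> S \<noteq> {} \<Longrightarrow> 1 \<le> num_orbits S p"
  by (simp add: num_orbits_def Suc_le_eq card_gt_0_iff)

lemma chi_eq:
  assumes \<phi>: "\<phi> permutes inf_points n" and \<beta>: "\<beta> \<in> PM (inf_points n)"
    and R: "half_system (inf_points n) \<beta> R"
  defines "p \<equiv> conj_perm \<phi> \<beta>"
  shows "chi (inf_points n) \<phi> \<beta> = int (num_orbits (inf_points n) \<phi>) + int (num_orbits R \<beta>) +
      int (num_orbits (FD (inf_points n) p) p) - int (n + 1)"
    and "1 \<le> num_orbits (FD (inf_points n) p) p" "1 \<le> num_orbits (inf_points n) \<phi>"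
proof -
  interpret J: signed_set "inf_points n" by (rule signed_set_inf_points)
  have r: "reversible (inf_points n) \<beta>"
    using \<beta> PM_iff[OF signed_set_inf_points] by blast
  have p: "p \<in> PM (inf_points n)"
    unfolding p_def by (rule J.conj_perm_PM[OF \<phi> \<beta>])
  then have rp: "reversible (inf_points n) p"
    using PM_iff[OF signed_set_inf_points] by blast
  have D: "half_system (inf_points n) p (FD (inf_points n) p)"
    by (rule J.half_system_FD[OF p])
  have invK: "inv (K \<phi> \<beta>) = p"
    unfolding p_def by (rule J.inv_K_eq[OF \<phi> reversibleD(1)[OF r]])
  have "K \<phi> \<beta> = inv p"
  proof -
    have V: "\<phi> permutes pm (inf_points n)" using \<phi> subset_pm by (rule permutes_subset)
    have "bij (minus_perm \<phi>)"
      unfolding minus_perm_def using permutes_bij[OF \<phi>] bij_uminus_point by (intro bij_comp)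
    then have "bij (K \<phi> \<beta>)"
      unfolding K_def using permutes_bij[OF permutes_inv[OF \<phi>]] permutes_bij[OF permutes_inv[OF reversibleD(1)[OF r]]]
      by (intro bij_comp)
    then show ?thesis
      using invK inv_inv_eq by metis
  qed
  then have "num_orbits (pm (inf_points n)) (K \<phi> \<beta>) = num_orbits (pm (inf_points n)) p"
    using num_orbits_inv[OF reversibleD(1)[OF rp]] finite_inf_points by simp
  then show "chi (inf_points n) \<phi> \<beta> = int (num_orbits (inf_points n) \<phi>) + int (num_orbits R \<beta>) +
      int (num_orbits (FD (inf_points n) p) p) - int (n + 1)"
    using J.num_orbits_half_system(2)[OF D rp] J.num_orbits_half_system(2)[OF R r]
      J.num_orbits_double_perm(2)[OF \<phi>]
    by (simp add: chi_def card_inf_points)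
  show "1 \<le> num_orbits (inf_points n) \<phi>"
    by (intro num_orbits_pos finite_inf_points) (metis empty_iff infinite_mem(3))
  have "Pinf \<in> FD (inf_points n) p"
    using permutes_self_in_orbit[OF reversibleD(1)[OF rp], of Pinf] finite_inf_points
    by (simp add: FD_def)
  moreover have "finite (FD (inf_points n) p)"
    using half_systemD(1)[OF D] finite_inf_points finite_pm finite_subset by blast
  ultimately show "1 \<le> num_orbits (FD (inf_points n) p) p"
    by (intro num_orbits_pos) auto
qed

lemma prod_qpow_factor:
  fixes A :: "point \<Rightarrow> quat ^ 'N::finite ^ 'N" and i :: "point \<Rightarrow> 'N" and h :: "point \<Rightarrow> int"
  assumes \<epsilon>: "\<epsilon> \<in> fin_points n \<rightarrow> {1, -1}" and h: "\<And>x. x \<in> pm (inf_points n) \<Longrightarrow> h x \<in> {1, -1}"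
  defines "\<iota> \<equiv> \<lambda>x. i (delta_eps n \<epsilon> x)"
    and "\<eta> \<equiv> \<lambda>x. point_sgn x * point_sgn (delta_eps n \<epsilon> x) * h (delta_eps n \<epsilon> x)"
  shows "(\<Prod>k\<in>fin_points n. qentry (qpow (A k) (\<epsilon> k) $ i k $ i (- k)) (h k) (h (- k))) =
    of_int (\<Prod>k\<in>fin_points n. if \<epsilon> k = -1 then h k * h (- k) else 1) *
    (\<Prod>k\<in>fin_points n. qentry (A k $ \<iota> k $ \<iota> (- k)) (\<eta> k) (\<eta> (- k)))"
  unfolding of_int_prod prod.distrib[symmetric] \<iota>_def \<eta>_def
  using \<epsilon> h fin_points_memD(2,3) by (intro prod.cong refl qpow_factor) blast+

text \<open>
  By independence the moment factors over the colours, and the product of the sums over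
  \<open>PM\<close> of each colour class is a sum over families of pairings.
\<close>

lemma moment_expansion:
  fixes X :: "nat \<Rightarrow> point \<Rightarrow> 'a \<Rightarrow> quat ^ 'N::finite ^ 'N"
    and f :: "nat \<Rightarrow> point set \<Rightarrow> (point \<Rightarrow> point) \<Rightarrow> complex"
    and i :: "point \<Rightarrow> 'N" and h :: "point \<Rightarrow> int"
  assumes M: "prob_space M"
    and X_indep:
      "prob_space.indep_vars M (\<lambda>_. \<Pi>\<^sub>M k\<in>fin_points n. borel)
         (\<lambda>c \<omega>. \<lambda>k\<in>fin_points n. X c k \<omega>) {1..C}"
    and X_integrable:
      "\<And>c I \<iota> \<eta>. c \<in> {1..C} \<Longrightarrow> I \<subseteq> fin_points n \<Longrightarrow> \<eta> \<in> pm I \<rightarrow> {1, -1} \<Longrightarrow>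
         integrable M (\<lambda>\<omega>. \<Prod>k\<in>I. qentry (X c k \<omega> $ \<iota> k $ \<iota> (- k)) (\<eta> k) (\<eta> (- k)))"
    and X_moments:
      "\<And>c I \<iota> \<eta>. c \<in> {1..C} \<Longrightarrow> I \<subseteq> fin_points n \<Longrightarrow> \<eta> \<in> pm I \<rightarrow> {1, -1} \<Longrightarrow>
         (LINT \<omega>|M. (\<Prod>k\<in>I. qentry (X c k \<omega> $ \<iota> k $ \<iota> (- k)) (\<eta> k) (\<eta> (- k)))) =
         (\<Sum>\<alpha>\<in>moment_index_set I \<iota> \<eta>.
            (\<Prod>k | k \<in> I \<and> - k \<in> FD I \<alpha>. of_int (\<eta> k * \<eta> (- k)))
            * (2 * of_nat CARD('N)) powi (int (num_orbits (pm I) \<alpha> div 2) - int (card I))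
            * f c I \<alpha>)"
    and w: "w \<in> fin_points n \<rightarrow> {1..C}"
    and \<epsilon>: "\<epsilon> \<in> fin_points n \<rightarrow> {1, -1}"
    and i: "i Pinf = i Minf"
    and h: "\<And>x. x \<in> pm (inf_points n) \<Longrightarrow> h x \<in> {1, -1}" "h Pinf = h Minf"
  defines "\<beta> \<equiv> \<lambda>a. delta_eps n \<epsilon> \<circ> compose_perms C a \<circ> delta_eps n \<epsilon>"
    and "R \<equiv> \<lambda>a. delta_eps n \<epsilon> ` colored_pairing.half n C w a"
  shows "integrable M (\<lambda>\<omega>. \<Prod>k\<in>fin_points n. qentry (qpow (X (w k) k \<omega>) (\<epsilon> k) $ i k $ i (- k)) (h k) (h (- k)))"
    and "(LINT \<omega>|M. (\<Prod>k\<in>fin_points n. qentry (qpow (X (w k) k \<omega>) (\<epsilon> k) $ i k $ i (- k)) (h k) (h (- k)))) =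
      (\<Sum>a \<in> (\<Pi>\<^sub>E d\<in>{1..C}. PM (color_class n w d)).
        if (\<forall>x\<in>pm (inf_points n). i x = i (- \<beta> a x)) \<and>
          (\<forall>x\<in>pm (inf_points n). point_sgn x * h x = point_sgn (\<beta> a x) * h (- \<beta> a x))
        then of_int (\<Prod>k | k \<in> fin_points n \<and> - k \<in> R a. h k * h (- k)) *
          ((2 * of_nat CARD('N)) powi (int (num_orbits (R a) (\<beta> a)) - int (n + 1)) *
            (\<Prod>d\<in>{1..C}. f d (color_class n w d) (a d)))
        else 0)"
proof -
  let ?I = "color_class n w"
  let ?P = "\<Pi>\<^sub>E d\<in>{1..C}. PM (?I d)"
  define \<iota> where "\<iota> x = i (delta_eps n \<epsilon> x)" for x
  define \<eta> where "\<eta> x = point_sgn x * point_sgn (delta_eps n \<epsilon> x) * h (delta_eps n \<epsilon> x)" for x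
  define S where "S = (\<Prod>k\<in>fin_points n. if \<epsilon> k = -1 then h k * h (- k) else 1)"
  define g where "g c \<alpha> = (\<Prod>k | k \<in> ?I c \<and> - k \<in> FD (?I c) \<alpha>. complex_of_int (\<eta> k * \<eta> (- k))) *
      (2 * of_nat CARD('N)) powi (int (num_orbits (pm (?I c)) \<alpha> div 2) - int (card (?I c))) * f c (?I c) \<alpha>"
    for c \<alpha>
  have \<eta>_mem: "\<eta> x \<in> {1, -1}" if "x \<in> pm (fin_points n)" for x
    unfolding \<eta>_def using that
    by (intro sign_mult_mem point_sgn_cases h(1)) (simp add: delta_eps_pm pm_inf_points)
  have \<eta>: "\<eta> \<in> pm (fin_points n) \<rightarrow> {1, -1}"
    using \<eta>_mem by (rule Pi_I)
  have factor: "(\<Prod>k\<in>fin_points n. qentry (qpow (X (w k) k \<omega>) (\<epsilon> k) $ i k $ i (- k)) (h k) (h (- k))) =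
      of_int S * (\<Prod>k\<in>fin_points n. qentry (X (w k) k \<omega> $ \<iota> k $ \<iota> (- k)) (\<eta> k) (\<eta> (- k)))" for \<omega>
    unfolding S_def \<iota>_def \<eta>_def by (rule prod_qpow_factor[OF \<epsilon> h(1)])
  note fact = moment_factorization[OF M X_indep X_integrable w \<eta>, of \<iota>]
  show "integrable M (\<lambda>\<omega>. \<Prod>k\<in>fin_points n. qentry (qpow (X (w k) k \<omega>) (\<epsilon> k) $ i k $ i (- k)) (h k) (h (- k)))"
    unfolding factor by (intro integrable_mult_right fact(1))
  have "(LINT \<omega>|M. (\<Prod>k\<in>fin_points n. qentry (qpow (X (w k) k \<omega>) (\<epsilon> k) $ i k $ i (- k)) (h k) (h (- k)))) =
      of_int S * (\<Prod>c\<in>{1..C}. LINT \<omega>|M. (\<Prod>k\<in>?I c. qentry (X c k \<omega> $ \<iota> k $ \<iota> (- k)) (\<eta> k) (\<eta> (- k))))"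
    unfolding factor by (simp only: integral_mult_right_zero fact(2))
  also have "(\<Prod>c\<in>{1..C}. LINT \<omega>|M. (\<Prod>k\<in>?I c. qentry (X c k \<omega> $ \<iota> k $ \<iota> (- k)) (\<eta> k) (\<eta> (- k)))) =
      (\<Prod>c\<in>{1..C}. \<Sum>\<alpha>\<in>PM (?I c). if \<alpha> \<in> moment_index_set (?I c) \<iota> \<eta> then g c \<alpha> else 0)"
  proof (rule prod.cong[OF refl])
    fix c assume c: "c \<in> {1..C}"
    have "\<eta> \<in> pm (?I c) \<rightarrow> {1, -1}"
      using \<eta> by (rule Pi_anti_mono[THEN subsetD, rotated]) (auto simp: pm_def)
    then have "(LINT \<omega>|M. (\<Prod>k\<in>?I c. qentry (X c k \<omega> $ \<iota> k $ \<iota> (- k)) (\<eta> k) (\<eta> (- k)))) =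
        (\<Sum>\<alpha>\<in>moment_index_set (?I c) \<iota> \<eta>. g c \<alpha>)"
      unfolding g_def by (intro X_moments c) auto
    also have "moment_index_set (?I c) \<iota> \<eta> = {\<alpha> \<in> PM (?I c). \<alpha> \<in> moment_index_set (?I c) \<iota> \<eta>}"
      by (auto simp: moment_index_set_def)
    also have "(\<Sum>\<alpha>\<in>\<dots>. g c \<alpha>) = (\<Sum>\<alpha>\<in>PM (?I c). if \<alpha> \<in> moment_index_set (?I c) \<iota> \<eta> then g c \<alpha> else 0)"
      by (rule sum.inter_filter) (simp add: finite_PM finite_inf_points)
    finally show "(LINT \<omega>|M. (\<Prod>k\<in>?I c. qentry (X c k \<omega> $ \<iota> k $ \<iota> (- k)) (\<eta> k) (\<eta> (- k)))) = \<dots>" .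
  qed
  also have "\<dots> = (\<Sum>a\<in>?P. \<Prod>c\<in>{1..C}. if a c \<in> moment_index_set (?I c) \<iota> \<eta> then g c (a c) else 0)"
    by (rule prod_sum_PiE) (simp_all add: finite_PM finite_inf_points)
  also have "of_int S * \<dots> = (\<Sum>a\<in>?P.
        if (\<forall>x\<in>pm (inf_points n). i x = i (- \<beta> a x)) \<and>
          (\<forall>x\<in>pm (inf_points n). point_sgn x * h x = point_sgn (\<beta> a x) * h (- \<beta> a x))
        then of_int (\<Prod>k | k \<in> fin_points n \<and> - k \<in> R a. h k * h (- k)) *
          ((2 * of_nat CARD('N)) powi (int (num_orbits (R a) (\<beta> a)) - int (n + 1)) *
            (\<Prod>d\<in>{1..C}. f d (color_class n w d) (a d)))
        else 0)"
    unfolding sum_distrib_left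
  proof (rule sum.cong[OF refl])
    fix a assume "a \<in> ?P"
    then interpret colored_pairing n C w a
      using w by unfold_locales (auto dest: PiE_mem)
    have cond: "(\<forall>c\<in>{1..C}. a c \<in> moment_index_set (?I c) \<iota> \<eta>) \<longleftrightarrow>
        (\<forall>x\<in>pm (inf_points n). i x = i (- \<beta> a x)) \<and>
        (\<forall>x\<in>pm (inf_points n). point_sgn x * h x = point_sgn (\<beta> a x) * h (- \<beta> a x))"
      unfolding \<iota>_def \<eta>_def \<beta>_def by (rule twisted_index_conditions[OF \<epsilon> i h(2)])
    have "of_int S * (\<Prod>c\<in>{1..C}. g c (a c)) =
        of_int (S * (\<Prod>c\<in>{1..C}. \<Prod>k | k \<in> ?I c \<and> - k \<in> FD (?I c) (a c). \<eta> k * \<eta> (- k))) *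
        ((\<Prod>c\<in>{1..C}. (2 * of_nat CARD('N)) powi (int (num_orbits (pm (?I c)) (a c) div 2) - int (card (?I c)))) *
          (\<Prod>d\<in>{1..C}. f d (?I d) (a d)))"
      by (simp only: g_def prod.distrib of_int_mult of_int_prod mult.assoc)
    also have "S * (\<Prod>c\<in>{1..C}. \<Prod>k | k \<in> ?I c \<and> - k \<in> FD (?I c) (a c). \<eta> k * \<eta> (- k)) =
        (\<Prod>k | k \<in> fin_points n \<and> - k \<in> R a. h k * h (- k))"
      unfolding S_def \<eta>_def R_def by (rule twisted_sign[OF \<epsilon> h(1)])
    also have "(\<Prod>c\<in>{1..C}. (2 * of_nat CARD('N)) powi (int (num_orbits (pm (?I c)) (a c) div 2) - int (card (?I c)))) =
        (2 * of_nat CARD('N) :: complex) powi (int (num_orbits (R a) (\<beta> a)) - int (n + 1))"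
    proof -
      have "(\<Sum>c\<in>{1..C}. int (num_orbits (pm (?I c)) (a c) div 2) - int (card (?I c))) =
          int (\<Sum>c\<in>{1..C}. num_orbits (pm (?I c)) (a c) div 2) - int (\<Sum>c\<in>{1..C}. card (?I c))"
        by (simp only: sum_subtractf of_nat_sum)
      also have "\<dots> = int (num_orbits (R a) (\<beta> a)) - int (n + 1)"
        unfolding sum_card_color_classes[OF w] R_def \<beta>_def num_orbits_twisted[OF \<epsilon>] by simp
      finally show ?thesis
        by (subst prod_power_int_eq) simp_all
    qed
    finally have "of_int S * (\<Prod>c\<in>{1..C}. g c (a c)) =
        of_int (\<Prod>k | k \<in> fin_points n \<and> - k \<in> R a. h k * h (- k)) *
          ((2 * of_nat CARD('N)) powi (int (num_orbits (R a) (\<beta> a)) - int (n + 1)) *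
            (\<Prod>d\<in>{1..C}. f d (?I d) (a d)))" .
    moreover have "(\<Prod>c\<in>{1..C}. if a c \<in> moment_index_set (?I c) \<iota> \<eta> then g c (a c) else 0) =
        (if \<forall>c\<in>{1..C}. a c \<in> moment_index_set (?I c) \<iota> \<eta> then \<Prod>c\<in>{1..C}. g c (a c) else 0)"
    proof (cases "\<forall>c\<in>{1..C}. a c \<in> moment_index_set (?I c) \<iota> \<eta>")
      case False
      then obtain c where "c \<in> {1..C}" "a c \<notin> moment_index_set (?I c) \<iota> \<eta>" by blast
      then show ?thesis using False by (subst prod_zero) auto
    qed (auto intro!: prod.cong)
    ultimately show "of_int S * (\<Prod>c\<in>{1..C}. if a c \<in> moment_index_set (?I c) \<iota> \<eta> then g c (a c) else 0) =
        (if (\<forall>x\<in>pm (inf_points n). i x = i (- \<beta> a x)) \<and>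
          (\<forall>x\<in>pm (inf_points n). point_sgn x * h x = point_sgn (\<beta> a x) * h (- \<beta> a x))
        then of_int (\<Prod>k | k \<in> fin_points n \<and> - k \<in> R a. h k * h (- k)) *
          ((2 * of_nat CARD('N)) powi (int (num_orbits (R a) (\<beta> a)) - int (n + 1)) *
            (\<Prod>d\<in>{1..C}. f d (color_class n w d) (a d)))
        else 0)"
      unfolding cond by simp
  qed
  finally show "(LINT \<omega>|M. (\<Prod>k\<in>fin_points n. qentry (qpow (X (w k) k \<omega>) (\<epsilon> k) $ i k $ i (- k)) (h k) (h (- k)))) = \<dots>" .
qed

lemma finite_split_set: "finite T \<Longrightarrow> finite (split_set n T \<phi> b a)"
  by (rule finite_subset[of _ "pm (inf_points n) \<rightarrow>\<^sub>E T"])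
    (auto simp: split_set_def finite_inf_points intro!: finite_PiE)

theorem proposition3p2:
  fixes M :: "'a measure"
    and n C :: nat
    and X :: "nat \<Rightarrow> point \<Rightarrow> 'a \<Rightarrow> quat ^ 'N::finite ^ 'N"
    and Y :: "point \<Rightarrow> 'a \<Rightarrow> quat ^ 'N ^ 'N"
    and f :: "nat \<Rightarrow> point set \<Rightarrow> (point \<Rightarrow> point) \<Rightarrow> complex"
    and w :: "point \<Rightarrow> nat"
    and \<epsilon> :: "point \<Rightarrow> int"
    and \<phi>\<^sub>R \<phi>\<^sub>t :: "point \<Rightarrow> point"
  assumes "prob_space M"
    and "n \<ge> 1" and "C \<ge> 1"
    and X_indep:
      "prob_space.indep_vars M (\<lambda>_. \<Pi>\<^sub>M k\<in>fin_points n. borel)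
         (\<lambda>c \<omega>. \<lambda>k\<in>fin_points n. X c k \<omega>) {1..C}"
    and X_integrable:
      "\<And>c I \<iota> \<eta>. c \<in> {1..C} \<Longrightarrow> I \<subseteq> fin_points n \<Longrightarrow> \<eta> \<in> pm I \<rightarrow> {1, -1} \<Longrightarrow>
         integrable M (\<lambda>\<omega>. \<Prod>k\<in>I. qentry (X c k \<omega> $ \<iota> k $ \<iota> (- k)) (\<eta> k) (\<eta> (- k)))"
    and X_moments:
      "\<And>c I \<iota> \<eta>. c \<in> {1..C} \<Longrightarrow> I \<subseteq> fin_points n \<Longrightarrow> \<eta> \<in> pm I \<rightarrow> {1, -1} \<Longrightarrow>
         (LINT \<omega>|M. (\<Prod>k\<in>I. qentry (X c k \<omega> $ \<iota> k $ \<iota> (- k)) (\<eta> k) (\<eta> (- k)))) =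
         (\<Sum>\<alpha>\<in>moment_index_set I \<iota> \<eta>.
            (\<Prod>k | k \<in> I \<and> - k \<in> FD I \<alpha>. of_int (\<eta> k * \<eta> (- k)))
            * (2 * of_nat CARD('N)) powi (int (num_orbits (pm I) \<alpha> div 2) - int (card I))
            * f c I \<alpha>)"
    and w: "w \<in> fin_points n \<rightarrow> {1..C}"
    and Y_indep:
      "prob_space.indep_var M
         (\<Pi>\<^sub>M k\<in>fin_points n. borel) (\<lambda>\<omega>. \<lambda>k\<in>fin_points n. X (w k) k \<omega>)
         (\<Pi>\<^sub>M k\<in>fin_points n. borel) (\<lambda>\<omega>. \<lambda>k\<in>fin_points n. Y k \<omega>)"
    and \<epsilon>: "\<epsilon> \<in> fin_points n \<rightarrow> {1, -1}"
    and "\<phi>\<^sub>R permutes inf_points n" and "\<phi>\<^sub>t permutes inf_points n"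
    and lhs_integrable:
      "\<And>r c s t. s \<in> {1, -1} \<Longrightarrow> t \<in> {1, -1} \<Longrightarrow>
         integrable M (\<lambda>\<omega>. re_tr_perm n \<phi>\<^sub>R \<phi>\<^sub>t
           (\<lambda>k. qmm (qpow (X (w k) k \<omega>) (\<epsilon> k)) (Y k \<omega>)) r c s t)"
    and rhs_integrable:
      "\<And>a \<beta> r c s t.
         a \<in> (\<Pi>\<^sub>E d\<in>{1..C}. PM {k \<in> fin_points n. w k = d}) \<Longrightarrow>
         \<beta> = delta_eps n \<epsilon> \<circ> compose_perms C a \<circ> delta_eps n \<epsilon> \<Longrightarrow>
         s \<in> {1, -1} \<Longrightarrow> t \<in> {1, -1} \<Longrightarrow>
         integrable M (\<lambda>\<omega>. re_tr n (inv (K \<phi>\<^sub>R \<beta>)) (inv (K \<phi>\<^sub>t \<beta>)) (\<lambda>k. Y k \<omega>) r c s t)"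
  shows
    "\<forall>r c. \<forall>s\<in>{1, -1}. \<forall>t\<in>{1, -1}.
       (LINT \<omega>|M. re_tr_perm n \<phi>\<^sub>R \<phi>\<^sub>t
           (\<lambda>k. qmm (qpow (X (w k) k \<omega>) (\<epsilon> k)) (Y k \<omega>)) r c s t) =
       (\<Sum>a \<in> (\<Pi>\<^sub>E d\<in>{1..C}. PM {k \<in> fin_points n. w k = d}).
          let \<beta> = delta_eps n \<epsilon> \<circ> compose_perms C a \<circ> delta_eps n \<epsilon> in
          (- 2) powi (chi (inf_points n) \<phi>\<^sub>R \<beta> - 2 * int (num_orbits (inf_points n) \<phi>\<^sub>R))
          * of_nat CARD('N) powi
              (chi (inf_points n) \<phi>\<^sub>t \<beta> - 2 * int (num_orbits (inf_points n) \<phi>\<^sub>t))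
          * (\<Prod>d\<in>{1..C}. f d {k \<in> fin_points n. w k = d} (a d))
          * (LINT \<omega>|M. re_tr n (inv (K \<phi>\<^sub>R \<beta>)) (inv (K \<phi>\<^sub>t \<beta>)) (\<lambda>k. Y k \<omega>) r c s t))"
proof (intro allI ballI)
  fix r c :: 'N and s t :: int
  assume st: "s \<in> {1, -1}" "t \<in> {1, -1}"
  note \<phi>\<^sub>R = \<open>\<phi>\<^sub>R permutes inf_points n\<close> and \<phi>\<^sub>t = \<open>\<phi>\<^sub>t permutes inf_points n\<close>
  interpret prob_space M by (rule \<open>prob_space M\<close>)
  let ?J = "inf_points n" and ?F = "fin_points n" and ?V = "pm (inf_points n)"
  let ?P = "\<Pi>\<^sub>E d\<in>{1..C}. PM (color_class n w d)"
  let ?N = "of_nat CARD('N) :: complex"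
  define \<beta> where "\<beta> a = delta_eps n \<epsilon> \<circ> compose_perms C a \<circ> delta_eps n \<epsilon>" for a
  define R where "R a = delta_eps n \<epsilon> ` colored_pairing.half n C w a" for a
  define Z where "Z = split_set n (UNIV :: 'N set) \<phi>\<^sub>t r c \<times> split_set n {1, -1 :: int} \<phi>\<^sub>R s t"
  \<comment> \<open>The normalisation \<open>k\<^sub>0\<close> goes with the factor \<open>A\<close>, so that the sum of the \<open>A z * B z\<close> is the trace itself.\<close>
  define k\<^sub>0 where "k\<^sub>0 = 2 ^ (num_orbits ?J \<phi>\<^sub>R - 1) * ?N ^ (num_orbits ?J \<phi>\<^sub>t - 1)"
  define A where "A z x = (\<Prod>k\<in>?F. qentry (qpow (x k) (\<epsilon> k) $ fst z k $ fst z (- k)) (snd z k) (snd z (- k))) / k\<^sub>0"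
    for z :: "(point \<Rightarrow> 'N) \<times> (point \<Rightarrow> int)" and x
  define B where "B z y = (\<Prod>k\<in>?F. qentry (y k $ fst z (- k) $ fst z (\<phi>\<^sub>t k)) (snd z (- k)) (snd z (\<phi>\<^sub>R k)))"
    for z :: "(point \<Rightarrow> 'N) \<times> (point \<Rightarrow> int)" and y :: "point \<Rightarrow> quat ^ 'N ^ 'N"
  \<comment> \<open>The moment of \<open>X\<close> at the indices \<open>z\<close> is the sum of \<open>\<sigma> a * w\<^sub>a a\<close> over the families \<open>a\<close> whose constraints \<open>I\<^sub>a\<close> and \<open>H\<^sub>a\<close> hold.\<close>
  define w\<^sub>a where "w\<^sub>a a = (2 * ?N) powi (int (num_orbits (R a) (\<beta> a)) - int (n + 1)) *
      (\<Prod>d\<in>{1..C}. f d (color_class n w d) (a d))" for a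
  define I\<^sub>a where "I\<^sub>a a i \<longleftrightarrow> (\<forall>x\<in>?V. i x = i (- \<beta> a x))" for a and i :: "point \<Rightarrow> 'N"
  define H\<^sub>a where "H\<^sub>a a h \<longleftrightarrow> (\<forall>x\<in>?V. point_sgn x * h x = point_sgn (\<beta> a x) * h (- \<beta> a x))" for a and h :: "point \<Rightarrow> int"
  define \<sigma> where "\<sigma> a h = complex_of_int (\<Prod>k | k \<in> ?F \<and> - k \<in> R a. h k * h (- k))" for a h
  have hZ: "snd z x \<in> {1, -1}" if "z \<in> Z" "x \<in> ?V" for z x
    using that PiE_mem[of "snd z" ?V "\<lambda>_. {1, -1}"] unfolding Z_def split_set_def by auto
  have iZ: "fst z Pinf = fst z Minf" "snd z Pinf = snd z Minf" if "z \<in> Z" for z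
    using that by (auto simp: Z_def split_set_def)

  have A_restrict: "A z (\<lambda>k\<in>?F. x k) = A z x" and B_restrict: "B z (\<lambda>k\<in>?F. y k) = B z y" for z x y
    unfolding A_def B_def by (simp_all cong: prod.cong)
  have A_int: "integrable M (\<lambda>\<omega>. A z (\<lambda>k. X (w k) k \<omega>))"
    and A_exp: "(LINT \<omega>|M. A z (\<lambda>k. X (w k) k \<omega>)) =
      (\<Sum>a\<in>?P. if I\<^sub>a a (fst z) \<and> H\<^sub>a a (snd z) then \<sigma> a (snd z) * w\<^sub>a a else 0) / k\<^sub>0"
    if z: "z \<in> Z" for z
  proof -
    note exp = moment_expansion[where i = "fst z" and h = "snd z", OF \<open>prob_space M\<close> X_indep X_integrable X_moments w \<epsilon> iZ(1)[OF z] hZ[OF z] iZ(2)[OF z]]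
    show "integrable M (\<lambda>\<omega>. A z (\<lambda>k. X (w k) k \<omega>))"
      unfolding A_def by (intro integrable_divide_zero exp(1))
    show "(LINT \<omega>|M. A z (\<lambda>k. X (w k) k \<omega>)) =
      (\<Sum>a\<in>?P. if I\<^sub>a a (fst z) \<and> H\<^sub>a a (snd z) then \<sigma> a (snd z) * w\<^sub>a a else 0) / k\<^sub>0"
      unfolding A_def integral_divide_zero I\<^sub>a_def H\<^sub>a_def \<sigma>_def w\<^sub>a_def \<beta>_def R_def
      by (rule arg_cong[where f = "\<lambda>x. x / k\<^sub>0"], rule exp(2))
  qed
  have lhs: "re_tr_perm n \<phi>\<^sub>R \<phi>\<^sub>t (\<lambda>k. qmm (qpow (X (w k) k \<omega>) (\<epsilon> k)) (Y k \<omega>)) r c s t =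
      (\<Sum>z\<in>Z. A z (\<lambda>k\<in>?F. X (w k) k \<omega>) * B z (\<lambda>k\<in>?F. Y k \<omega>))" for \<omega>
    unfolding re_tr_perm_qmm[OF \<phi>\<^sub>R \<phi>\<^sub>t st] A_restrict B_restrict Z_def sum.cartesian_product[symmetric]
    by (simp add: A_def B_def k\<^sub>0_def sum_divide_distrib split_beta sum.cartesian_product)
  have remaining: "(\<Sum>z\<in>Z. (LINT \<omega>'|M. A z (\<lambda>k. X (w k) k \<omega>')) * B z y) =
      (\<Sum>a\<in>?P. (- 2) powi (chi ?J \<phi>\<^sub>R (\<beta> a) - 2 * int (num_orbits ?J \<phi>\<^sub>R)) *
        ?N powi (chi ?J \<phi>\<^sub>t (\<beta> a) - 2 * int (num_orbits ?J \<phi>\<^sub>t)) *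
        (\<Prod>d\<in>{1..C}. f d (color_class n w d) (a d)) *
        re_tr n (inv (K \<phi>\<^sub>R (\<beta> a))) (inv (K \<phi>\<^sub>t (\<beta> a))) y r c s t)" for y
  proof -
    have "(\<Sum>z\<in>Z. (LINT \<omega>'|M. A z (\<lambda>k. X (w k) k \<omega>')) * B z y) =
        (\<Sum>z\<in>Z. \<Sum>a\<in>?P. w\<^sub>a a / k\<^sub>0 * (if I\<^sub>a a (fst z) \<and> H\<^sub>a a (snd z) then \<sigma> a (snd z) * B z y else 0))"
    proof (rule sum.cong[OF refl])
      fix z assume z: "z \<in> Z"
      show "(LINT \<omega>'|M. A z (\<lambda>k. X (w k) k \<omega>')) * B z y =
          (\<Sum>a\<in>?P. w\<^sub>a a / k\<^sub>0 * (if I\<^sub>a a (fst z) \<and> H\<^sub>a a (snd z) then \<sigma> a (snd z) * B z y else 0))"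
        unfolding A_exp[OF z] sum_divide_distrib sum_distrib_right by (rule sum.cong[OF refl]) simp
    qed
    also have "\<dots> = (\<Sum>a\<in>?P. \<Sum>z\<in>Z. w\<^sub>a a / k\<^sub>0 * (if I\<^sub>a a (fst z) \<and> H\<^sub>a a (snd z) then \<sigma> a (snd z) * B z y else 0))"
      by (rule sum.swap)
    also have "\<dots> = (\<Sum>a\<in>?P. (- 2) powi (chi ?J \<phi>\<^sub>R (\<beta> a) - 2 * int (num_orbits ?J \<phi>\<^sub>R)) *
        ?N powi (chi ?J \<phi>\<^sub>t (\<beta> a) - 2 * int (num_orbits ?J \<phi>\<^sub>t)) *
        (\<Prod>d\<in>{1..C}. f d (color_class n w d) (a d)) *
        re_tr n (inv (K \<phi>\<^sub>R (\<beta> a))) (inv (K \<phi>\<^sub>t (\<beta> a))) y r c s t)"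
    proof (rule sum.cong[OF refl])
      fix a assume "a \<in> ?P"
      then interpret a: colored_pairing n C w a
        using w by unfold_locales (auto dest: PiE_mem)
      interpret J: signed_set ?J by (rule signed_set_inf_points)
      have \<beta>: "\<beta> a \<in> PM ?J" "half_system ?J (\<beta> a) (R a)" "\<beta> a Pinf = Pinf" "Pinf \<in> R a"
        unfolding \<beta>_def R_def
        using a.twisted_PM[OF \<epsilon>] a.half_system_twisted[OF \<epsilon>] a.twisted_infinite[OF \<epsilon>] by simp_all
      let ?p = "conj_perm \<phi>\<^sub>R (\<beta> a)" and ?q = "conj_perm \<phi>\<^sub>t (\<beta> a)"
      let ?d = "num_orbits (FD ?J ?p) ?p" and ?d' = "num_orbits (FD ?J ?q) ?q"
      have perm: "\<beta> a permutes ?V"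
        using \<beta>(1) by (simp add: PM_def)
      have "(\<Sum>z\<in>Z. if I\<^sub>a a (fst z) \<and> H\<^sub>a a (snd z) then \<sigma> a (snd z) * B z y else 0) =
          (\<Sum>i\<in>split_set n UNIV \<phi>\<^sub>t r c. if I\<^sub>a a i then
            \<Sum>h\<in>split_set n {1, -1} \<phi>\<^sub>R s t. if H\<^sub>a a h then \<sigma> a h * B (i, h) y else 0 else 0)"
        unfolding Z_def sum.cartesian_product' fst_conv snd_conv by (rule sum.cong[OF refl]) simp
      also have "\<dots> = (\<Sum>i | i \<in> split_set n UNIV \<phi>\<^sub>t r c \<and> I\<^sub>a a i.
          \<Sum>h | h \<in> split_set n {1, -1} \<phi>\<^sub>R s t \<and> H\<^sub>a a h. \<sigma> a h * B (i, h) y)"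
        by (simp add: sum.inter_filter finite_split_set)
      also have "\<dots> = (- 1) ^ (n + 1 + num_orbits ?J \<phi>\<^sub>R + num_orbits (R a) (\<beta> a) + ?d) *
          (2 ^ (?d - 1) * ?N ^ (?d' - 1)) * re_tr n ?p ?q y r c s t"
        using remaining_trace[OF \<phi>\<^sub>R \<phi>\<^sub>t \<beta>(1,3,2,4) st, of y r c]
        by (simp only: I\<^sub>a_def H\<^sub>a_def \<sigma>_def B_def fst_conv snd_conv)
      finally have sum_z: "(\<Sum>z\<in>Z. if I\<^sub>a a (fst z) \<and> H\<^sub>a a (snd z) then \<sigma> a (snd z) * B z y else 0) = \<dots>" .
      have coeff: "(2 * ?N) powi (int (num_orbits (R a) (\<beta> a)) - int (n + 1)) / k\<^sub>0 *
          ((- 1) ^ (n + 1 + num_orbits ?J \<phi>\<^sub>R + num_orbits (R a) (\<beta> a) + ?d) * (2 ^ (?d - 1) * ?N ^ (?d' - 1))) =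
          (- 2) powi (chi ?J \<phi>\<^sub>R (\<beta> a) - 2 * int (num_orbits ?J \<phi>\<^sub>R)) *
          ?N powi (chi ?J \<phi>\<^sub>t (\<beta> a) - 2 * int (num_orbits ?J \<phi>\<^sub>t))"
        unfolding k\<^sub>0_def chi_eq(1)[OF \<phi>\<^sub>R \<beta>(1,2)] chi_eq(1)[OF \<phi>\<^sub>t \<beta>(1,2)]
        by (rule coefficient_identity)
          (simp_all add: chi_eq(2,3)[OF \<phi>\<^sub>R \<beta>(1,2), simplified] chi_eq(2,3)[OF \<phi>\<^sub>t \<beta>(1,2), simplified])
      show "(\<Sum>z\<in>Z. w\<^sub>a a / k\<^sub>0 * (if I\<^sub>a a (fst z) \<and> H\<^sub>a a (snd z) then \<sigma> a (snd z) * B z y else 0)) =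
          (- 2) powi (chi ?J \<phi>\<^sub>R (\<beta> a) - 2 * int (num_orbits ?J \<phi>\<^sub>R)) *
          ?N powi (chi ?J \<phi>\<^sub>t (\<beta> a) - 2 * int (num_orbits ?J \<phi>\<^sub>t)) *
          (\<Prod>d\<in>{1..C}. f d (color_class n w d) (a d)) *
          re_tr n (inv (K \<phi>\<^sub>R (\<beta> a))) (inv (K \<phi>\<^sub>t (\<beta> a))) y r c s t"
        unfolding sum_distrib_left[symmetric] sum_z J.inv_K_eq[OF \<phi>\<^sub>R perm] J.inv_K_eq[OF \<phi>\<^sub>t perm]
          coeff[symmetric] w\<^sub>a_def
        by simp
    qed
    finally show ?thesis .
  qed
  have "(LINT \<omega>|M. re_tr_perm n \<phi>\<^sub>R \<phi>\<^sub>t (\<lambda>k. qmm (qpow (X (w k) k \<omega>) (\<epsilon> k)) (Y k \<omega>)) r c s t) =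
      (LINT \<omega>|M. (\<Sum>z\<in>Z. (LINT \<omega>'|M. A z (\<lambda>k\<in>?F. X (w k) k \<omega>')) * B z (\<lambda>k\<in>?F. Y k \<omega>)))"
    unfolding lhs
  proof (rule integral_sum_products_indep[OF Y_indep])
    fix z assume z: "z \<in> Z"
    show "A z \<in> borel_measurable (\<Pi>\<^sub>M k\<in>?F. borel)"
    proof -
      let ?e = "delta_eps n \<epsilon>"
      let ?i = "\<lambda>x. fst z (?e x)" and ?h = "\<lambda>x. point_sgn x * point_sgn (?e x) * snd z (?e x)"
      have "A z = (\<lambda>x. of_int (\<Prod>k\<in>?F. if \<epsilon> k = -1 then snd z k * snd z (- k) else 1) *
          (\<Prod>k\<in>?F. qentry (x k $ ?i k $ ?i (- k)) (?h k) (?h (- k))) / k\<^sub>0)"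
        unfolding A_def
        by (rule ext, rule arg_cong[where f = "\<lambda>u. u / k\<^sub>0"], rule prod_qpow_factor[OF \<epsilon> hZ[OF z]])
      then show ?thesis
        by (simp only:) (intro borel_measurable_divide borel_measurable_times borel_measurable_const
          borel_measurable_prod_qentry order.refl)
    qed
    show "B z \<in> borel_measurable (\<Pi>\<^sub>M k\<in>?F. borel)"
      unfolding B_def by (rule borel_measurable_prod_qentry) simp
    show "integrable M (\<lambda>\<omega>. A z (\<lambda>k\<in>?F. X (w k) k \<omega>))"
      unfolding A_restrict by (rule A_int[OF z])
  next
    show "integrable M (\<lambda>\<omega>. \<Sum>z\<in>Z. A z (\<lambda>k\<in>?F. X (w k) k \<omega>) * B z (\<lambda>k\<in>?F. Y k \<omega>))"
      using lhs_integrable[OF st, of r c] unfolding lhs .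
  qed
  also have "\<dots> = (LINT \<omega>|M. (\<Sum>a\<in>?P. (- 2) powi (chi ?J \<phi>\<^sub>R (\<beta> a) - 2 * int (num_orbits ?J \<phi>\<^sub>R)) *
        ?N powi (chi ?J \<phi>\<^sub>t (\<beta> a) - 2 * int (num_orbits ?J \<phi>\<^sub>t)) *
        (\<Prod>d\<in>{1..C}. f d (color_class n w d) (a d)) *
        re_tr n (inv (K \<phi>\<^sub>R (\<beta> a))) (inv (K \<phi>\<^sub>t (\<beta> a))) (\<lambda>k. Y k \<omega>) r c s t))"
    unfolding A_restrict B_restrict remaining ..
  also have "\<dots> = (\<Sum>a\<in>?P. (- 2) powi (chi ?J \<phi>\<^sub>R (\<beta> a) - 2 * int (num_orbits ?J \<phi>\<^sub>R)) *
        ?N powi (chi ?J \<phi>\<^sub>t (\<beta> a) - 2 * int (num_orbits ?J \<phi>\<^sub>t)) *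
        (\<Prod>d\<in>{1..C}. f d (color_class n w d) (a d)) *
        (LINT \<omega>|M. re_tr n (inv (K \<phi>\<^sub>R (\<beta> a))) (inv (K \<phi>\<^sub>t (\<beta> a))) (\<lambda>k. Y k \<omega>) r c s t))"
    using rhs_integrable[OF _ \<beta>_def st]
    by (subst Bochner_Integration.integral_sum) (simp_all add: integrable_mult_right)
  finally show "(LINT \<omega>|M. re_tr_perm n \<phi>\<^sub>R \<phi>\<^sub>t
           (\<lambda>k. qmm (qpow (X (w k) k \<omega>) (\<epsilon> k)) (Y k \<omega>)) r c s t) =
       (\<Sum>a \<in> (\<Pi>\<^sub>E d\<in>{1..C}. PM {k \<in> fin_points n. w k = d}).
          let \<beta> = delta_eps n \<epsilon> \<circ> compose_perms C a \<circ> delta_eps n \<epsilon> in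
          (- 2) powi (chi (inf_points n) \<phi>\<^sub>R \<beta> - 2 * int (num_orbits (inf_points n) \<phi>\<^sub>R))
          * of_nat CARD('N) powi
              (chi (inf_points n) \<phi>\<^sub>t \<beta> - 2 * int (num_orbits (inf_points n) \<phi>\<^sub>t))
          * (\<Prod>d\<in>{1..C}. f d {k \<in> fin_points n. w k = d} (a d))
          * (LINT \<omega>|M. re_tr n (inv (K \<phi>\<^sub>R \<beta>)) (inv (K \<phi>\<^sub>t \<beta>)) (\<lambda>k. Y k \<omega>) r c s t))"
    unfolding \<beta>_def Let_def .
qed

end
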